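(* Let $(V,\delta_V)$ be a (coassociative, counitary) coalgebra over a field $\mathbb{K}$, with counit $\epsilon_V$ and Sweedler notation $\delta_V(v)=v'\otimes v''$. The twisted bialgebra $(\mathbf{T}_V,m,\Delta)$ of tensors is given a structure of double twisted bialgebra by the coproduct $\delta$ defined, for every finite set $X$ and all $(v_x)_{x\in X}\in V^X$, by \[\delta_X\Big(\bigotimes_{x\in X}v_x\Big)=\Big(\bigotimes_{x\in X}v'_x\Big)\otimes\Big(\bigotimes_{x\in X}v''_x\Big).\] The counit $\epsilon_\delta$ of $\delta$ sends $\bigotimes_{x\in X}v_x$ to $\prod_{x\in X}\epsilon_V(v_x)$.
   Context: A species $\mathbf{P}$ is a functor from the category of finite sets with bijections to $\mathbb{K}$-vector spaces, written $X\mapsto\mathbf{P}[X]$, $\sigma\mapsto\mathbf{P}[\sigma]$; $\sqcup$ is disjoint union and $c$ denotes the flip $x\otimes y\mapsto y\otimes x$. The species $\mathbf{T}_V$: $\mathbf{T}_V[X]=V^{\otimes X}$ is the unordered tensor product of copies of $V$ indexed by the finite set $X$ (the universal target of multilinear maps from $V^X$), spanned by the tensors $\bigotimes_{x\in X}v_x$; $\mathbf{T}_V[\emptyset]=\mathbb{K}$; for a bijection $\sigma:X\to Y$, $\mathbf{T}_V[\sigma](\bigotimes_{x\in X}v_x)=\bigotimes_{y\in Y}v_{\sigma^{-1}(y)}$. Its twisted bialgebra structure is $m_{X,Y}(\bigotimes_{x\in X}v_x\otimes\bigotimes_{y\in Y}v_y)=\bigotimes_{z\in X\sqcup Y}v_z$,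 $\Delta_{X,Y}(\bigotimes_{z\in X\sqcup Y}v_z)=\bigotimes_{x\in X}v_x\otimes\bigotimes_{y\in Y}v_y$, with unit $1\in\mathbb{K}=\mathbf{T}_V[\emptyset]$ and counit $\varepsilon_\Delta=\mathrm{Id}_{\mathbb{K}}$. Twisted algebra $(\mathbf{P},m)$: linear maps $m_{X,Y}:\mathbf{P}[X]\otimes\mathbf{P}[Y]\to\mathbf{P}[X\sqcup Y]$, natural in bijections of $X$ and $Y$, associative, with a unit $1_{\mathbf{P}}\in\mathbf{P}[\emptyset]$. Twisted coalgebra $(\mathbf{P},\Delta)$: linear maps $\Delta_{X,Y}:\mathbf{P}[X\sqcup Y]\to\mathbf{P}[X]\otimes\mathbf{P}[Y]$, natural in bijections, with $(\Delta_{X,Y}\otimes\mathrm{Id})\circ\Delta_{X\sqcup Y,Z}=(\mathrm{Id}\otimes\Delta_{Y,Z})\circ\Delta_{X,Y\sqcup Z}$ and a counit $\varepsilon_\Delta:\mathbf{P}[\emptyset]\to\mathbb{K}$. Twisted bialgebra: both, such that whenever $I\sqcup J=I'\sqcup J'$, $\Delta_{I,J}\circ m_{I',J'}=(m_{I'\cap I,J'\cap I}\otimes m_{I'\cap J,J'\cap J})\circ(\mathrm{Id}\otimes c\otimes\mathrm{Id})\circ(\Delta_{I'\cap I,I'\cap J}\otimes\Delta_{J'\cap I,J'\cap J})$, $\Delta_{\emptyset,\emptyset}(1_{\mathbf{P}})=1_{\mathbf{P}}\otimes1_{\mathbf{P}}$, and $\varepsilon_\Delta$ is multiplicative and unital on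 $\mathbf{P}[\emptyset]$. Double twisted bialgebra $(\mathbf{P},m,\Delta,\delta)$: (1) $(\mathbf{P},m,\Delta)$ is a twisted bialgebra with unit $1_{\mathbf{P}}$ and counit $\varepsilon_\Delta$; (2) for every finite set $X$, $\delta_X:\mathbf{P}[X]\to\mathbf{P}[X]\otimes\mathbf{P}[X]$ is a coassociative coproduct with a counit $\epsilon_X$, $\delta_X$ and $\epsilon_X$ being natural in bijections; $\delta_{X\sqcup Y}\circ m_{X,Y}=(m_{X,Y}\otimes m_{X,Y})\circ(\mathrm{Id}\otimes c\otimes\mathrm{Id})\circ(\delta_X\otimes\delta_Y)$ and $\delta_\emptyset(1_{\mathbf{P}})=1_{\mathbf{P}}\otimes1_{\mathbf{P}}$; (3) for all finite $X,Y$, $m_{1,3,24}\circ(\delta_X\otimes\delta_Y)\circ\Delta_{X,Y}=(\Delta_{X,Y}\otimes\mathrm{Id})\circ\delta_{X\sqcup Y}$, where $m_{1,3,24}(a\otimes b\otimes a'\otimes b')=a\otimes a'\otimes m_{X,Y}(b\otimes b')$, and $(\varepsilon_\Delta\otimes\mathrm{Id})\circ\delta_\emptyset(x)=\varepsilon_\Delta(x)1_{\mathbf{P}}$ for $x\in\mathbf{P}[\emptyset]$. *)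

theory Defs
  imports "HOL-Algebra.AbelCoset" "Jordan_Normal_Form.Missing_VectorSpace"
begin

section \<open>Vector spaces by generators and relations\<close>

text \<open>The library type \<open>module\<close> extends \<open>ring\<close>; the fields \<open>mult\<close> and \<open>one\<close> play no role in
  the predicates \<open>vectorspace\<close> and \<open>module_hom\<close>, and are left undefined below.\<close>

definition free_vs :: "'k ring \<Rightarrow> 's set \<Rightarrow> ('k, 's \<Rightarrow> 'k) module" where
  "free_vs K S = \<lparr>
     carrier = {p. (\<forall>s. p s \<in> carrier K) \<and> (\<forall>s. s \<notin> S \<longrightarrow> p s = \<zero>\<^bsub>K\<^esub>) \<and> finite {s. p s \<noteq> \<zero>\<^bsub>K\<^esub>}},
     mult = undefined, one = undefined,
     zero = (\<lambda>s. \<zero>\<^bsub>K\<^esub>),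
     add = (\<lambda>p q s. p s \<oplus>\<^bsub>K\<^esub> q s),
     smult = (\<lambda>r p s. r \<otimes>\<^bsub>K\<^esub> p s)\<rparr>"

definition free_gen :: "'k ring \<Rightarrow> 's \<Rightarrow> 's \<Rightarrow> 'k" where
  "free_gen K s = (\<lambda>t. if t = s then \<one>\<^bsub>K\<^esub> else \<zero>\<^bsub>K\<^esub>)"

definition quot_vs :: "('k, 'm) module \<Rightarrow> 'm set \<Rightarrow> ('k, 'm set) module" where
  "quot_vs M N = \<lparr>
     carrier = a_rcosets\<^bsub>M\<^esub> N,
     mult = undefined, one = undefined,
     zero = N,
     add = set_add M,
     smult = (\<lambda>r C. \<Union>c\<in>C. N +>\<^bsub>M\<^esub> (r \<odot>\<^bsub>M\<^esub> c))\<rparr>"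

text \<open>The vector space generated by \<open>S\<close> subject to the relations \<open>r = 0\<close> for \<open>r \<in> R\<close>, and the
  class of a generator.\<close>

definition pres_vs :: "'k ring \<Rightarrow> 's set \<Rightarrow> ('s \<Rightarrow> 'k) set \<Rightarrow> ('k, ('s \<Rightarrow> 'k) set) module" where
  "pres_vs K S R = quot_vs (free_vs K S) (module.span K (free_vs K S) R)"

definition pres_gen :: "'k ring \<Rightarrow> 's set \<Rightarrow> ('s \<Rightarrow> 'k) set \<Rightarrow> 's \<Rightarrow> ('s \<Rightarrow> 'k) set" where
  "pres_gen K S R s = module.span K (free_vs K S) R +>\<^bsub>free_vs K S\<^esub> free_gen K s"

text \<open>The linear map into \<open>W\<close> that sends the class of each generator \<open>s\<close> to \<open>g s\<close>, computed on a
  representative; it is independent of the representative whenever \<open>g\<close> respects the relations.\<close>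

definition pres_lift :: "'k ring \<Rightarrow> ('k, 'w) module \<Rightarrow> ('s \<Rightarrow> 'w) \<Rightarrow> ('s \<Rightarrow> 'k) set \<Rightarrow> 'w" where
  "pres_lift K W g C =
     (let p = (SOME p. p \<in> C) in \<Oplus>\<^bsub>W\<^esub>s\<in>{s. p s \<noteq> \<zero>\<^bsub>K\<^esub>}. p s \<odot>\<^bsub>W\<^esub> g s)"

definition self_vs :: "'k ring \<Rightarrow> ('k, 'k) module" where
  "self_vs K = \<lparr>carrier = carrier K, mult = mult K, one = \<one>\<^bsub>K\<^esub>, zero = \<zero>\<^bsub>K\<^esub>,
     add = add K, smult = mult K\<rparr>"


section \<open>Binary tensor products\<close>

definition tensor_rel ::
    "'k ring \<Rightarrow> ('k, 'a) module \<Rightarrow> ('k, 'b) module \<Rightarrow> ('a \<times> 'b \<Rightarrow> 'k) set" where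
  "tensor_rel K A B = (let F = free_vs K (carrier A \<times> carrier B); e = free_gen K in
      {e (a \<oplus>\<^bsub>A\<^esub> a', b) \<ominus>\<^bsub>F\<^esub> (e (a, b) \<oplus>\<^bsub>F\<^esub> e (a', b)) | a a' b.
         a \<in> carrier A \<and> a' \<in> carrier A \<and> b \<in> carrier B}
    \<union> {e (a, b \<oplus>\<^bsub>B\<^esub> b') \<ominus>\<^bsub>F\<^esub> (e (a, b) \<oplus>\<^bsub>F\<^esub> e (a, b')) | a b b'.
         a \<in> carrier A \<and> b \<in> carrier B \<and> b' \<in> carrier B}
    \<union> {e (r \<odot>\<^bsub>A\<^esub> a, b) \<ominus>\<^bsub>F\<^esub> r \<odot>\<^bsub>F\<^esub> e (a, b) | r a b.
         r \<in> carrier K \<and> a \<in> carrier A \<and> b \<in> carrier B}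
    \<union> {e (a, r \<odot>\<^bsub>B\<^esub> b) \<ominus>\<^bsub>F\<^esub> r \<odot>\<^bsub>F\<^esub> e (a, b) | r a b.
         r \<in> carrier K \<and> a \<in> carrier A \<and> b \<in> carrier B})"

definition tensor :: "'k ring \<Rightarrow> ('k, 'a) module \<Rightarrow> ('k, 'b) module
    \<Rightarrow> ('k, ('a \<times> 'b \<Rightarrow> 'k) set) module"  (infixl \<open>\<boxtimes>\<index>\<close> 75) where
  "A \<boxtimes>\<^bsub>K\<^esub> B = pres_vs K (carrier A \<times> carrier B) (tensor_rel K A B)"

definition pure :: "'k ring \<Rightarrow> ('k, 'a) module \<Rightarrow> ('k, 'b) module
    \<Rightarrow> 'a \<Rightarrow> 'b \<Rightarrow> ('a \<times> 'b \<Rightarrow> 'k) set" where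
  "pure K A B a b = pres_gen K (carrier A \<times> carrier B) (tensor_rel K A B) (a, b)"

text \<open>The map \<open>f \<otimes> g\<close>, where \<open>C\<close> and \<open>D\<close> are the codomains of \<open>f\<close> and \<open>g\<close>.\<close>

definition tmap :: "'k ring \<Rightarrow> ('k, 'c) module \<Rightarrow> ('k, 'd) module \<Rightarrow> ('a \<Rightarrow> 'c) \<Rightarrow> ('b \<Rightarrow> 'd)
    \<Rightarrow> ('a \<times> 'b \<Rightarrow> 'k) set \<Rightarrow> ('c \<times> 'd \<Rightarrow> 'k) set" where
  "tmap K C D f g = pres_lift K (C \<boxtimes>\<^bsub>K\<^esub> D) (\<lambda>(a, b). pure K C D (f a) (g b))"

text \<open>The canonical isomorphisms \<open>(A \<otimes> B) \<otimes> C \<rightarrow> A \<otimes> (B \<otimes> C)\<close>, \<open>K \<otimes> A \<rightarrow> A\<close> and \<open>A \<otimes> K \<rightarrow> A\<close>.\<close>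

definition tassoc :: "'k ring \<Rightarrow> ('k, 'a) module \<Rightarrow> ('k, 'b) module \<Rightarrow> ('k, 'c) module
    \<Rightarrow> (('a \<times> 'b \<Rightarrow> 'k) set \<times> 'c \<Rightarrow> 'k) set \<Rightarrow> ('a \<times> ('b \<times> 'c \<Rightarrow> 'k) set \<Rightarrow> 'k) set" where
  "tassoc K A B C = (let W = A \<boxtimes>\<^bsub>K\<^esub> (B \<boxtimes>\<^bsub>K\<^esub> C) in
     pres_lift K W (\<lambda>(s, c). pres_lift K W
       (\<lambda>(a, b). pure K A (B \<boxtimes>\<^bsub>K\<^esub> C) a (pure K B C b c)) s))"

definition lunit :: "'k ring \<Rightarrow> ('k, 'a) module \<Rightarrow> ('k \<times> 'a \<Rightarrow> 'k) set \<Rightarrow> 'a" where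
  "lunit K A = pres_lift K A (\<lambda>(r, a). r \<odot>\<^bsub>A\<^esub> a)"

definition runit :: "'k ring \<Rightarrow> ('k, 'a) module \<Rightarrow> ('a \<times> 'k \<Rightarrow> 'k) set \<Rightarrow> 'a" where
  "runit K A = pres_lift K A (\<lambda>(a, r). r \<odot>\<^bsub>A\<^esub> a)"

text \<open>The map \<open>Id \<otimes> c \<otimes> Id\<close> from \<open>(A \<otimes> B) \<otimes> (C \<otimes> D)\<close> to \<open>(A \<otimes> C) \<otimes> (B \<otimes> D)\<close>, which sends
  \<open>(a \<otimes> b) \<otimes> (c \<otimes> d)\<close> to \<open>(a \<otimes> c) \<otimes> (b \<otimes> d)\<close>.\<close>

definition mid_flip :: "'k ring \<Rightarrow> ('k, 'a) module \<Rightarrow> ('k, 'b) module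
    \<Rightarrow> ('k, 'c) module \<Rightarrow> ('k, 'd) module
    \<Rightarrow> (('a \<times> 'b \<Rightarrow> 'k) set \<times> ('c \<times> 'd \<Rightarrow> 'k) set \<Rightarrow> 'k) set
    \<Rightarrow> (('a \<times> 'c \<Rightarrow> 'k) set \<times> ('b \<times> 'd \<Rightarrow> 'k) set \<Rightarrow> 'k) set" where
  "mid_flip K A B C D = (let W = (A \<boxtimes>\<^bsub>K\<^esub> C) \<boxtimes>\<^bsub>K\<^esub> (B \<boxtimes>\<^bsub>K\<^esub> D) in
     pres_lift K W (\<lambda>(s, t). pres_lift K W (\<lambda>(a, b). pres_lift K W
       (\<lambda>(c, d). pure K (A \<boxtimes>\<^bsub>K\<^esub> C) (B \<boxtimes>\<^bsub>K\<^esub> D) (pure K A C a c) (pure K B D b d)) t) s))"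


section \<open>Coalgebras\<close>

locale coalgebra =
  fixes K :: "'k ring" and V :: "('k, 'v) module"
    and \<delta> :: "'v \<Rightarrow> ('v \<times> 'v \<Rightarrow> 'k) set" and \<epsilon> :: "'v \<Rightarrow> 'k"
  assumes vs: "vectorspace K V"
    and coproduct_hom: "\<delta> \<in> module_hom K V (V \<boxtimes>\<^bsub>K\<^esub> V)"
    and counit_hom: "\<epsilon> \<in> module_hom K V (self_vs K)"
    and coassoc: "v \<in> carrier V \<Longrightarrow>
      tassoc K V V V (tmap K (V \<boxtimes>\<^bsub>K\<^esub> V) V \<delta> id (\<delta> v)) = tmap K V (V \<boxtimes>\<^bsub>K\<^esub> V) id \<delta> (\<delta> v)"
    and counit_left: "v \<in> carrier V \<Longrightarrow> lunit K V (tmap K (self_vs K) V \<epsilon> id (\<delta> v)) = v"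
    and counit_right: "v \<in> carrier V \<Longrightarrow> runit K V (tmap K V (self_vs K) id \<epsilon> (\<delta> v)) = v"


section \<open>Species and twisted structures\<close>

text \<open>The finite sets are the finite subsets of an arbitrary type \<open>'x\<close>. A disjoint union \<open>X \<squnion> Y\<close> is
  the union of sets \<open>X\<close>, \<open>Y\<close> with \<open>X \<inter> Y = {}\<close>. A bijection \<open>\<sigma> : X \<rightarrow> Y\<close> is given by a total function
  of which only the values on \<open>X\<close> matter (\<open>act_cong\<close>); its codomain is determined as \<open>\<sigma> ` X\<close>, so
  \<open>P[\<sigma>]\<close> is written \<open>act X \<sigma>\<close>.\<close>

locale species =
  fixes K :: "'k ring" and P :: "'x set \<Rightarrow> ('k, 'p) module"
    and act :: "'x set \<Rightarrow> ('x \<Rightarrow> 'x) \<Rightarrow> 'p \<Rightarrow> 'p"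
  assumes field_K: "field K"
    and vs: "finite X \<Longrightarrow> vectorspace K (P X)"
    and act_hom: "\<lbrakk>finite X; bij_betw \<sigma> X Y\<rbrakk> \<Longrightarrow> act X \<sigma> \<in> module_hom K (P X) (P Y)"
    and act_cong: "\<lbrakk>finite X; bij_betw \<sigma> X Y; \<And>x. x \<in> X \<Longrightarrow> \<sigma> x = \<tau> x; p \<in> carrier (P X)\<rbrakk> \<Longrightarrow>
      act X \<sigma> p = act X \<tau> p"
    and act_id: "\<lbrakk>finite X; p \<in> carrier (P X)\<rbrakk> \<Longrightarrow> act X id p = p"
    and act_comp: "\<lbrakk>finite X; bij_betw \<sigma> X Y; bij_betw \<tau> Y Z; p \<in> carrier (P X)\<rbrakk> \<Longrightarrow>
      act X (\<tau> \<circ> \<sigma>) p = act Y \<tau> (act X \<sigma> p)"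

definition glue :: "'x set \<Rightarrow> ('x \<Rightarrow> 'a) \<Rightarrow> ('x \<Rightarrow> 'a) \<Rightarrow> 'x \<Rightarrow> 'a" where
  "glue X f g = (\<lambda>z. if z \<in> X then f z else g z)"

locale twisted_algebra = species K P act
  for K :: "'k ring" and P :: "'x set \<Rightarrow> ('k, 'p) module" and act +
  fixes m :: "'x set \<Rightarrow> 'x set \<Rightarrow> ('p \<times> 'p \<Rightarrow> 'k) set \<Rightarrow> 'p" and unit :: 'p
  assumes m_hom: "\<lbrakk>finite X; finite Y; X \<inter> Y = {}\<rbrakk> \<Longrightarrow>
      m X Y \<in> module_hom K (P X \<boxtimes>\<^bsub>K\<^esub> P Y) (P (X \<union> Y))"
    and m_natural: "\<lbrakk>finite X; finite Y; X \<inter> Y = {}; X' \<inter> Y' = {};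
        bij_betw \<sigma> X X'; bij_betw \<tau> Y Y'; t \<in> carrier (P X \<boxtimes>\<^bsub>K\<^esub> P Y)\<rbrakk> \<Longrightarrow>
      act (X \<union> Y) (glue X \<sigma> \<tau>) (m X Y t) = m X' Y' (tmap K (P X') (P Y') (act X \<sigma>) (act Y \<tau>) t)"
    and m_assoc: "\<lbrakk>finite X; finite Y; finite Z; X \<inter> Y = {}; X \<inter> Z = {}; Y \<inter> Z = {};
        u \<in> carrier ((P X \<boxtimes>\<^bsub>K\<^esub> P Y) \<boxtimes>\<^bsub>K\<^esub> P Z)\<rbrakk> \<Longrightarrow>
      m (X \<union> Y) Z (tmap K (P (X \<union> Y)) (P Z) (m X Y) id u) =
      m X (Y \<union> Z) (tmap K (P X) (P (Y \<union> Z)) id (m Y Z) (tassoc K (P X) (P Y) (P Z) u))"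
    and unit_carrier: "unit \<in> carrier (P {})"
    and unit_left: "\<lbrakk>finite X; p \<in> carrier (P X)\<rbrakk> \<Longrightarrow> m {} X (pure K (P {}) (P X) unit p) = p"
    and unit_right: "\<lbrakk>finite X; p \<in> carrier (P X)\<rbrakk> \<Longrightarrow> m X {} (pure K (P X) (P {}) p unit) = p"

locale twisted_coalgebra = species K P act
  for K :: "'k ring" and P :: "'x set \<Rightarrow> ('k, 'p) module" and act +
  fixes \<Delta> :: "'x set \<Rightarrow> 'x set \<Rightarrow> 'p \<Rightarrow> ('p \<times> 'p \<Rightarrow> 'k) set" and \<epsilon>\<Delta> :: "'p \<Rightarrow> 'k"
  assumes \<Delta>_hom: "\<lbrakk>finite X; finite Y; X \<inter> Y = {}\<rbrakk> \<Longrightarrow>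
      \<Delta> X Y \<in> module_hom K (P (X \<union> Y)) (P X \<boxtimes>\<^bsub>K\<^esub> P Y)"
    and \<Delta>_natural: "\<lbrakk>finite X; finite Y; X \<inter> Y = {}; X' \<inter> Y' = {};
        bij_betw \<sigma> X X'; bij_betw \<tau> Y Y'; p \<in> carrier (P (X \<union> Y))\<rbrakk> \<Longrightarrow>
      \<Delta> X' Y' (act (X \<union> Y) (glue X \<sigma> \<tau>) p) = tmap K (P X') (P Y') (act X \<sigma>) (act Y \<tau>) (\<Delta> X Y p)"
    and \<Delta>_coassoc: "\<lbrakk>finite X; finite Y; finite Z; X \<inter> Y = {}; X \<inter> Z = {}; Y \<inter> Z = {};
        p \<in> carrier (P (X \<union> Y \<union> Z))\<rbrakk> \<Longrightarrow>
      tassoc K (P X) (P Y) (P Z) (tmap K (P X \<boxtimes>\<^bsub>K\<^esub> P Y) (P Z) (\<Delta> X Y) id (\<Delta> (X \<union> Y) Z p)) =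
      tmap K (P X) (P Y \<boxtimes>\<^bsub>K\<^esub> P Z) id (\<Delta> Y Z) (\<Delta> X (Y \<union> Z) p)"
    and \<epsilon>\<Delta>_hom: "\<epsilon>\<Delta> \<in> module_hom K (P {}) (self_vs K)"
    and \<epsilon>\<Delta>_left: "\<lbrakk>finite X; p \<in> carrier (P X)\<rbrakk> \<Longrightarrow>
      lunit K (P X) (tmap K (self_vs K) (P X) \<epsilon>\<Delta> id (\<Delta> {} X p)) = p"
    and \<epsilon>\<Delta>_right: "\<lbrakk>finite X; p \<in> carrier (P X)\<rbrakk> \<Longrightarrow>
      runit K (P X) (tmap K (P X) (self_vs K) id \<epsilon>\<Delta> (\<Delta> X {} p)) = p"

locale twisted_bialgebra =
  twisted_algebra K P act m unit + twisted_coalgebra K P act \<Delta> \<epsilon>\<Delta>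
  for K :: "'k ring" and P :: "'x set \<Rightarrow> ('k, 'p) module" and act m unit \<Delta> \<epsilon>\<Delta> +
  assumes \<Delta>_m: "\<lbrakk>finite I; finite J; I \<inter> J = {}; I' \<inter> J' = {}; I \<union> J = I' \<union> J';
        t \<in> carrier (P I' \<boxtimes>\<^bsub>K\<^esub> P J')\<rbrakk> \<Longrightarrow>
      \<Delta> I J (m I' J' t) =
      tmap K (P I) (P J) (m (I' \<inter> I) (J' \<inter> I)) (m (I' \<inter> J) (J' \<inter> J))
        (mid_flip K (P (I' \<inter> I)) (P (I' \<inter> J)) (P (J' \<inter> I)) (P (J' \<inter> J))
          (tmap K (P (I' \<inter> I) \<boxtimes>\<^bsub>K\<^esub> P (I' \<inter> J)) (P (J' \<inter> I) \<boxtimes>\<^bsub>K\<^esub> P (J' \<inter> J))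
            (\<Delta> (I' \<inter> I) (I' \<inter> J)) (\<Delta> (J' \<inter> I) (J' \<inter> J)) t))"
    and \<Delta>_unit: "\<Delta> {} {} unit = pure K (P {}) (P {}) unit unit"
    and \<epsilon>\<Delta>_m: "\<lbrakk>p \<in> carrier (P {}); q \<in> carrier (P {})\<rbrakk> \<Longrightarrow>
      \<epsilon>\<Delta> (m {} {} (pure K (P {}) (P {}) p q)) = \<epsilon>\<Delta> p \<otimes>\<^bsub>K\<^esub> \<epsilon>\<Delta> q"
    and \<epsilon>\<Delta>_unit: "\<epsilon>\<Delta> unit = \<one>\<^bsub>K\<^esub>"

locale double_twisted_bialgebra =
  twisted_bialgebra K P act m unit \<Delta> \<epsilon>\<Delta>
  for K :: "'k ring" and P :: "'x set \<Rightarrow> ('k, 'p) module" and act m unit \<Delta> \<epsilon>\<Delta> +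
  fixes \<delta> :: "'x set \<Rightarrow> 'p \<Rightarrow> ('p \<times> 'p \<Rightarrow> 'k) set" and \<epsilon> :: "'x set \<Rightarrow> 'p \<Rightarrow> 'k"
  assumes coalgebra: "finite X \<Longrightarrow> coalgebra K (P X) (\<delta> X) (\<epsilon> X)"
    and \<delta>_natural: "\<lbrakk>finite X; bij_betw \<sigma> X Y; p \<in> carrier (P X)\<rbrakk> \<Longrightarrow>
      \<delta> Y (act X \<sigma> p) = tmap K (P Y) (P Y) (act X \<sigma>) (act X \<sigma>) (\<delta> X p)"
    and \<epsilon>_natural: "\<lbrakk>finite X; bij_betw \<sigma> X Y; p \<in> carrier (P X)\<rbrakk> \<Longrightarrow> \<epsilon> Y (act X \<sigma> p) = \<epsilon> X p"
    and \<delta>_m: "\<lbrakk>finite X; finite Y; X \<inter> Y = {}; t \<in> carrier (P X \<boxtimes>\<^bsub>K\<^esub> P Y)\<rbrakk> \<Longrightarrow>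
      \<delta> (X \<union> Y) (m X Y t) =
      tmap K (P (X \<union> Y)) (P (X \<union> Y)) (m X Y) (m X Y)
        (mid_flip K (P X) (P X) (P Y) (P Y)
          (tmap K (P X \<boxtimes>\<^bsub>K\<^esub> P X) (P Y \<boxtimes>\<^bsub>K\<^esub> P Y) (\<delta> X) (\<delta> Y) t))"
    and \<delta>_unit: "\<delta> {} unit = pure K (P {}) (P {}) unit unit"
    \<comment> \<open>\<open>m\<^sub>1\<^sub>,\<^sub>3\<^sub>,\<^sub>2\<^sub>4\<close> is \<open>(Id \<otimes> m X Y) \<circ> mid_flip\<close>\<close>
    and \<Delta>_\<delta>: "\<lbrakk>finite X; finite Y; X \<inter> Y = {}; p \<in> carrier (P (X \<union> Y))\<rbrakk> \<Longrightarrow>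
      tmap K (P X \<boxtimes>\<^bsub>K\<^esub> P Y) (P (X \<union> Y)) id (m X Y)
        (mid_flip K (P X) (P X) (P Y) (P Y)
          (tmap K (P X \<boxtimes>\<^bsub>K\<^esub> P X) (P Y \<boxtimes>\<^bsub>K\<^esub> P Y) (\<delta> X) (\<delta> Y) (\<Delta> X Y p))) =
      tmap K (P X \<boxtimes>\<^bsub>K\<^esub> P Y) (P (X \<union> Y)) (\<Delta> X Y) id (\<delta> (X \<union> Y) p)"
    and \<epsilon>\<Delta>_\<delta>: "p \<in> carrier (P {}) \<Longrightarrow>
      lunit K (P {}) (tmap K (self_vs K) (P {}) \<epsilon>\<Delta> id (\<delta> {} p)) = \<epsilon>\<Delta> p \<odot>\<^bsub>P {}\<^esub> unit"


section \<open>The species of tensors\<close>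

text \<open>The unordered tensor product \<open>V\<^sup>\<otimes>\<^sup>X\<close>: generators are the families \<open>(v\<^sub>x)\<^sub>x\<^sub>\<in>\<^sub>X\<close>, relations express
  linearity in each of the slots.\<close>

definition T_rel :: "'k ring \<Rightarrow> ('k, 'v) module \<Rightarrow> 'x set \<Rightarrow> (('x \<Rightarrow> 'v) \<Rightarrow> 'k) set" where
  "T_rel K V X = (let S = X \<rightarrow>\<^sub>E carrier V; F = free_vs K S; e = free_gen K in
      {e (v(x := a \<oplus>\<^bsub>V\<^esub> b)) \<ominus>\<^bsub>F\<^esub> (e (v(x := a)) \<oplus>\<^bsub>F\<^esub> e (v(x := b))) | v x a b.
         v \<in> S \<and> x \<in> X \<and> a \<in> carrier V \<and> b \<in> carrier V}
    \<union> {e (v(x := r \<odot>\<^bsub>V\<^esub> a)) \<ominus>\<^bsub>F\<^esub> r \<odot>\<^bsub>F\<^esub> e (v(x := a)) | v x r a.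
         v \<in> S \<and> x \<in> X \<and> r \<in> carrier K \<and> a \<in> carrier V})"

definition T :: "'k ring \<Rightarrow> ('k, 'v) module \<Rightarrow> 'x set \<Rightarrow> ('k, (('x \<Rightarrow> 'v) \<Rightarrow> 'k) set) module" where
  "T K V X = pres_vs K (X \<rightarrow>\<^sub>E carrier V) (T_rel K V X)"

definition tens :: "'k ring \<Rightarrow> ('k, 'v) module \<Rightarrow> 'x set \<Rightarrow> ('x \<Rightarrow> 'v) \<Rightarrow> (('x \<Rightarrow> 'v) \<Rightarrow> 'k) set" where
  "tens K V X v = pres_gen K (X \<rightarrow>\<^sub>E carrier V) (T_rel K V X) (restrict v X)"

definition T_act :: "'k ring \<Rightarrow> ('k, 'v) module \<Rightarrow> 'x set \<Rightarrow> ('x \<Rightarrow> 'x)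
    \<Rightarrow> (('x \<Rightarrow> 'v) \<Rightarrow> 'k) set \<Rightarrow> (('x \<Rightarrow> 'v) \<Rightarrow> 'k) set" where
  "T_act K V X \<sigma> = pres_lift K (T K V (\<sigma> ` X)) (\<lambda>v. tens K V (\<sigma> ` X) (\<lambda>y. v (inv_into X \<sigma> y)))"

definition T_mult :: "'k ring \<Rightarrow> ('k, 'v) module \<Rightarrow> 'x set \<Rightarrow> 'x set
    \<Rightarrow> ((('x \<Rightarrow> 'v) \<Rightarrow> 'k) set \<times> (('x \<Rightarrow> 'v) \<Rightarrow> 'k) set \<Rightarrow> 'k) set \<Rightarrow> (('x \<Rightarrow> 'v) \<Rightarrow> 'k) set" where
  "T_mult K V X Y = (let W = T K V (X \<union> Y) in
     pres_lift K W (\<lambda>(s, t). pres_lift K W (\<lambda>v. pres_lift K W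
       (\<lambda>w. tens K V (X \<union> Y) (glue X v w)) t) s))"

definition T_comult :: "'k ring \<Rightarrow> ('k, 'v) module \<Rightarrow> 'x set \<Rightarrow> 'x set
    \<Rightarrow> (('x \<Rightarrow> 'v) \<Rightarrow> 'k) set \<Rightarrow> ((('x \<Rightarrow> 'v) \<Rightarrow> 'k) set \<times> (('x \<Rightarrow> 'v) \<Rightarrow> 'k) set \<Rightarrow> 'k) set" where
  "T_comult K V X Y = pres_lift K (T K V X \<boxtimes>\<^bsub>K\<^esub> T K V Y)
     (\<lambda>v. pure K (T K V X) (T K V Y) (tens K V X v) (tens K V Y v))"

text \<open>\<open>V\<^sup>\<otimes>\<^sup>\<emptyset>\<close> is freely generated by the empty tensor, which is identified with \<open>1 \<in> K\<close>.\<close>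

definition T_unit :: "'k ring \<Rightarrow> ('k, 'v) module \<Rightarrow> (('x \<Rightarrow> 'v) \<Rightarrow> 'k) set" where
  "T_unit K V = tens K V {} (\<lambda>_. undefined)"

definition T_counit :: "'k ring \<Rightarrow> (('x \<Rightarrow> 'v) \<Rightarrow> 'k) set \<Rightarrow> 'k" where
  "T_counit K = pres_lift K (self_vs K) (\<lambda>_. \<one>\<^bsub>K\<^esub>)"

text \<open>The map \<open>d\<close> is linear and sends \<open>\<Otimes>\<^sub>x v\<^sub>x\<close> to \<open>(\<Otimes>\<^sub>x v'\<^sub>x) \<otimes> (\<Otimes>\<^sub>x v''\<^sub>x)\<close>. The Sweedler notation is
  spelled out: if \<open>\<delta>\<^sub>V(v\<^sub>x)\<close> is the sum of \<open>a x i \<otimes> b x i\<close> for \<open>i < n x\<close>, then the value of \<open>d\<close> is the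
  sum over all choices of one summand for each \<open>x \<in> X\<close>. This is required for every way of writing
  the \<open>\<delta>\<^sub>V(v\<^sub>x)\<close> as such sums.\<close>

definition is_tensor_coproduct :: "'k ring \<Rightarrow> ('k, 'v) module \<Rightarrow> ('v \<Rightarrow> ('v \<times> 'v \<Rightarrow> 'k) set)
    \<Rightarrow> 'x set \<Rightarrow> ((('x \<Rightarrow> 'v) \<Rightarrow> 'k) set
      \<Rightarrow> ((('x \<Rightarrow> 'v) \<Rightarrow> 'k) set \<times> (('x \<Rightarrow> 'v) \<Rightarrow> 'k) set \<Rightarrow> 'k) set) \<Rightarrow> bool" where
  "is_tensor_coproduct K V \<delta>V X d \<longleftrightarrow>
     d \<in> module_hom K (T K V X) (T K V X \<boxtimes>\<^bsub>K\<^esub> T K V X) \<and>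
     (\<forall>v (n :: 'x \<Rightarrow> nat) a b.
       (\<forall>x\<in>X. v x \<in> carrier V \<and> (\<forall>i<n x. a x i \<in> carrier V \<and> b x i \<in> carrier V) \<and>
          \<delta>V (v x) = (\<Oplus>\<^bsub>V \<boxtimes>\<^bsub>K\<^esub> V\<^esub>i\<in>{..<n x}. pure K V V (a x i) (b x i))) \<longrightarrow>
       d (tens K V X v) =
         (\<Oplus>\<^bsub>T K V X \<boxtimes>\<^bsub>K\<^esub> T K V X\<^esub>f\<in>(\<Pi>\<^sub>E x\<in>X. {..<n x}).
            pure K (T K V X) (T K V X) (tens K V X (\<lambda>x. a x (f x))) (tens K V X (\<lambda>x. b x (f x)))))"

end

theory Submission
  imports Defs
begin

text \<open>All spaces involved are spanned by pure tensors, so every axiom is an equality of linear maps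
  to be checked on pure tensors. Since \<open>\<delta>\<^sub>V(v)\<close> is only a sum of pure tensors, this does not apply
  directly to \<open>\<delta>\<^sub>X\<close>; but \<open>\<delta>\<^sub>X\<close> factors as
  \<open>V\<^sup>\<otimes>\<^sup>X \<rightarrow> (V \<otimes> V)\<^sup>\<otimes>\<^sup>X \<rightarrow> V\<^sup>\<otimes>\<^sup>X \<otimes> V\<^sup>\<otimes>\<^sup>X\<close>, where the first map applies \<open>\<delta>\<^sub>V\<close> in every slot and the
  second one reshuffles the tensor factors. The first map commutes with all structure maps of the species of
  tensors, and identities for the second one need to be checked only on families of pure
  tensors \<open>a\<^sub>x \<otimes> b\<^sub>x\<close>. Coassociativity and counitarity of \<open>\<delta>\<^sub>X\<close> are then those of \<open>\<delta>\<^sub>V\<close>, slot by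
  slot.\<close>

section \<open>Linear maps and spanning sets\<close>

text \<open>The multiple sum behind Sweedler notation depends on how each
  \<open>\<delta>V (v x)\<close> is written, so it cannot by itself define a map. The detour through
  families in \<open>V \<otimes> V\<close> involves no choice of summands; the sum is recovered
  afterwards by expanding a tensor of sums in every slot (\<open>tens_expand\<close>). Uniqueness
  needs in addition that each \<open>\<delta>V (v x)\<close> has at least one expression as a finite
  sum of pure tensors.

  The reshuffling must be defined on families of arbitrary elements of \<open>V \<otimes> V\<close>,
  and such a family does not split canonically into two families in \<open>V\<close>. It is
  therefore constructed one slot at a time.

  A further obstacle is that \<open>pres_lift\<close> computes on a chosen representative. The
  choice is harmless for maps that respect the relations. In nested lifts such as
  \<open>mid_flip\<close> or \<open>T_mult\<close>, the inner lift must also be linear in the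
  variables of the outer one; this holds because a fixed class uses the same representative for all
  values of these variables.\<close>

locale ground_field = field K for K :: "'k ring" (structure)
begin

abbreviation lin :: "('k, 'a) module \<Rightarrow> ('k, 'b) module \<Rightarrow> ('a \<Rightarrow> 'b) set" where
  "lin \<equiv> module_hom K"

lemma vectorspaceI: "module K A \<Longrightarrow> vectorspace K A"
  by (simp add: vectorspace_def field_axioms)

lemma vs_module: "vectorspace K A \<Longrightarrow> module K A"
  by (simp add: vectorspace_def)

lemma vs_group: "vectorspace K A \<Longrightarrow> abelian_group A"
  by (simp add: vectorspace_def module_def)

lemma vs_zero [simp]: "vectorspace K A \<Longrightarrow> \<zero>\<^bsub>A\<^esub> \<in> carrier A"
  by (simp add: vs_group abelian_group.axioms(1) abelian_monoid.zero_closed)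

lemma vs_add [simp]:
  "\<lbrakk>vectorspace K A; x \<in> carrier A; y \<in> carrier A\<rbrakk> \<Longrightarrow> x \<oplus>\<^bsub>A\<^esub> y \<in> carrier A"
  by (simp add: vs_group abelian_group.axioms(1) abelian_monoid.a_closed)

lemma vs_smult [simp]:
  "\<lbrakk>vectorspace K A; r \<in> carrier K; x \<in> carrier A\<rbrakk> \<Longrightarrow> r \<odot>\<^bsub>A\<^esub> x \<in> carrier A"
  by (rule module.smult_closed[OF vs_module])

lemma vs_finsum [simp]:
  "\<lbrakk>vectorspace K A; \<And>i. i \<in> I \<Longrightarrow> f i \<in> carrier A\<rbrakk> \<Longrightarrow> (\<Oplus>\<^bsub>A\<^esub>i\<in>I. f i) \<in> carrier A"
  by (simp add: vs_group abelian_group.axioms(1) abelian_monoid.finsum_closed)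

lemma vs_minus [simp]:
  "\<lbrakk>vectorspace K A; x \<in> carrier A; y \<in> carrier A\<rbrakk> \<Longrightarrow> x \<ominus>\<^bsub>A\<^esub> y \<in> carrier A"
  by (simp add: vs_group abelian_group.minus_closed)

lemma vs_minus_eq_zero:
  "\<lbrakk>vectorspace K A; x \<in> carrier A; y \<in> carrier A\<rbrakk> \<Longrightarrow> x \<ominus>\<^bsub>A\<^esub> y = \<zero>\<^bsub>A\<^esub> \<longleftrightarrow> x = y"
  by (metis abelian_group.a_inv_closed abelian_group.minus_equality abelian_group.minus_minus
      abelian_group.r_neg a_minus_def vs_group)

lemma linI:
  assumes "\<And>x. x \<in> carrier A \<Longrightarrow> f x \<in> carrier B"
    and "\<And>x y. \<lbrakk>x \<in> carrier A; y \<in> carrier A\<rbrakk> \<Longrightarrow> f (x \<oplus>\<^bsub>A\<^esub> y) = f x \<oplus>\<^bsub>B\<^esub> f y"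
    and "\<And>r x. \<lbrakk>r \<in> carrier K; x \<in> carrier A\<rbrakk> \<Longrightarrow> f (r \<odot>\<^bsub>A\<^esub> x) = r \<odot>\<^bsub>B\<^esub> f x"
  shows "f \<in> lin A B"
  using assms by (auto simp: module_hom_def)

lemma lin_closed: "\<lbrakk>f \<in> lin A B; x \<in> carrier A\<rbrakk> \<Longrightarrow> f x \<in> carrier B"
  by (auto simp: module_hom_def)

text \<open>Homomorphisms are constrained on the carrier only, so a formula valid there suffices.
  Needed in \<open>T_eps_multilin\<close>, where the product formula is established only for
  arguments in \<open>carrier V\<close>.\<close>

lemma lin_cong:
  assumes "f \<in> lin A B" "vectorspace K A" "\<And>x. x \<in> carrier A \<Longrightarrow> f x = g x"
  shows "g \<in> lin A B"
  using assms(1,2)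
  by (intro linI) (simp_all add: assms(3)[symmetric] lin_closed module_hom_add module_hom_smult)

lemma lin_zero:
  assumes "f \<in> lin A B" "vectorspace K A" "vectorspace K B"
  shows "f \<zero>\<^bsub>A\<^esub> = \<zero>\<^bsub>B\<^esub>"
  by (rule mod_hom.f0_is_0[of K]) (simp add: mod_hom_def mod_hom_axioms_def assms vs_module)

lemma lin_finsum:
  assumes "f \<in> lin A B" "vectorspace K A" "vectorspace K B" "\<And>i. i \<in> I \<Longrightarrow> g i \<in> carrier A"
  shows "f (\<Oplus>\<^bsub>A\<^esub>i\<in>I. g i) = (\<Oplus>\<^bsub>B\<^esub>i\<in>I. f (g i))"
proof -
  interpret A: abelian_group A using assms(2) by (rule vs_group)
  interpret B: abelian_group B using assms(3) by (rule vs_group)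
  show ?thesis using assms(4)
  \<comment> \<open>For infinite \<open>I\<close> both sums are zero by convention, so that case
    reduces to \<open>lin_zero\<close>, like the empty one.\<close>
  proof (induct I rule: infinite_finite_induct)
    case (insert i I)
    have c: "g i \<in> carrier A" "g \<in> I \<rightarrow> carrier A" using insert.prems by auto
    then have "f (g i) \<in> carrier B" "(\<lambda>i. f (g i)) \<in> I \<rightarrow> carrier B"
      using lin_closed[OF assms(1)] by auto
    then show ?case
      using insert c by (simp add: module_hom_add[OF assms(1)])
  qed (simp_all add: lin_zero[OF assms(1-3)])
qed

lemma lin_id: "(\<lambda>x. x) \<in> lin A A" "id \<in> lin A A"
  by (auto simp: module_hom_def)

lemma lin_comp: "\<lbrakk>f \<in> lin A B; g \<in> lin B C\<rbrakk> \<Longrightarrow> (\<lambda>x. g (f x)) \<in> lin A C"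
  by (auto simp: module_hom_def Pi_def)

lemma lin_minus:
  assumes "f \<in> lin A B" "vectorspace K A" "vectorspace K B" "x \<in> carrier A" "y \<in> carrier A"
  shows "f (x \<ominus>\<^bsub>A\<^esub> y) = f x \<ominus>\<^bsub>B\<^esub> f y"
  by (rule mod_hom.f_minus[of K]) (simp_all add: mod_hom_def mod_hom_axioms_def assms vs_module)

text \<open>Commutativity of \<open>K\<close> is what makes scaling by a fixed \<open>r\<close>
  compatible with the other scalars.\<close>

lemma lin_scale:
  assumes "f \<in> lin A B" "vectorspace K B" "r \<in> carrier K"
  shows "(\<lambda>x. r \<odot>\<^bsub>B\<^esub> f x) \<in> lin A B"
proof -
  interpret B: module K B using assms(2) by (rule vs_module)
  show ?thesis
    using assms(1,3)
    by (intro linI) (auto simp: module_hom_add module_hom_smult lin_closed B.smult_r_distr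
      m_comm B.smult_assoc1[symmetric])
qed

lemma lin_finsum_map:
  assumes "\<And>i. i \<in> I \<Longrightarrow> (\<lambda>x. f i x) \<in> lin A B" "vectorspace K B"
  shows "(\<lambda>x. \<Oplus>\<^bsub>B\<^esub>i\<in>I. f i x) \<in> lin A B"
proof -
  interpret B: abelian_group B using assms(2) by (rule vs_group)
  note c = lin_closed[OF assms(1)]
  show ?thesis
  proof (rule linI)
    fix r x assume r: "r \<in> carrier K" and x: "x \<in> carrier A"
    have "(\<Oplus>\<^bsub>B\<^esub>i\<in>I. f i (r \<odot>\<^bsub>A\<^esub> x)) = (\<Oplus>\<^bsub>B\<^esub>i\<in>I. r \<odot>\<^bsub>B\<^esub> f i x)"
      using r x assms(2) by (intro B.finsum_cong') (auto simp: module_hom_smult[OF assms(1)] c)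
    also have "\<dots> = r \<odot>\<^bsub>B\<^esub> (\<Oplus>\<^bsub>B\<^esub>i\<in>I. f i x)"
      using x by (intro lin_finsum[OF lin_scale[OF lin_id(1) _ r], symmetric] assms(2)) (auto simp: c)
    finally show "(\<Oplus>\<^bsub>B\<^esub>i\<in>I. f i (r \<odot>\<^bsub>A\<^esub> x)) = r \<odot>\<^bsub>B\<^esub> (\<Oplus>\<^bsub>B\<^esub>i\<in>I. f i x)" .
  next
    fix x y assume x: "x \<in> carrier A" and y: "y \<in> carrier A"
    have "(\<Oplus>\<^bsub>B\<^esub>i\<in>I. f i (x \<oplus>\<^bsub>A\<^esub> y)) = (\<Oplus>\<^bsub>B\<^esub>i\<in>I. f i x \<oplus>\<^bsub>B\<^esub> f i y)"
      using x y assms(2) by (intro B.finsum_cong') (auto simp: module_hom_add[OF assms(1)] c)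
    also have "\<dots> = (\<Oplus>\<^bsub>B\<^esub>i\<in>I. f i x) \<oplus>\<^bsub>B\<^esub> (\<Oplus>\<^bsub>B\<^esub>i\<in>I. f i y)"
      using x y by (intro B.finsum_addf) (auto simp: c)
    finally show "(\<Oplus>\<^bsub>B\<^esub>i\<in>I. f i (x \<oplus>\<^bsub>A\<^esub> y)) = (\<Oplus>\<^bsub>B\<^esub>i\<in>I. f i x) \<oplus>\<^bsub>B\<^esub> (\<Oplus>\<^bsub>B\<^esub>i\<in>I. f i y)" .
  qed (auto simp: c assms(2))
qed

end

text \<open>An inductive form of the span: its induction rule carries equalities and memberships
  from generators to all vectors.\<close>

inductive_set lspan :: "'k ring \<Rightarrow> ('k, 'a) module \<Rightarrow> 'a set \<Rightarrow> 'a set" for K A G where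
  lspan_zero: "\<zero>\<^bsub>A\<^esub> \<in> lspan K A G"
| lspan_base: "g \<in> G \<Longrightarrow> g \<in> lspan K A G"
| lspan_add: "\<lbrakk>x \<in> lspan K A G; y \<in> lspan K A G\<rbrakk> \<Longrightarrow> x \<oplus>\<^bsub>A\<^esub> y \<in> lspan K A G"
| lspan_smult: "\<lbrakk>r \<in> carrier K; x \<in> lspan K A G\<rbrakk> \<Longrightarrow> r \<odot>\<^bsub>A\<^esub> x \<in> lspan K A G"

definition generates :: "'k ring \<Rightarrow> ('k, 'a) module \<Rightarrow> 'a set \<Rightarrow> bool" where
  "generates K A G \<longleftrightarrow> G \<subseteq> carrier A \<and> carrier A \<subseteq> lspan K A G"

context ground_field
begin

lemma lspan_carrier:
  assumes "vectorspace K A" "G \<subseteq> carrier A" "x \<in> lspan K A G"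
  shows "x \<in> carrier A"
  using assms(3) by induct (use assms(1,2) in auto)

lemma generates_carrier: "generates K A (carrier A)"
  by (auto simp: generates_def intro: lspan_base)

text \<open>The set where two linear maps agree is closed under the rules of \<open>lspan\<close>.
  The bounded quantifier in the conclusion lets the resulting identities of maps be handed to
  \<open>simp\<close> as conditional rewrite rules.\<close>

lemma lin_eqI:
  assumes "generates K A G" "f \<in> lin A B" "g \<in> lin A B" "vectorspace K A" "vectorspace K B"
    and "\<And>x. x \<in> G \<Longrightarrow> f x = g x"
  shows "\<forall>x\<in>carrier A. f x = g x"
proof
  fix x assume "x \<in> carrier A"
  with assms(1) have "x \<in> lspan K A G" by (auto simp: generates_def)
  then show "f x = g x"
  proof induct
    case lspan_zero then show ?case using assms by (simp add: lin_zero)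
  next
    case (lspan_add x y)
    then show ?case
      using assms lspan_carrier[of A G] by (simp add: module_hom_add[of _ K A B] generates_def)
  next
    case (lspan_smult r x)
    then show ?case
      using assms lspan_carrier[of A G] by (simp add: module_hom_smult[of _ K A B] generates_def)
  qed (fact assms(6))
qed

text \<open>A multilinear map with all arguments but one frozen is linear, and this lemma then
  reduces the free argument to generators. \<open>tensor_generates\<close> and
  \<open>T_generates\<close> use it once per slot.\<close>

lemma lspan_lin_image:
  assumes "f \<in> lin A B" "vectorspace K A" "vectorspace K B" "G \<subseteq> carrier A" "x \<in> lspan K A G"
    and "\<And>g. g \<in> G \<Longrightarrow> f g \<in> lspan K B H"
  shows "f x \<in> lspan K B H"
  using assms(5)
proof induct
  case lspan_zero then show ?case using assms by (simp add: lin_zero lspan.lspan_zero)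
next
  case (lspan_add x y)
  then show ?case
    using assms(1) lspan_carrier[OF assms(2,4)]
    by (simp add: module_hom_add[of _ K A B] lspan.lspan_add)
next
  case (lspan_smult r x)
  then show ?case
    using assms(1) lspan_carrier[OF assms(2,4)]
    by (simp add: module_hom_smult[of _ K A B] lspan.lspan_smult)
qed (fact assms(6))

section \<open>Vector spaces by generators and relations\<close>

lemma free_vs_simps:
  "carrier (free_vs K S) = {p. (\<forall>s. p s \<in> carrier K) \<and> (\<forall>s. s \<notin> S \<longrightarrow> p s = \<zero>) \<and> finite {s. p s \<noteq> \<zero>}}"
  "zero (free_vs K S) = (\<lambda>s. \<zero>)"
  "add (free_vs K S) = (\<lambda>p q s. p s \<oplus> q s)"
  "smult (free_vs K S) = (\<lambda>r p s. r \<otimes> p s)"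
  by (simp_all add: free_vs_def)

lemma free_vs: "vectorspace K (free_vs K S)"
proof (intro vectorspaceI moduleI abelian_groupI)
  fix p assume p: "p \<in> carrier (free_vs K S)"
  have "{s. \<ominus> p s \<noteq> \<zero>} \<subseteq> {s. p s \<noteq> \<zero>}" by auto
  then show "\<exists>q\<in>carrier (free_vs K S). q \<oplus>\<^bsub>free_vs K S\<^esub> p = \<zero>\<^bsub>free_vs K S\<^esub>"
    using p by (intro bexI[of _ "\<lambda>s. \<ominus> p s"]) (auto simp: free_vs_simps l_neg finite_subset)
next
  fix p q assume "p \<in> carrier (free_vs K S)" "q \<in> carrier (free_vs K S)"
  moreover have "{s. p s \<oplus> q s \<noteq> \<zero>} \<subseteq> {s. p s \<noteq> \<zero>} \<union> {s. q s \<noteq> \<zero>}"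
    by auto
  ultimately show "p \<oplus>\<^bsub>free_vs K S\<^esub> q \<in> carrier (free_vs K S)"
    by (auto simp: free_vs_simps elim: finite_subset)
next
  fix r p assume rp: "r \<in> carrier K" "p \<in> carrier (free_vs K S)"
  then have "{s. r \<otimes> p s \<noteq> \<zero>} \<subseteq> {s. p s \<noteq> \<zero>}"
    by auto
  with rp show "r \<odot>\<^bsub>free_vs K S\<^esub> p \<in> carrier (free_vs K S)"
    by (simp add: free_vs_simps finite_subset)
qed (auto simp: free_vs_simps fun_eq_iff a_ac m_assoc l_distr r_distr is_cring)

lemma free_gen_carrier [simp]: "s \<in> S \<Longrightarrow> free_gen K s \<in> carrier (free_vs K S)"
  by (auto simp: free_vs_simps free_gen_def)

lemma free_vs_generates: "generates K (free_vs K S) (free_gen K ` S)"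
proof -
  \<comment> \<open>The induction runs over a finite set \<open>A\<close> containing the support,
    not over the support itself: clearing the coefficient at \<open>a\<close> leaves the support
    inside the smaller set even if that coefficient was already zero.\<close>
  have "p \<in> lspan K (free_vs K S) (free_gen K ` S)"
    if "finite A" "p \<in> carrier (free_vs K S)" "{s. p s \<noteq> \<zero>} \<subseteq> A" for A p
    using that
  proof (induct A arbitrary: p)
    case empty
    then have "p = \<zero>\<^bsub>free_vs K S\<^esub>" by (auto simp: free_vs_simps)
    then show ?case by (metis lspan_zero)
  next
    case (insert a A)
    let ?q = "p(a := \<zero>)"
    have "finite {s. ?q s \<noteq> \<zero>}"
      using insert.prems by (auto simp: free_vs_simps intro: rev_finite_subset)
    then have q: "?q \<in> lspan K (free_vs K S) (free_gen K ` S)"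
      using insert.prems by (intro insert.hyps) (auto simp: free_vs_simps)
    show ?case
    proof (cases "a \<in> S")
      case True
      have "p = ?q \<oplus>\<^bsub>free_vs K S\<^esub> (p a \<odot>\<^bsub>free_vs K S\<^esub> free_gen K a)"
        using insert.prems by (auto simp: free_vs_simps free_gen_def)
      moreover have "p a \<in> carrier K" using insert.prems by (simp add: free_vs_simps)
      ultimately show ?thesis
        using q True by (metis image_eqI lspan_add lspan_base lspan_smult)
    next
      case False
      then have "p = ?q" using insert.prems by (auto simp: free_vs_simps)
      with q show ?thesis by simp
    qed
  qed
  from this[OF _ _ subset_refl] have "p \<in> lspan K (free_vs K S) (free_gen K ` S)"
    if "p \<in> carrier (free_vs K S)" for p
    using that by (simp add: free_vs_simps)
  moreover have "free_gen K ` S \<subseteq> carrier (free_vs K S)"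
    by (rule image_subsetI) (rule free_gen_carrier)
  ultimately show ?thesis
    by (simp add: generates_def subset_iff)
qed

text \<open>The formula inside \<open>pres_lift\<close>, but evaluated at a given representative
  instead of a chosen one.\<close>

definition free_ext :: "('k, 'w) module \<Rightarrow> ('s \<Rightarrow> 'w) \<Rightarrow> ('s \<Rightarrow> 'k) \<Rightarrow> 'w" where
  "free_ext W g p = (\<Oplus>\<^bsub>W\<^esub>s\<in>{s. p s \<noteq> \<zero>}. p s \<odot>\<^bsub>W\<^esub> g s)"

text \<open>Supports change under addition and scaling, so sums over them are compared on a common
  finite index set. The condition \<open>A \<subseteq> S\<close> keeps the additional vectors in
  \<open>carrier W\<close>, where their zero coefficients kill them.\<close>

lemma free_ext_superset:
  assumes "vectorspace K W" "g \<in> S \<rightarrow> carrier W" "p \<in> carrier (free_vs K S)"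
    and "finite A" "{s. p s \<noteq> \<zero>} \<subseteq> A" "A \<subseteq> S"
  shows "free_ext W g p = (\<Oplus>\<^bsub>W\<^esub>s\<in>A. p s \<odot>\<^bsub>W\<^esub> g s)"
proof -
  interpret W: module K W using assms(1) by (rule vs_module)
  show ?thesis unfolding free_ext_def
    using assms
    by (intro W.M.add.finprod_mono_neutral_cong_left) (auto simp: free_vs_simps Pi_iff subset_iff)
qed

lemma free_ext_lin:
  assumes W: "vectorspace K W" and g: "g \<in> S \<rightarrow> carrier W"
  shows "free_ext W g \<in> lin (free_vs K S) W"
proof -
  interpret W: module K W using assms(1) by (rule vs_module)
  interpret F: module K "free_vs K S" using free_vs by (rule vs_module)
  have supp: "{s. p s \<noteq> \<zero>} \<subseteq> S" "finite {s. p s \<noteq> \<zero>}" if "p \<in> carrier (free_vs K S)" for p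
    using that by (auto simp: free_vs_simps)
  show ?thesis
  proof (rule linI)
    fix p assume p: "p \<in> carrier (free_vs K S)"
    then show "free_ext W g p \<in> carrier W"
      unfolding free_ext_def using g by (intro W.M.finsum_closed) (auto simp: free_vs_simps)
    fix r assume r: "r \<in> carrier K"
    have gs: "g s \<in> carrier W" if "p s \<noteq> \<zero>" for s using p g that by (auto simp: free_vs_simps)
    let ?A = "{s. p s \<noteq> \<zero>}"
    have "free_ext W g (r \<odot>\<^bsub>free_vs K S\<^esub> p) = (\<Oplus>\<^bsub>W\<^esub>s\<in>?A. (r \<odot>\<^bsub>free_vs K S\<^esub> p) s \<odot>\<^bsub>W\<^esub> g s)"
      by (rule free_ext_superset[OF W g])
        (use p r supp[OF p] vs_smult[OF free_vs r p] in \<open>auto simp: free_vs_simps\<close>)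
    also have "\<dots> = (\<Oplus>\<^bsub>W\<^esub>s\<in>?A. (r \<otimes> p s) \<odot>\<^bsub>W\<^esub> g s)"
      by (simp add: free_vs_simps)
    also have "\<dots> = (\<Oplus>\<^bsub>W\<^esub>s\<in>?A. r \<odot>\<^bsub>W\<^esub> (p s \<odot>\<^bsub>W\<^esub> g s))"
      using p r gs by (intro W.M.finsum_cong') (auto simp: free_vs_simps W.smult_assoc1)
    also have "\<dots> = r \<odot>\<^bsub>W\<^esub> free_ext W g p"
      unfolding free_ext_def using p r gs
      by (intro lin_finsum[OF lin_scale[OF lin_id(1) W r] W W, symmetric]) (auto simp: free_vs_simps)
    finally show "free_ext W g (r \<odot>\<^bsub>free_vs K S\<^esub> p) = r \<odot>\<^bsub>W\<^esub> free_ext W g p" .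
  next
    fix p q assume pq: "p \<in> carrier (free_vs K S)" "q \<in> carrier (free_vs K S)"
    define A where "A = {s. p s \<noteq> \<zero>} \<union> {s. q s \<noteq> \<zero>}"
    have A: "finite A" "A \<subseteq> S" using supp pq by (auto simp: A_def)
    have gA: "g s \<in> carrier W" if "s \<in> A" for s using A g that by auto
    have c: "p s \<in> carrier K" "q s \<in> carrier K" for s using pq by (auto simp: free_vs_simps A_def)
    have "free_ext W g (p \<oplus>\<^bsub>free_vs K S\<^esub> q) = (\<Oplus>\<^bsub>W\<^esub>s\<in>A. (p \<oplus>\<^bsub>free_vs K S\<^esub> q) s \<odot>\<^bsub>W\<^esub> g s)"
      using vs_add[OF free_vs pq] by (rule free_ext_superset[OF W g _ A(1) _ A(2)]) (auto simp: free_vs_simps A_def)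
    also have "\<dots> = (\<Oplus>\<^bsub>W\<^esub>s\<in>A. (p s \<oplus> q s) \<odot>\<^bsub>W\<^esub> g s)"
      by (simp add: free_vs_simps)
    also have "\<dots> = (\<Oplus>\<^bsub>W\<^esub>s\<in>A. p s \<odot>\<^bsub>W\<^esub> g s \<oplus>\<^bsub>W\<^esub> q s \<odot>\<^bsub>W\<^esub> g s)"
      using c gA A by (intro W.M.finsum_cong') (auto simp: W.smult_l_distr)
    also have "\<dots> = (\<Oplus>\<^bsub>W\<^esub>s\<in>A. p s \<odot>\<^bsub>W\<^esub> g s) \<oplus>\<^bsub>W\<^esub> (\<Oplus>\<^bsub>W\<^esub>s\<in>A. q s \<odot>\<^bsub>W\<^esub> g s)"
      using c gA A by (intro W.M.finsum_addf) auto
    also have "\<dots> = free_ext W g p \<oplus>\<^bsub>W\<^esub> free_ext W g q"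
      using free_ext_superset[OF W g pq(1) A(1) _ A(2)] free_ext_superset[OF W g pq(2) A(1) _ A(2)]
      by (simp add: A_def)
    finally show "free_ext W g (p \<oplus>\<^bsub>free_vs K S\<^esub> q) = free_ext W g p \<oplus>\<^bsub>W\<^esub> free_ext W g q" .
  qed
qed

lemma free_ext_gen:
  assumes W: "vectorspace K W" and g: "g s \<in> carrier W"
  shows "free_ext W g (free_gen K s) = g s"
proof -
  interpret W: module K W using assms(1) by (rule vs_module)
  have "{t. free_gen K s t \<noteq> \<zero>} = {s}" by (auto simp: free_gen_def)
  then show ?thesis using g by (simp add: free_ext_def free_gen_def)
qed

section \<open>Quotient spaces\<close>

lemma quot_vs:
  assumes "vectorspace K M" "submodule K N M"
  shows "vectorspace K (quot_vs M N)" "(\<lambda>p. N +>\<^bsub>M\<^esub> p) \<in> lin M (quot_vs M N)"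
    "carrier (quot_vs M N) = (\<lambda>p. N +>\<^bsub>M\<^esub> p) ` carrier M"
    "n \<in> N \<Longrightarrow> N +>\<^bsub>M\<^esub> n = \<zero>\<^bsub>quot_vs M N\<^esub>"
proof -
  interpret M: module K M using assms(1) by (rule vs_module)
  interpret N: submodule K N M by fact
  let ?Q = "quot_vs M N"
  have "subgroup N (add_monoid M)"
  proof
    fix x assume x: "x \<in> N"
    \<comment> \<open>Closure under negatives comes from closure under scalars, applied to minus
      one.\<close>
    then have "\<ominus>\<^bsub>M\<^esub> x = (\<ominus> \<one>) \<odot>\<^bsub>M\<^esub> x" using N.subset by (auto simp: M.smult_l_minus)
    then show "inv\<^bsub>add_monoid M\<^esub> x \<in> N" using x by (simp add: a_inv_def[symmetric])
  qed (use N.subset in auto)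
  then interpret N: abelian_subgroup N M
    by (intro abelian_subgroupI3 additive_subgroup.intro M.abelian_group_axioms)
  show "n \<in> N \<Longrightarrow> N +>\<^bsub>M\<^esub> n = \<zero>\<^bsub>?Q\<^esub>"
    by (simp add: quot_vs_def N.a_rcos_const)
  show car: "carrier ?Q = (\<lambda>p. N +>\<^bsub>M\<^esub> p) ` carrier M"
    by (auto simp: quot_vs_def A_RCOSETS_def')
  have add: "(N +>\<^bsub>M\<^esub> p) \<oplus>\<^bsub>?Q\<^esub> (N +>\<^bsub>M\<^esub> q) = N +>\<^bsub>M\<^esub> (p \<oplus>\<^bsub>M\<^esub> q)"
    if "p \<in> carrier M" "q \<in> carrier M" for p q
    using that by (simp add: quot_vs_def N.a_rcos_sum)
  have zero: "\<zero>\<^bsub>?Q\<^esub> = N +>\<^bsub>M\<^esub> \<zero>\<^bsub>M\<^esub>"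
    using N.subset by (simp add: quot_vs_def)
  have smult: "r \<odot>\<^bsub>?Q\<^esub> (N +>\<^bsub>M\<^esub> p) = N +>\<^bsub>M\<^esub> (r \<odot>\<^bsub>M\<^esub> p)"
    if r: "r \<in> carrier K" and p: "p \<in> carrier M" for r p
  proof -
    \<comment> \<open>Scalar multiplication of cosets is a union over all representatives. All of
      them contribute the same coset, and there is at least one, so the union collapses.\<close>
    have "N +>\<^bsub>M\<^esub> (r \<odot>\<^bsub>M\<^esub> c) = N +>\<^bsub>M\<^esub> (r \<odot>\<^bsub>M\<^esub> p)" if "c \<in> N +>\<^bsub>M\<^esub> p" for c
    proof -
      from that obtain n where n: "n \<in> N" "c = n \<oplus>\<^bsub>M\<^esub> p" by (auto simp: a_r_coset_def')
      then have "r \<odot>\<^bsub>M\<^esub> c = r \<odot>\<^bsub>M\<^esub> n \<oplus>\<^bsub>M\<^esub> r \<odot>\<^bsub>M\<^esub> p"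
        using r p N.subset by (auto simp: M.smult_r_distr)
      then have "r \<odot>\<^bsub>M\<^esub> c \<in> N +>\<^bsub>M\<^esub> (r \<odot>\<^bsub>M\<^esub> p)"
        using n r by (auto simp: a_r_coset_def')
      then show ?thesis using r p N.a_repr_independence' by simp
    qed
    moreover have "p \<in> N +>\<^bsub>M\<^esub> p" using p by (rule N.a_rcos_self)
    ultimately have "(\<Union>c\<in>N +>\<^bsub>M\<^esub> p. N +>\<^bsub>M\<^esub> (r \<odot>\<^bsub>M\<^esub> c)) = N +>\<^bsub>M\<^esub> (r \<odot>\<^bsub>M\<^esub> p)"
      by blast
    then show ?thesis by (simp add: quot_vs_def)
  qed
  show "(\<lambda>p. N +>\<^bsub>M\<^esub> p) \<in> lin M ?Q"
    by (rule linI) (auto simp: car add smult)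
  show "vectorspace K ?Q"
  proof (intro vectorspaceI moduleI abelian_groupI)
    fix x assume "x \<in> carrier ?Q"
    then obtain p where p: "p \<in> carrier M" "x = N +>\<^bsub>M\<^esub> p" by (auto simp: car)
    then show "\<exists>y\<in>carrier ?Q. y \<oplus>\<^bsub>?Q\<^esub> x = \<zero>\<^bsub>?Q\<^esub>"
      by (intro bexI[of _ "N +>\<^bsub>M\<^esub> (\<ominus>\<^bsub>M\<^esub> p)"]) (auto simp: add car zero M.M.l_neg)
  qed (auto simp: car add zero smult is_cring M.M.a_ac M.smult_l_distr M.smult_r_distr M.smult_assoc1)
qed

context
  fixes S :: "'s set" and R :: "('s \<Rightarrow> 'k) set"
  assumes rel: "R \<subseteq> carrier (free_vs K S)"
begin

lemma pres_span_submodule: "submodule K (module.span K (free_vs K S) R) (free_vs K S)"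
  by (rule module.span_is_submodule[OF vs_module[OF free_vs] rel])

lemmas pres_quot = quot_vs[OF free_vs pres_span_submodule, folded pres_vs_def]

lemma pres_vs: "vectorspace K (pres_vs K S R)"
  by (rule pres_quot)

lemma pres_gen_carrier: "s \<in> S \<Longrightarrow> pres_gen K S R s \<in> carrier (pres_vs K S R)"
  by (auto simp: pres_gen_def pres_quot(3))

lemma pres_generates: "generates K (pres_vs K S R) (pres_gen K S R ` S)"
proof -
  have "x \<in> lspan K (pres_vs K S R) (pres_gen K S R ` S)" if x: "x \<in> carrier (pres_vs K S R)" for x
  proof -
    obtain p where p: "p \<in> carrier (free_vs K S)" "x = module.span K (free_vs K S) R +>\<^bsub>free_vs K S\<^esub> p"
      using x by (auto simp: pres_quot(3))
    then have "p \<in> lspan K (free_vs K S) (free_gen K ` S)"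
      using free_vs_generates[of S] by (auto simp: generates_def)
    then have "module.span K (free_vs K S) R +>\<^bsub>free_vs K S\<^esub> p \<in> lspan K (pres_vs K S R) (pres_gen K S R ` S)"
      by (rule lspan_lin_image[OF pres_quot(2) free_vs pres_vs, rotated])
        (auto simp: pres_gen_def intro!: lspan_base)
    with p(2) show ?thesis by simp
  qed
  then show ?thesis by (auto simp: generates_def pres_gen_carrier)
qed

lemma pres_some:
  assumes "t \<in> carrier (pres_vs K S R)"
  shows "(SOME p. p \<in> t) \<in> carrier (free_vs K S)" "(SOME p. p \<in> t) \<in> t"
proof -
  interpret F: module K "free_vs K S" using free_vs by (rule vs_module)
  interpret N: submodule K "module.span K (free_vs K S) R" "free_vs K S" by (rule pres_span_submodule)
  obtain p where p: "p \<in> carrier (free_vs K S)" "t = module.span K (free_vs K S) R +>\<^bsub>free_vs K S\<^esub> p"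
    using assms by (auto simp: pres_quot(3))
  then have "\<zero>\<^bsub>free_vs K S\<^esub> \<oplus>\<^bsub>free_vs K S\<^esub> p \<in> t"
    using N.zero_closed by (auto simp: a_r_coset_def' simp del: F.M.l_zero)
  then show *: "(SOME p. p \<in> t) \<in> t" by (rule someI[of "\<lambda>p. p \<in> t"])
  show "(SOME p. p \<in> t) \<in> carrier (free_vs K S)"
    using * p N.subset by (auto simp: a_r_coset_def')
qed

text \<open>\<open>pres_lift\<close> evaluates every map of a family on the same representative, so it is linear in
  the parameter of the family whether or not the maps respect the relations.\<close>

lemma lift_param:
  assumes "vectorspace K W" "t \<in> carrier (pres_vs K S R)"
    and "\<And>s. s \<in> S \<Longrightarrow> (\<lambda>c. g c s) \<in> lin C W"
  shows "(\<lambda>c. pres_lift K W (g c) t) \<in> lin C W"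
  unfolding pres_lift_def Let_def
  using pres_some[OF assms(2)] assms(1,3)
  by (intro lin_finsum_map lin_scale) (auto simp: free_vs_simps)

lemma lift_cong:
  assumes "vectorspace K W" "t \<in> carrier (pres_vs K S R)"
    and "\<And>s. s \<in> S \<Longrightarrow> g s \<in> carrier W" "\<And>s. s \<in> S \<Longrightarrow> g s = h s"
  shows "pres_lift K W g t = pres_lift K W h t"
proof -
  interpret W: abelian_group W using assms(1) by (rule vs_group)
  have h: "h s \<in> carrier W" if "s \<in> S" for s using assms(3,4) that by metis
  let ?p = "SOME p. p \<in> t"
  have p: "?p s \<in> carrier K" "?p s \<noteq> \<zero> \<Longrightarrow> s \<in> S" for s
    using pres_some(1)[OF assms(2)] by (auto simp: free_vs_simps)
  show ?thesis unfolding pres_lift_def Let_def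
    by (rule W.finsum_cong') (use assms(1,3,4) h p in auto)
qed

text \<open>Independence of the representative: the relations lie in the kernel of
  \<open>free_ext W g\<close>, hence so does their span, and the chosen representative differs from
  \<open>p\<close> by an element of that span.\<close>

lemma lift_coset:
  assumes W: "vectorspace K W" and g: "g \<in> S \<rightarrow> carrier W"
    and R0: "\<And>r. r \<in> R \<Longrightarrow> free_ext W g r = \<zero>\<^bsub>W\<^esub>"
    and p: "p \<in> carrier (free_vs K S)"
  shows "pres_lift K W g (module.span K (free_vs K S) R +>\<^bsub>free_vs K S\<^esub> p) = free_ext W g p"
proof -
  interpret mod_hom K "free_vs K S" W "free_ext W g"
    using W by (simp add: mod_hom_def mod_hom_axioms_def free_vs vs_module free_ext_lin g)
  let ?t = "module.span K (free_vs K S) R +>\<^bsub>free_vs K S\<^esub> p"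
  have ker: "module.span K (free_vs K S) R \<subseteq> ker"
    using rel R0 by (intro module.span_is_subset[OF vs_module[OF free_vs] _ ker_is_submodule])
      (auto simp: ker_def)
  have "?t \<in> carrier (pres_vs K S R)" using p by (auto simp: pres_quot(3))
  then have "(SOME q. q \<in> ?t) \<in> ?t" by (rule pres_some)
  then obtain n where "n \<in> module.span K (free_vs K S) R" "(SOME q. q \<in> ?t) = n \<oplus>\<^bsub>free_vs K S\<^esub> p"
    by (auto simp: a_r_coset_def')
  then have "free_ext W g (SOME q. q \<in> ?t) = free_ext W g p"
    using ker p by (auto simp: ker_def)
  then show ?thesis by (simp add: pres_lift_def Let_def free_ext_def)
qed

lemma lift_lin:
  assumes W: "vectorspace K W" and g: "g \<in> S \<rightarrow> carrier W"
    and R0: "\<And>r. r \<in> R \<Longrightarrow> free_ext W g r = \<zero>\<^bsub>W\<^esub>"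
  shows "pres_lift K W g \<in> lin (pres_vs K S R) W"
proof (rule linI)
  note q = lift_coset[OF W g R0]
  note ext = free_ext_lin[OF W g]
  fix x assume "x \<in> carrier (pres_vs K S R)"
  then obtain p where p: "p \<in> carrier (free_vs K S)" "x = module.span K (free_vs K S) R +>\<^bsub>free_vs K S\<^esub> p"
    by (auto simp: pres_quot(3))
  then show "pres_lift K W g x \<in> carrier W" by (simp add: q lin_closed[OF ext])
  { fix r assume "r \<in> carrier K"
    then show "pres_lift K W g (r \<odot>\<^bsub>pres_vs K S R\<^esub> x) = r \<odot>\<^bsub>W\<^esub> pres_lift K W g x"
      using p by (simp add: q module_hom_smult[OF ext] free_vs module_hom_smult[OF pres_quot(2), symmetric]) }
  fix y assume "y \<in> carrier (pres_vs K S R)"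
  then obtain p' where p': "p' \<in> carrier (free_vs K S)" "y = module.span K (free_vs K S) R +>\<^bsub>free_vs K S\<^esub> p'"
    by (auto simp: pres_quot(3))
  show "pres_lift K W g (x \<oplus>\<^bsub>pres_vs K S R\<^esub> y) = pres_lift K W g x \<oplus>\<^bsub>W\<^esub> pres_lift K W g y"
    using p p' by (simp add: q module_hom_add[OF ext] free_vs module_hom_add[OF pres_quot(2), symmetric])
qed

lemma lift_gen:
  assumes W: "vectorspace K W" and g: "g \<in> S \<rightarrow> carrier W"
    and R0: "\<And>r. r \<in> R \<Longrightarrow> free_ext W g r = \<zero>\<^bsub>W\<^esub>" and s: "s \<in> S"
  shows "pres_lift K W g (pres_gen K S R s) = g s"
  unfolding pres_gen_def using assms by (simp add: lift_coset free_ext_gen Pi_iff)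

lemma pres_gen_rel_zero:
  assumes "r \<in> R"
  shows "module.span K (free_vs K S) R +>\<^bsub>free_vs K S\<^esub> r = \<zero>\<^bsub>pres_vs K S R\<^esub>"
  using assms module.in_own_span[OF vs_module[OF free_vs] rel] by (intro pres_quot(4)) auto

text \<open>Every relation in \<open>tensor_rel\<close> and \<open>T_rel\<close> has the shape
  treated here or the one in \<open>pres_rel_smult\<close>; these two lemmas read such a relation as
  an identity between classes of generators.\<close>

lemma pres_rel_add:
  assumes "free_gen K s \<ominus>\<^bsub>free_vs K S\<^esub> (free_gen K t \<oplus>\<^bsub>free_vs K S\<^esub> free_gen K u) \<in> R"
    and "s \<in> S" "t \<in> S" "u \<in> S"
  shows "pres_gen K S R s = pres_gen K S R t \<oplus>\<^bsub>pres_vs K S R\<^esub> pres_gen K S R u"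
  using pres_gen_rel_zero[OF assms(1)] assms(2-) pres_gen_carrier
  by (simp add: lin_minus[OF pres_quot(2) free_vs pres_vs] module_hom_add[OF pres_quot(2)] free_vs
    pres_vs vs_minus_eq_zero pres_gen_def)

lemma pres_rel_smult:
  assumes "free_gen K s \<ominus>\<^bsub>free_vs K S\<^esub> r \<odot>\<^bsub>free_vs K S\<^esub> free_gen K t \<in> R"
    and "s \<in> S" "t \<in> S" "r \<in> carrier K"
  shows "pres_gen K S R s = r \<odot>\<^bsub>pres_vs K S R\<^esub> pres_gen K S R t"
  using pres_gen_rel_zero[OF assms(1)] assms(2-) pres_gen_carrier
  by (simp add: lin_minus[OF pres_quot(2) free_vs pres_vs] module_hom_smult[OF pres_quot(2)] free_vs
    pres_vs vs_minus_eq_zero pres_gen_def)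

end

text \<open>Counterpart of \<open>pres_rel_add\<close> on the side of maps: an additivity law for
  \<open>g\<close> is what makes its extension vanish on a relation of this shape.\<close>

lemma free_ext_rel_add:
  assumes "vectorspace K W" "g \<in> S \<rightarrow> carrier W" "s \<in> S" "t \<in> S" "u \<in> S" "g s = g t \<oplus>\<^bsub>W\<^esub> g u"
  shows "free_ext W g (free_gen K s \<ominus>\<^bsub>free_vs K S\<^esub> (free_gen K t \<oplus>\<^bsub>free_vs K S\<^esub> free_gen K u)) = \<zero>\<^bsub>W\<^esub>"
  using assms Pi_mem[OF assms(2)]
  by (simp add: lin_minus[OF free_ext_lin[of W g S]] module_hom_add[OF free_ext_lin[of W g S]] free_vs
    free_ext_gen vs_minus_eq_zero)

lemma free_ext_rel_smult:
  assumes "vectorspace K W" "g \<in> S \<rightarrow> carrier W" "s \<in> S" "t \<in> S" "r \<in> carrier K" "g s = r \<odot>\<^bsub>W\<^esub> g t"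
  shows "free_ext W g (free_gen K s \<ominus>\<^bsub>free_vs K S\<^esub> r \<odot>\<^bsub>free_vs K S\<^esub> free_gen K t) = \<zero>\<^bsub>W\<^esub>"
  using assms Pi_mem[OF assms(2)]
  by (simp add: lin_minus[OF free_ext_lin[of W g S]] module_hom_smult[OF free_ext_lin[of W g S]] free_vs
    free_ext_gen vs_minus_eq_zero)

lemma lspan_trans:
  assumes "x \<in> lspan K A G" "G \<subseteq> lspan K A H"
  shows "x \<in> lspan K A H"
  using assms(1) by induct (use assms(2) in \<open>auto intro: lspan.intros\<close>)

lemma generates_lspan: "generates K A G \<Longrightarrow> x \<in> carrier A \<Longrightarrow> x \<in> lspan K A G"
  by (auto simp: generates_def)

lemma self_vs_simps [simp]:
  "carrier (self_vs K) = carrier K" "add (self_vs K) = add K" "smult (self_vs K) = mult K"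
  "zero (self_vs K) = \<zero>"
  by (simp_all add: self_vs_def)

lemma self_vs [simp]: "vectorspace K (self_vs K)"
proof (intro vectorspaceI moduleI abelian_groupI)
  show "\<exists>y\<in>carrier (self_vs K). y \<oplus>\<^bsub>self_vs K\<^esub> x = \<zero>\<^bsub>self_vs K\<^esub>" if "x \<in> carrier (self_vs K)" for x
    using that by (intro bexI[of _ "\<ominus> x"]) (auto simp: l_neg)
qed (auto simp: is_cring a_ac l_distr r_distr m_assoc)

section \<open>Bilinear maps and binary tensor products\<close>

definition bilin :: "('k, 'a) module \<Rightarrow> ('k, 'b) module \<Rightarrow> ('k, 'w) module \<Rightarrow> ('a \<Rightarrow> 'b \<Rightarrow> 'w) \<Rightarrow> bool" where
  "bilin A B W h \<longleftrightarrow> (\<forall>a\<in>carrier A. h a \<in> lin B W) \<and> (\<forall>b\<in>carrier B. (\<lambda>a. h a b) \<in> lin A W)"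

lemma bilinI:
  assumes "\<And>a. a \<in> carrier A \<Longrightarrow> (\<lambda>b. h a b) \<in> lin B W" "\<And>b. b \<in> carrier B \<Longrightarrow> (\<lambda>a. h a b) \<in> lin A W"
  shows "bilin A B W h"
  using assms by (simp add: bilin_def)

lemma bilin_closed: "\<lbrakk>bilin A B W h; a \<in> carrier A; b \<in> carrier B\<rbrakk> \<Longrightarrow> h a b \<in> carrier W"
  by (auto simp: bilin_def intro: lin_closed)

text \<open>One equivalence serves three choices of \<open>Q\<close>: lying in the free space, being
  killed by an extension, and lying in \<open>tensor_rel\<close> itself, which yields the
  introduction rules \<open>tensor_relI\<close>. \<open>T_rel_ball\<close> plays the same part for
  unordered tensors.\<close>

lemma tensor_rel_ball:
  "(\<forall>r\<in>tensor_rel K A B. Q r) \<longleftrightarrow> (let F = free_vs K (carrier A \<times> carrier B); e = free_gen K in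
    (\<forall>a\<in>carrier A. \<forall>a'\<in>carrier A. \<forall>b\<in>carrier B.
       Q (e (a \<oplus>\<^bsub>A\<^esub> a', b) \<ominus>\<^bsub>F\<^esub> (e (a, b) \<oplus>\<^bsub>F\<^esub> e (a', b)))) \<and>
    (\<forall>a\<in>carrier A. \<forall>b\<in>carrier B. \<forall>b'\<in>carrier B.
       Q (e (a, b \<oplus>\<^bsub>B\<^esub> b') \<ominus>\<^bsub>F\<^esub> (e (a, b) \<oplus>\<^bsub>F\<^esub> e (a, b')))) \<and>
    (\<forall>r\<in>carrier K. \<forall>a\<in>carrier A. \<forall>b\<in>carrier B.
       Q (e (r \<odot>\<^bsub>A\<^esub> a, b) \<ominus>\<^bsub>F\<^esub> r \<odot>\<^bsub>F\<^esub> e (a, b))) \<and>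
    (\<forall>r\<in>carrier K. \<forall>a\<in>carrier A. \<forall>b\<in>carrier B.
       Q (e (a, r \<odot>\<^bsub>B\<^esub> b) \<ominus>\<^bsub>F\<^esub> r \<odot>\<^bsub>F\<^esub> e (a, b))))"
  unfolding tensor_rel_def Let_def by blast

lemmas tensor_relI = tensor_rel_ball[where Q = "\<lambda>r. r \<in> tensor_rel K A B" for A B, unfolded Let_def,
  THEN iffD1, OF ballI]

context
  fixes A :: "('k, 'a) module" and B :: "('k, 'b) module"
  assumes A: "vectorspace K A" and B: "vectorspace K B"
begin

lemma tensor_rel_carrier: "tensor_rel K A B \<subseteq> carrier (free_vs K (carrier A \<times> carrier B))"
  unfolding subset_eq tensor_rel_ball Let_def using A B by (auto simp: free_vs)

lemma tensor_vs: "vectorspace K (A \<boxtimes> B)"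
  unfolding tensor_def by (rule pres_vs[OF tensor_rel_carrier])

lemma pure_bilin: "bilin A B (A \<boxtimes> B) (pure K A B)"
proof (intro bilinI linI)
  fix a b assume a: "a \<in> carrier A" and b: "b \<in> carrier B"
  show "pure K A B a b \<in> carrier (A \<boxtimes> B)" "pure K A B a b \<in> carrier (A \<boxtimes> B)"
    unfolding tensor_def pure_def using a b by (auto intro: pres_gen_carrier[OF tensor_rel_carrier])
  { fix r assume r: "r \<in> carrier K"
    show "pure K A B a (r \<odot>\<^bsub>B\<^esub> b) = r \<odot>\<^bsub>A \<boxtimes> B\<^esub> pure K A B a b"
      unfolding tensor_def pure_def using a b r A B
      by (intro pres_rel_smult[OF tensor_rel_carrier]) (simp_all add: tensor_relI)
    show "pure K A B (r \<odot>\<^bsub>A\<^esub> a) b = r \<odot>\<^bsub>A \<boxtimes> B\<^esub> pure K A B a b"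
      unfolding tensor_def pure_def using a b r A B
      by (intro pres_rel_smult[OF tensor_rel_carrier]) (simp_all add: tensor_relI) }
  { fix b' assume b': "b' \<in> carrier B"
    show "pure K A B a (b \<oplus>\<^bsub>B\<^esub> b') = pure K A B a b \<oplus>\<^bsub>A \<boxtimes> B\<^esub> pure K A B a b'"
      unfolding tensor_def pure_def using a b b' A B
      by (intro pres_rel_add[OF tensor_rel_carrier]) (simp_all add: tensor_relI) }
  { fix a' assume a': "a' \<in> carrier A"
    show "pure K A B (a \<oplus>\<^bsub>A\<^esub> a') b = pure K A B a b \<oplus>\<^bsub>A \<boxtimes> B\<^esub> pure K A B a' b"
      unfolding tensor_def pure_def using a b a' A B
      by (intro pres_rel_add[OF tensor_rel_carrier]) (simp_all add: tensor_relI) }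
qed

lemma pure_carrier: "\<lbrakk>a \<in> carrier A; b \<in> carrier B\<rbrakk> \<Longrightarrow> pure K A B a b \<in> carrier (A \<boxtimes> B)"
  by (rule bilin_closed[OF pure_bilin])

lemma pure_lin:
  "a \<in> carrier A \<Longrightarrow> pure K A B a \<in> lin B (A \<boxtimes> B)"
  "b \<in> carrier B \<Longrightarrow> (\<lambda>a. pure K A B a b) \<in> lin A (A \<boxtimes> B)"
  using pure_bilin by (auto simp: bilin_def)

text \<open>The two arguments of \<open>pure\<close> are extended from generators to arbitrary
  vectors one after the other, first the second and then the first, each time by linearity in the
  argument that moves.\<close>

lemma tensor_generates:
  assumes "generates K A G" "generates K B H"
  shows "generates K (A \<boxtimes> B) {pure K A B a b | a b. a \<in> G \<and> b \<in> H}"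
proof -
  let ?P = "{pure K A B a b | a b. a \<in> G \<and> b \<in> H}"
  have G: "G \<subseteq> carrier A" and H: "H \<subseteq> carrier B" using assms by (auto simp: generates_def)
  have 1: "pure K A B a b \<in> lspan K (A \<boxtimes> B) ?P" if a: "a \<in> G" and b: "b \<in> carrier B" for a b
    by (rule lspan_lin_image[OF pure_lin(1) B tensor_vs H generates_lspan[OF assms(2) b]])
      (use a G in \<open>auto intro!: lspan_base\<close>)
  have 2: "pure K A B a b \<in> lspan K (A \<boxtimes> B) ?P" if a: "a \<in> carrier A" and b: "b \<in> carrier B" for a b
    by (rule lspan_lin_image[OF pure_lin(2)[OF b] A tensor_vs G generates_lspan[OF assms(1) a]])
      (use 1 b in auto)
  have "carrier (A \<boxtimes> B) \<subseteq> lspan K (A \<boxtimes> B) ?P"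
  proof
    fix x assume "x \<in> carrier (A \<boxtimes> B)"
    from generates_lspan[OF pres_generates[OF tensor_rel_carrier], folded tensor_def, OF this]
    show "x \<in> lspan K (A \<boxtimes> B) ?P"
      by (rule lspan_trans) (auto simp: 2[unfolded pure_def] pure_def)
  qed
  then show ?thesis
    unfolding generates_def using G H by (auto intro!: pure_carrier)
qed

text \<open>The four families of relations are the four laws of bilinearity, so the free extension
  of a bilinear map kills them.\<close>

lemma tensor_lift:
  assumes W: "vectorspace K W" and h: "bilin A B W h"
  shows "pres_lift K W (\<lambda>(a, b). h a b) \<in> lin (A \<boxtimes> B) W"
    and "\<lbrakk>a \<in> carrier A; b \<in> carrier B\<rbrakk> \<Longrightarrow> pres_lift K W (\<lambda>(a, b). h a b) (pure K A B a b) = h a b"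
proof -
  let ?h = "\<lambda>(a, b). h a b"
  have c: "?h \<in> carrier A \<times> carrier B \<rightarrow> carrier W"
    using bilin_closed[OF h] by auto
  have h1: "\<And>a. a \<in> carrier A \<Longrightarrow> h a \<in> lin B W" and h2: "\<And>b. b \<in> carrier B \<Longrightarrow> (\<lambda>a. h a b) \<in> lin A W"
    using h by (auto simp: bilin_def)
  have 0: "free_ext W ?h r = \<zero>\<^bsub>W\<^esub>" if "r \<in> tensor_rel K A B" for r
    by (rule bspec[OF _ that], unfold tensor_rel_ball Let_def, intro conjI ballI;
        (rule free_ext_rel_add[OF W c] | rule free_ext_rel_smult[OF W c]))
      (auto simp: A B module_hom_add[OF h1] module_hom_add[OF h2] module_hom_smult[OF h1]
        module_hom_smult[OF h2])
  show "pres_lift K W ?h \<in> lin (A \<boxtimes> B) W"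
    unfolding tensor_def by (rule lift_lin[OF tensor_rel_carrier W c 0])
  show "pres_lift K W ?h (pure K A B a b) = h a b" if "a \<in> carrier A" "b \<in> carrier B"
    unfolding pure_def using that by (simp add: lift_gen[OF tensor_rel_carrier W c 0])
qed

text \<open>For each fixed pair only linearity in the parameter \<open>c\<close> is demanded, not
  bilinearity of \<open>h c\<close>. This is the device that handles nested lifts.\<close>

lemma tensor_param:
  assumes W: "vectorspace K W" and t: "t \<in> carrier (A \<boxtimes> B)"
    and "\<And>a b. \<lbrakk>a \<in> carrier A; b \<in> carrier B\<rbrakk> \<Longrightarrow> (\<lambda>c. h c a b) \<in> lin C W"
  shows "(\<lambda>c. pres_lift K W (\<lambda>(a, b). h c a b) t) \<in> lin C W"
  by (rule lift_param[OF tensor_rel_carrier W t[unfolded tensor_def]]) (use assms(3) in auto)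

end

declare tensor_vs [simp] pure_carrier [simp]

section \<open>Tensor products of maps and canonical isomorphisms\<close>

lemma tmap_aux:
  assumes "vectorspace K C" "vectorspace K D" "f \<in> lin A C" "g \<in> lin B D"
  shows "bilin A B (C \<boxtimes> D) (\<lambda>a b. pure K C D (f a) (g b))"
  by (rule bilinI)
    (auto intro: lin_comp[OF assms(4) pure_lin(1)] lin_comp[OF assms(3) pure_lin(2)] assms
      lin_closed[OF assms(3)] lin_closed[OF assms(4)])

lemma tmap_lin:
  assumes "vectorspace K A" "vectorspace K B" "vectorspace K C" "vectorspace K D"
    "f \<in> lin A C" "g \<in> lin B D"
  shows "tmap K C D f g \<in> lin (A \<boxtimes> B) (C \<boxtimes> D)"
  unfolding tmap_def using assms by (intro tensor_lift tmap_aux) auto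

lemma tmap_pure:
  assumes "vectorspace K A" "vectorspace K B" "vectorspace K C" "vectorspace K D"
    "f \<in> lin A C" "g \<in> lin B D" "a \<in> carrier A" "b \<in> carrier B"
  shows "tmap K C D f g (pure K A B a b) = pure K C D (f a) (g b)"
  unfolding tmap_def using assms by (subst tensor_lift(2)[OF _ _ _ tmap_aux]) auto

context
  fixes A :: "('k, 'a) module" and B :: "('k, 'b) module" and C :: "('k, 'c) module"
  assumes vs: "vectorspace K A" "vectorspace K B" "vectorspace K C"
begin

lemma tassoc_aux1:
  assumes "c \<in> carrier C"
  shows "bilin A B (A \<boxtimes> (B \<boxtimes> C)) (\<lambda>a b. pure K A (B \<boxtimes> C) a (pure K B C b c))"
  using assms vs
  by (intro bilinI) (auto intro: lin_comp[OF pure_lin(2) pure_lin(1)] pure_lin(2))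

text \<open>Linearity in \<open>s\<close> is that of a lifted bilinear map
  (\<open>tassoc_aux1\<close>); linearity in \<open>c\<close>, which enters only as a parameter of
  the lift, is \<open>tensor_param\<close>.\<close>

lemma tassoc_aux2:
  "bilin (A \<boxtimes> B) C (A \<boxtimes> (B \<boxtimes> C))
     (\<lambda>s c. pres_lift K (A \<boxtimes> (B \<boxtimes> C)) (\<lambda>(a, b). pure K A (B \<boxtimes> C) a (pure K B C b c)) s)"
  using vs
  by (intro bilinI tensor_param tensor_lift(1) tassoc_aux1) (auto intro: lin_comp[OF pure_lin(1) pure_lin(1)])

lemma tassoc_lin: "tassoc K A B C \<in> lin ((A \<boxtimes> B) \<boxtimes> C) (A \<boxtimes> (B \<boxtimes> C))"
  unfolding tassoc_def Let_def using vs by (intro tensor_lift(1) tassoc_aux2) auto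

lemma tassoc_pure:
  assumes "a \<in> carrier A" "b \<in> carrier B" "c \<in> carrier C"
  shows "tassoc K A B C (pure K (A \<boxtimes> B) C (pure K A B a b) c) = pure K A (B \<boxtimes> C) a (pure K B C b c)"
  unfolding tassoc_def Let_def using vs assms
  by (subst tensor_lift(2)[OF _ _ _ tassoc_aux2]; (subst tensor_lift(2)[OF _ _ _ tassoc_aux1])?) auto

end

context
  fixes A :: "('k, 'a) module"
  assumes vs: "vectorspace K A"
begin

lemma smult_bilin: "bilin (self_vs K) A A (\<lambda>r a. r \<odot>\<^bsub>A\<^esub> a)"
proof -
  interpret A: module K A using vs by (rule vs_module)
  show ?thesis
    by (intro bilinI linI)
      (auto simp: A.smult_l_distr A.smult_r_distr A.smult_assoc1[symmetric] m_comm)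
qed

lemma lunit_lin: "lunit K A \<in> lin (self_vs K \<boxtimes> A) A"
  unfolding lunit_def using vs by (intro tensor_lift(1) smult_bilin) auto

lemma lunit_pure:
  "\<lbrakk>r \<in> carrier K; a \<in> carrier A\<rbrakk> \<Longrightarrow> lunit K A (pure K (self_vs K) A r a) = r \<odot>\<^bsub>A\<^esub> a"
  unfolding lunit_def using vs by (subst tensor_lift(2)[OF _ _ _ smult_bilin]) auto

lemma smult_bilin': "bilin A (self_vs K) A (\<lambda>a r. r \<odot>\<^bsub>A\<^esub> a)"
  using smult_bilin by (simp add: bilin_def)

lemma runit_lin: "runit K A \<in> lin (A \<boxtimes> self_vs K) A"
  unfolding runit_def using vs by (intro tensor_lift(1) smult_bilin') auto

lemma runit_pure:
  "\<lbrakk>r \<in> carrier K; a \<in> carrier A\<rbrakk> \<Longrightarrow> runit K A (pure K A (self_vs K) a r) = r \<odot>\<^bsub>A\<^esub> a"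
  unfolding runit_def using vs by (subst tensor_lift(2)[OF _ _ _ smult_bilin']) auto

end

context
  fixes A :: "('k, 'a) module" and B :: "('k, 'b) module" and C :: "('k, 'c) module"
    and D :: "('k, 'd) module"
  assumes vs: "vectorspace K A" "vectorspace K B" "vectorspace K C" "vectorspace K D"
begin

text \<open>The three auxiliary lemmas follow the nesting of \<open>mid_flip\<close> from the inside
  out: pure tensors on both sides, then an arbitrary \<open>t\<close> with \<open>a\<close> and
  \<open>b\<close> still free, then arbitrary \<open>s\<close> and \<open>t\<close>.\<close>

lemma mid_flip_aux1:
  assumes "a \<in> carrier A" "b \<in> carrier B"
  shows "bilin C D ((A \<boxtimes> C) \<boxtimes> (B \<boxtimes> D))
    (\<lambda>c d. pure K (A \<boxtimes> C) (B \<boxtimes> D) (pure K A C a c) (pure K B D b d))"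
  using assms vs
  by (intro bilinI) (auto intro: lin_comp[OF pure_lin(1) pure_lin(1)] lin_comp[OF pure_lin(1) pure_lin(2)])

lemma mid_flip_aux2:
  assumes "t \<in> carrier (C \<boxtimes> D)"
  shows "bilin A B ((A \<boxtimes> C) \<boxtimes> (B \<boxtimes> D))
    (\<lambda>a b. pres_lift K ((A \<boxtimes> C) \<boxtimes> (B \<boxtimes> D))
       (\<lambda>(c, d). pure K (A \<boxtimes> C) (B \<boxtimes> D) (pure K A C a c) (pure K B D b d)) t)"
  using assms vs
  by (intro bilinI tensor_param[where A = C and B = D])
    (auto intro: lin_comp[OF pure_lin(2) pure_lin(1)] lin_comp[OF pure_lin(2) pure_lin(2)])

lemma mid_flip_aux3:
  "bilin (A \<boxtimes> B) (C \<boxtimes> D) ((A \<boxtimes> C) \<boxtimes> (B \<boxtimes> D))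
    (\<lambda>s t. pres_lift K ((A \<boxtimes> C) \<boxtimes> (B \<boxtimes> D)) (\<lambda>(a, b). pres_lift K ((A \<boxtimes> C) \<boxtimes> (B \<boxtimes> D))
       (\<lambda>(c, d). pure K (A \<boxtimes> C) (B \<boxtimes> D) (pure K A C a c) (pure K B D b d)) t) s)"
  using vs
  by (intro bilinI tensor_lift(1) mid_flip_aux2)
    (auto intro!: tensor_param[where A = A and B = B] tensor_lift(1) mid_flip_aux1)

lemma mid_flip_lin:
  "mid_flip K A B C D \<in> lin ((A \<boxtimes> B) \<boxtimes> (C \<boxtimes> D)) ((A \<boxtimes> C) \<boxtimes> (B \<boxtimes> D))"
  unfolding mid_flip_def Let_def using vs by (intro tensor_lift(1) mid_flip_aux3) auto

lemma mid_flip_pure: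
  assumes "a \<in> carrier A" "b \<in> carrier B" "c \<in> carrier C" "d \<in> carrier D"
  shows "mid_flip K A B C D (pure K (A \<boxtimes> B) (C \<boxtimes> D) (pure K A B a b) (pure K C D c d)) =
    pure K (A \<boxtimes> C) (B \<boxtimes> D) (pure K A C a c) (pure K B D b d)"
  unfolding mid_flip_def Let_def using vs assms
  by (simp add: tensor_lift(2)[OF _ _ _ mid_flip_aux3] tensor_lift(2)[OF _ _ _ mid_flip_aux2]
    tensor_lift(2)[OF _ _ _ mid_flip_aux1])

end

section \<open>Multilinear maps and unordered tensor products\<close>

text \<open>Generators of \<open>T K A X\<close> are functions that are \<open>undefined\<close>
  outside \<open>X\<close>, while updating and gluing are simpler for total functions. The condition
  on \<open>restrict v X\<close> bridges the two: values outside \<open>X\<close> must not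
  matter.\<close>

definition multilin :: "'x set \<Rightarrow> ('k, 'a) module \<Rightarrow> ('k, 'w) module \<Rightarrow> (('x \<Rightarrow> 'a) \<Rightarrow> 'w) \<Rightarrow> bool" where
  "multilin X A W h \<longleftrightarrow> (\<forall>v\<in>X \<rightarrow> carrier A. h v \<in> carrier W \<and> h (restrict v X) = h v \<and>
     (\<forall>x\<in>X. (\<lambda>a. h (v(x := a))) \<in> lin A W))"

lemma multilinI:
  assumes "\<And>v. v \<in> X \<rightarrow> carrier A \<Longrightarrow> h v \<in> carrier W"
    and "\<And>v. v \<in> X \<rightarrow> carrier A \<Longrightarrow> h (restrict v X) = h v"
    and "\<And>v x. \<lbrakk>v \<in> X \<rightarrow> carrier A; x \<in> X\<rbrakk> \<Longrightarrow> (\<lambda>a. h (v(x := a))) \<in> lin A W"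
  shows "multilin X A W h"
  using assms by (simp add: multilin_def)

lemma multilinD:
  assumes "multilin X A W h" "v \<in> X \<rightarrow> carrier A"
  shows "h v \<in> carrier W" "h (restrict v X) = h v" "x \<in> X \<Longrightarrow> (\<lambda>a. h (v(x := a))) \<in> lin A W"
  using assms by (simp_all add: multilin_def)

lemma multilin_cong:
  assumes "multilin X A W h" "v \<in> X \<rightarrow> carrier A" "\<And>x. x \<in> X \<Longrightarrow> v x = w x"
  shows "h v = h w"
proof -
  have "w \<in> X \<rightarrow> carrier A" using assms(2,3) by (metis Pi_cong)
  moreover have "restrict v X = restrict w X" using assms(3) by (rule restrict_ext)
  ultimately show ?thesis using assms(1,2) by (metis multilinD(2))
qed

lemma multilin_comp: "\<lbrakk>multilin X A W h; f \<in> lin W U\<rbrakk> \<Longrightarrow> multilin X A U (\<lambda>v. f (h v))"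
  by (auto simp: multilin_def intro: lin_closed intro!: lin_comp[of _ A W f U])

text \<open>Makes \<open>T_map\<close> well defined: an update of slot \<open>x\<close> passes
  through \<open>f\<close>, and \<open>f\<close> is linear in the new entry.\<close>

lemma multilin_precomp:
  assumes "multilin X B W h" "f \<in> lin A B"
  shows "multilin X A W (\<lambda>v. h (\<lambda>x. f (v x)))"
proof (rule multilinI)
  fix v assume "v \<in> X \<rightarrow> carrier A"
  then have fv: "(\<lambda>x. f (v x)) \<in> X \<rightarrow> carrier B" using lin_closed[OF assms(2)] by auto
  from multilinD(1)[OF assms(1) this] show "h (\<lambda>x. f (v x)) \<in> carrier W" .
  show "h (\<lambda>x. f (restrict v X x)) = h (\<lambda>x. f (v x))"
    by (rule multilin_cong[OF assms(1) fv, symmetric]) simp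
  fix x assume "x \<in> X"
  then have "(\<lambda>a. h ((\<lambda>x. f (v x))(x := f a))) \<in> lin A W"
    by (rule lin_comp[OF assms(2) multilinD(3)[OF assms(1) fv]])
  moreover have "(\<lambda>y. f ((v(x := a)) y)) = (\<lambda>x. f (v x))(x := f a)" for a by auto
  ultimately show "(\<lambda>a. h (\<lambda>y. f ((v(x := a)) y))) \<in> lin A W" by simp
qed

lemma T_rel_ball:
  "(\<forall>r\<in>T_rel K A X. Q r) \<longleftrightarrow> (let S = X \<rightarrow>\<^sub>E carrier A; F = free_vs K S; e = free_gen K in
    (\<forall>v\<in>S. \<forall>x\<in>X. \<forall>a\<in>carrier A. \<forall>b\<in>carrier A.
       Q (e (v(x := a \<oplus>\<^bsub>A\<^esub> b)) \<ominus>\<^bsub>F\<^esub> (e (v(x := a)) \<oplus>\<^bsub>F\<^esub> e (v(x := b))))) \<and>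
    (\<forall>v\<in>S. \<forall>x\<in>X. \<forall>r\<in>carrier K. \<forall>a\<in>carrier A.
       Q (e (v(x := r \<odot>\<^bsub>A\<^esub> a)) \<ominus>\<^bsub>F\<^esub> r \<odot>\<^bsub>F\<^esub> e (v(x := a)))))"
  unfolding T_rel_def Let_def by blast

lemmas T_relI = T_rel_ball[where Q = "\<lambda>r. r \<in> T_rel K A X" for A X, unfolded Let_def,
  THEN iffD1, OF ballI]

lemma PiE_upd: "\<lbrakk>v \<in> X \<rightarrow>\<^sub>E S; x \<in> X; a \<in> S\<rbrakk> \<Longrightarrow> v(x := a) \<in> X \<rightarrow>\<^sub>E S"
  using PiE_fun_upd[of a "\<lambda>_. S" x v X] by (simp add: insert_absorb)

context
  fixes A :: "('k, 'a) module" and X :: "'x set"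
  assumes A: "vectorspace K A"
begin

lemma T_rel_carrier: "T_rel K A X \<subseteq> carrier (free_vs K (X \<rightarrow>\<^sub>E carrier A))"
  unfolding subset_eq T_rel_ball Let_def using A
  by (intro conjI ballI vs_minus vs_add vs_smult free_vs free_gen_carrier PiE_upd) auto

lemma T_vs: "vectorspace K (T K A X)"
  unfolding T_def by (rule pres_vs[OF T_rel_carrier])

lemma tens_multilin: "multilin X A (T K A X) (tens K A X)"
proof (intro multilinI linI)
  fix v assume v: "v \<in> X \<rightarrow> carrier A"
  show c: "tens K A X v \<in> carrier (T K A X)" if "v \<in> X \<rightarrow> carrier A" for v
    unfolding T_def tens_def using that by (intro pres_gen_carrier[OF T_rel_carrier]) auto
  show "tens K A X (restrict v X) = tens K A X v" by (simp add: tens_def)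
  fix x a assume x: "x \<in> X" and a: "a \<in> carrier A"
  then show "tens K A X (v(x := a)) \<in> carrier (T K A X)" using v by (intro c) auto
  have r: "restrict (v(x := a)) X = (restrict v X)(x := a)" for a using x by auto
  have p: "(restrict v X)(x := a) \<in> X \<rightarrow>\<^sub>E carrier A" if "a \<in> carrier A" for a
    using v x that by auto
  { fix s assume "s \<in> carrier K"
    then show "tens K A X (v(x := s \<odot>\<^bsub>A\<^esub> a)) = s \<odot>\<^bsub>T K A X\<^esub> tens K A X (v(x := a))"
      unfolding T_def tens_def r using a v x A
      by (intro pres_rel_smult[OF T_rel_carrier] p) (simp_all add: T_relI) }
  { fix b assume "b \<in> carrier A"
    then show "tens K A X (v(x := a \<oplus>\<^bsub>A\<^esub> b)) = tens K A X (v(x := a)) \<oplus>\<^bsub>T K A X\<^esub> tens K A X (v(x := b))"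
      unfolding T_def tens_def r using a v x A
      by (intro pres_rel_add[OF T_rel_carrier] p) (simp_all add: T_relI) }
qed

lemma tens_carrier: "v \<in> X \<rightarrow> carrier A \<Longrightarrow> tens K A X v \<in> carrier (T K A X)"
  by (rule multilinD(1)[OF tens_multilin])

text \<open>The slots are specialised to \<open>G\<close> one at a time, each by linearity in that
  slot; finiteness of \<open>X\<close> makes this process end.\<close>

lemma T_generates:
  assumes "generates K A G" "finite X"
  shows "generates K (T K A X) {tens K A X v | v. v \<in> X \<rightarrow> G}"
proof -
  let ?P = "{tens K A X v | v. v \<in> X \<rightarrow> G}"
  have G: "G \<subseteq> carrier A" using assms(1) by (simp add: generates_def)
  \<comment> \<open>\<open>Y\<close> is the set of slots whose entries may still lie outside
    \<open>G\<close>. The instance \<open>Y = X\<close> puts no restriction on \<open>v\<close>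
    beyond the carrier.\<close>
  have "tens K A X v \<in> lspan K (T K A X) ?P"
    if "finite Y" "Y \<subseteq> X" "v \<in> X \<rightarrow> carrier A" "v \<in> X - Y \<rightarrow> G" for Y v
    using that
  proof (induct Y arbitrary: v)
    case empty
    then show ?case by (auto intro: lspan_base)
  next
    case (insert y Y)
    \<comment> \<open>The trivial update \<open>v(y := v y)\<close> exposes slot \<open>y\<close> as
      the argument of a linear map, so that its entry may be replaced by generators.\<close>
    have "tens K A X (v(y := v y)) \<in> lspan K (T K A X) ?P"
    proof (rule lspan_lin_image[OF multilinD(3)[OF tens_multilin] A T_vs G generates_lspan[OF assms(1)]])
      show "tens K A X (v(y := g)) \<in> lspan K (T K A X) ?P" if "g \<in> G" for g
        using insert.prems that G by (intro insert.hyps(3)) auto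
    qed (use insert.prems in auto)
    then show ?case by simp
  qed
  from this[OF assms(2) subset_refl]
  have *: "tens K A X v \<in> lspan K (T K A X) ?P" if "v \<in> X \<rightarrow> carrier A" for v
    using that by auto
  have "carrier (T K A X) \<subseteq> lspan K (T K A X) ?P"
  proof
    fix x assume "x \<in> carrier (T K A X)"
    then have "x \<in> lspan K (T K A X) (pres_gen K (X \<rightarrow>\<^sub>E carrier A) (T_rel K A X) ` (X \<rightarrow>\<^sub>E carrier A))"
      by (rule generates_lspan[OF pres_generates[OF T_rel_carrier], folded T_def])
    moreover have "pres_gen K (X \<rightarrow>\<^sub>E carrier A) (T_rel K A X) v \<in> lspan K (T K A X) ?P"
      if "v \<in> X \<rightarrow>\<^sub>E carrier A" for v
    proof -
      have "v \<in> X \<rightarrow> carrier A" "restrict v X = v" using that by auto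
      with *[of v] show ?thesis unfolding tens_def[of K A X v] by simp
    qed
    ultimately show "x \<in> lspan K (T K A X) ?P"
      by (elim lspan_trans) auto
  qed
  then show ?thesis
    unfolding generates_def using G by (auto intro!: tens_carrier)
qed

text \<open>The universal property of the unordered tensor product: linearity in each slot is what
  makes the free extension vanish on \<open>T_rel\<close>.\<close>

lemma T_lift:
  assumes W: "vectorspace K W" and h: "multilin X A W h"
  shows "pres_lift K W h \<in> lin (T K A X) W"
    and "v \<in> X \<rightarrow> carrier A \<Longrightarrow> pres_lift K W h (tens K A X v) = h v"
proof -
  have c: "h \<in> (X \<rightarrow>\<^sub>E carrier A) \<rightarrow> carrier W"
    using multilinD(1)[OF h] by auto
  have v: "v \<in> X \<rightarrow> carrier A" if "v \<in> X \<rightarrow>\<^sub>E carrier A" for v using that by auto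
  have 0: "free_ext W h r = \<zero>\<^bsub>W\<^esub>" if "r \<in> T_rel K A X" for r
    by (rule bspec[OF _ that], unfold T_rel_ball Let_def, intro conjI ballI;
        (rule free_ext_rel_add[OF W c] | rule free_ext_rel_smult[OF W c]))
      (auto simp: A module_hom_add[OF multilinD(3)[OF h v]] module_hom_smult[OF multilinD(3)[OF h v]]
         intro!: PiE_upd)
  show "pres_lift K W h \<in> lin (T K A X) W"
    unfolding T_def by (rule lift_lin[OF T_rel_carrier W c 0])
  show "pres_lift K W h (tens K A X v) = h v" if "v \<in> X \<rightarrow> carrier A"
    unfolding tens_def using that
    by (subst lift_gen[OF T_rel_carrier W c 0]) (auto simp: multilinD(2)[OF h])
qed

lemma T_param:
  assumes W: "vectorspace K W" and t: "t \<in> carrier (T K A X)"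
    and "\<And>v. v \<in> X \<rightarrow> carrier A \<Longrightarrow> (\<lambda>c. h c v) \<in> lin C W"
  shows "(\<lambda>c. pres_lift K W (h c) t) \<in> lin C W"
  by (rule lift_param[OF T_rel_carrier W t[unfolded T_def]]) (use assms(3) in auto)

lemma T_lift_cong:
  assumes W: "vectorspace K W" and t: "t \<in> carrier (T K A X)"
    and "\<And>v. v \<in> X \<rightarrow>\<^sub>E carrier A \<Longrightarrow> g v \<in> carrier W" "\<And>v. v \<in> X \<rightarrow>\<^sub>E carrier A \<Longrightarrow> g v = h v"
  shows "pres_lift K W g t = pres_lift K W h t"
  by (rule lift_cong[OF T_rel_carrier W t[unfolded T_def]]) (use assms(3,4) in auto)

end

declare T_vs [simp] tens_carrier [simp]

lemma tens_cong: "(\<And>x. x \<in> X \<Longrightarrow> v x = w x) \<Longrightarrow> tens K A X v = tens K A X w"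
  unfolding tens_def by (simp cong: restrict_cong)

end

section \<open>Structure maps of the species of tensors\<close>

text \<open>Functoriality in the vector space with the index set fixed, whereas \<open>T_act\<close>
  is functoriality in the index set.\<close>

definition T_map :: "'k ring \<Rightarrow> ('k, 'b) module \<Rightarrow> 'x set \<Rightarrow> ('a \<Rightarrow> 'b)
    \<Rightarrow> (('x \<Rightarrow> 'a) \<Rightarrow> 'k) set \<Rightarrow> (('x \<Rightarrow> 'b) \<Rightarrow> 'k) set" where
  "T_map K B X f = pres_lift K (T K B X) (\<lambda>v. tens K B X (\<lambda>x. f (v x)))"

text \<open>The choice is from a nonempty set when \<open>X\<close> is finite, by \<open>shuffle_exists\<close> below.\<close>

definition shuffle :: "'k ring \<Rightarrow> ('k, 'a) module \<Rightarrow> ('k, 'b) module \<Rightarrow> 'x set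
    \<Rightarrow> (('x \<Rightarrow> ('a \<times> 'b \<Rightarrow> 'k) set) \<Rightarrow> 'k) set
    \<Rightarrow> ((('x \<Rightarrow> 'a) \<Rightarrow> 'k) set \<times> (('x \<Rightarrow> 'b) \<Rightarrow> 'k) set \<Rightarrow> 'k) set" where
  "shuffle K A B X = (SOME f. f \<in> module_hom K (T K (A \<boxtimes>\<^bsub>K\<^esub> B) X) (T K A X \<boxtimes>\<^bsub>K\<^esub> T K B X) \<and>
     (\<forall>a\<in>X \<rightarrow> carrier A. \<forall>b\<in>X \<rightarrow> carrier B.
        f (tens K (A \<boxtimes>\<^bsub>K\<^esub> B) X (\<lambda>x. pure K A B (a x) (b x))) =
        pure K (T K A X) (T K B X) (tens K A X a) (tens K B X b)))"

context ground_field
begin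

lemma lin_pure: "\<lbrakk>vectorspace K A; vectorspace K B; f \<in> lin C A; b \<in> carrier B\<rbrakk> \<Longrightarrow>
    (\<lambda>c. pure K A B (f c) b) \<in> lin C (A \<boxtimes> B)"
  "\<lbrakk>vectorspace K A; vectorspace K B; a \<in> carrier A; g \<in> lin C B\<rbrakk> \<Longrightarrow>
    (\<lambda>c. pure K A B a (g c)) \<in> lin C (A \<boxtimes> B)"
  by (auto intro: lin_comp[OF _ pure_lin(1)] lin_comp[OF _ pure_lin(2)])

lemma glue_carrier:
  "\<lbrakk>v \<in> X \<rightarrow> S; w \<in> Y \<rightarrow> S\<rbrakk> \<Longrightarrow> glue X v w \<in> X \<union> Y \<rightarrow> S"
  by (auto simp: glue_def)

context
  fixes A :: "('k, 'a) module"
  assumes A [simp]: "vectorspace K A"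
begin

lemmas tens_lin = multilinD(3)[OF tens_multilin[OF A]]

lemma T_act_multilin:
  assumes "bij_betw \<sigma> X Y"
  shows "multilin X A (T K A Y) (\<lambda>v. tens K A Y (\<lambda>y. v (inv_into X \<sigma> y)))"
proof (rule multilinI)
  have inv: "inv_into X \<sigma> y \<in> X" "\<sigma> (inv_into X \<sigma> y) = y" if "y \<in> Y" for y
    using that assms by (auto simp: bij_betw_def inv_into_into f_inv_into_f)
  fix v assume v: "v \<in> X \<rightarrow> carrier A"
  then have v': "(\<lambda>y. v (inv_into X \<sigma> y)) \<in> Y \<rightarrow> carrier A" using inv by auto
  then show "tens K A Y (\<lambda>y. v (inv_into X \<sigma> y)) \<in> carrier (T K A Y)" by simp
  show "tens K A Y (\<lambda>y. restrict v X (inv_into X \<sigma> y)) = tens K A Y (\<lambda>y. v (inv_into X \<sigma> y))"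
    by (rule tens_cong) (simp add: inv)
  fix x assume x: "x \<in> X"
  then have "\<sigma> x \<in> Y" "inv_into X \<sigma> (\<sigma> x) = x" using assms by (auto simp: bij_betw_def)
  \<comment> \<open>Changing slot \<open>x\<close> of \<open>v\<close> changes slot
    \<open>\<sigma> x\<close> of the transported family, and no other.\<close>
  moreover have "tens K A Y (\<lambda>y. (v(x := a)) (inv_into X \<sigma> y)) =
      tens K A Y ((\<lambda>y. v (inv_into X \<sigma> y))(\<sigma> x := a))" for a
    using inv(2) calculation by (intro tens_cong) auto
  ultimately show "(\<lambda>a. tens K A Y (\<lambda>y. (v(x := a)) (inv_into X \<sigma> y))) \<in> lin A (T K A Y)"
    using tens_lin[OF v'] by simp
qed

lemma T_act_lin: "bij_betw \<sigma> X Y \<Longrightarrow> T_act K A X \<sigma> \<in> lin (T K A X) (T K A Y)"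
  unfolding T_act_def by (simp add: bij_betw_imp_surj_on T_lift(1)[OF A _ T_act_multilin])

lemma T_act_tens:
  "\<lbrakk>bij_betw \<sigma> X Y; v \<in> X \<rightarrow> carrier A\<rbrakk> \<Longrightarrow>
    T_act K A X \<sigma> (tens K A X v) = tens K A Y (\<lambda>y. v (inv_into X \<sigma> y))"
  unfolding T_act_def by (simp add: bij_betw_imp_surj_on T_lift(2)[OF A _ T_act_multilin])

context
  fixes X Y :: "'x set"
  assumes disjoint: "X \<inter> Y = {}"
begin

lemma T_mult_aux1:
  assumes v: "v \<in> X \<rightarrow> carrier A"
  shows "multilin Y A (T K A (X \<union> Y)) (\<lambda>w. tens K A (X \<union> Y) (glue X v w))"
proof (rule multilinI)
  fix w assume w: "w \<in> Y \<rightarrow> carrier A"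
  show "tens K A (X \<union> Y) (glue X v w) \<in> carrier (T K A (X \<union> Y))"
    by (intro tens_carrier glue_carrier A v w)
  show "tens K A (X \<union> Y) (glue X v (restrict w Y)) = tens K A (X \<union> Y) (glue X v w)"
    by (rule tens_cong) (auto simp: glue_def)
  fix y assume y: "y \<in> Y"
  \<comment> \<open>Disjointness enters here: \<open>y\<close> is not in \<open>X\<close>, so gluing
    reads the updated value.\<close>
  then have "glue X v (w(y := a)) = (glue X v w)(y := a)" for a
    using disjoint by (auto simp: glue_def fun_eq_iff)
  then show "(\<lambda>a. tens K A (X \<union> Y) (glue X v (w(y := a)))) \<in> lin A (T K A (X \<union> Y))"
    using tens_lin[OF glue_carrier[OF v w], of y] y by simp
qed

text \<open>Since \<open>t\<close> is arbitrary, the inner lift cannot be evaluated. Linearity in a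
  slot of \<open>v\<close> comes from \<open>T_param\<close>, and insensitivity to values outside
  \<open>X\<close> from \<open>T_lift_cong\<close>, both of which compare lifts at the same
  class.\<close>

lemma T_mult_aux2:
  assumes t: "t \<in> carrier (T K A Y)"
  shows "multilin X A (T K A (X \<union> Y))
    (\<lambda>v. pres_lift K (T K A (X \<union> Y)) (\<lambda>w. tens K A (X \<union> Y) (glue X v w)) t)"
proof (rule multilinI)
  fix v assume v: "v \<in> X \<rightarrow> carrier A"
  show "pres_lift K (T K A (X \<union> Y)) (\<lambda>w. tens K A (X \<union> Y) (glue X v w)) t \<in> carrier (T K A (X \<union> Y))"
    by (rule lin_closed[OF T_lift(1)[OF A _ T_mult_aux1[OF v]] t]) simp
  show "pres_lift K (T K A (X \<union> Y)) (\<lambda>w. tens K A (X \<union> Y) (glue X (restrict v X) w)) t =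
      pres_lift K (T K A (X \<union> Y)) (\<lambda>w. tens K A (X \<union> Y) (glue X v w)) t"
  proof (rule T_lift_cong[OF A _ t])
    fix w assume "w \<in> Y \<rightarrow>\<^sub>E carrier A"
    then show "tens K A (X \<union> Y) (glue X (restrict v X) w) \<in> carrier (T K A (X \<union> Y))"
      using v by (intro tens_carrier glue_carrier A) auto
    show "tens K A (X \<union> Y) (glue X (restrict v X) w) = tens K A (X \<union> Y) (glue X v w)"
      by (rule tens_cong) (auto simp: glue_def)
  qed simp
  fix x assume x: "x \<in> X"
  then have g: "glue X (v(x := a)) w = (glue X v w)(x := a)" for a w
    by (auto simp: glue_def)
  show "(\<lambda>a. pres_lift K (T K A (X \<union> Y)) (\<lambda>w. tens K A (X \<union> Y) (glue X (v(x := a)) w)) t)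
      \<in> lin A (T K A (X \<union> Y))"
    unfolding g using t x v
    by (intro T_param[OF A] tens_lin glue_carrier) auto
qed

lemma T_mult_aux3:
  "bilin (T K A X) (T K A Y) (T K A (X \<union> Y)) (\<lambda>s t. pres_lift K (T K A (X \<union> Y)) (\<lambda>v.
    pres_lift K (T K A (X \<union> Y)) (\<lambda>w. tens K A (X \<union> Y) (glue X v w)) t) s)"
  by (intro bilinI T_param[OF A] T_lift(1) T_mult_aux1 T_mult_aux2) auto

lemma T_mult_lin: "T_mult K A X Y \<in> lin (T K A X \<boxtimes> T K A Y) (T K A (X \<union> Y))"
  unfolding T_mult_def Let_def by (intro tensor_lift(1) T_mult_aux3) auto

lemma T_mult_tens:
  assumes "v \<in> X \<rightarrow> carrier A" "w \<in> Y \<rightarrow> carrier A"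
  shows "T_mult K A X Y (pure K (T K A X) (T K A Y) (tens K A X v) (tens K A Y w)) =
    tens K A (X \<union> Y) (glue X v w)"
  unfolding T_mult_def Let_def using assms
  by (simp add: tensor_lift(2)[OF _ _ _ T_mult_aux3] T_lift(2)[OF _ _ T_mult_aux2]
    T_lift(2)[OF _ _ T_mult_aux1])

text \<open>Each slot lies in exactly one of \<open>X\<close> and \<open>Y\<close>, so only one
  tensor factor varies with it. A common slot would enter both factors and make the map quadratic
  there.\<close>

lemma T_comult_multilin:
  "multilin (X \<union> Y) A (T K A X \<boxtimes> T K A Y)
    (\<lambda>v. pure K (T K A X) (T K A Y) (tens K A X v) (tens K A Y v))"
proof (rule multilinI)
  fix v assume v: "v \<in> X \<union> Y \<rightarrow> carrier A"
  then have vX: "v \<in> X \<rightarrow> carrier A" and vY: "v \<in> Y \<rightarrow> carrier A" by auto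
  then show "pure K (T K A X) (T K A Y) (tens K A X v) (tens K A Y v) \<in> carrier (T K A X \<boxtimes> T K A Y)"
    by simp
  have "tens K A X (restrict v (X \<union> Y)) = tens K A X v" "tens K A Y (restrict v (X \<union> Y)) = tens K A Y v"
    by (simp_all cong: tens_cong)
  then show "pure K (T K A X) (T K A Y) (tens K A X (restrict v (X \<union> Y))) (tens K A Y (restrict v (X \<union> Y))) =
    pure K (T K A X) (T K A Y) (tens K A X v) (tens K A Y v)" by simp
  fix z assume "z \<in> X \<union> Y"
  then consider "z \<in> X" "z \<notin> Y" | "z \<in> Y" "z \<notin> X" using disjoint by auto
  then show "(\<lambda>a. pure K (T K A X) (T K A Y) (tens K A X (v(z := a))) (tens K A Y (v(z := a))))
    \<in> lin A (T K A X \<boxtimes> T K A Y)"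
  proof cases
    case 1
    then have "tens K A Y (v(z := a)) = tens K A Y v" for a by (intro tens_cong) auto
    then show ?thesis
      using lin_pure(1)[OF T_vs[OF A] T_vs[OF A] tens_lin[OF vX 1(1)] tens_carrier[OF A vY]] by simp
  next
    case 2
    then have "tens K A X (v(z := a)) = tens K A X v" for a by (intro tens_cong) auto
    then show ?thesis
      using lin_pure(2)[OF T_vs[OF A] T_vs[OF A] tens_carrier[OF A vX] tens_lin[OF vY 2(1)]] by simp
  qed
qed

lemma T_comult_lin: "T_comult K A X Y \<in> lin (T K A (X \<union> Y)) (T K A X \<boxtimes> T K A Y)"
  unfolding T_comult_def by (intro T_lift(1) T_comult_multilin) auto

lemma T_comult_tens:
  "v \<in> X \<union> Y \<rightarrow> carrier A \<Longrightarrow> T_comult K A X Y (tens K A (X \<union> Y) v) =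
    pure K (T K A X) (T K A Y) (tens K A X v) (tens K A Y v)"
  unfolding T_comult_def by (subst T_lift(2)[OF _ _ T_comult_multilin]) auto

end

lemma T_counit_multilin: "multilin {} A (self_vs K) (\<lambda>_. \<one>)"
  by (rule multilinI) auto

lemma T_counit_lin: "T_counit K \<in> lin (T K A {}) (self_vs K)"
  unfolding T_counit_def by (intro T_lift(1) T_counit_multilin) auto

lemma T_counit_tens: "T_counit K (tens K A {} v) = \<one>"
  unfolding T_counit_def by (subst T_lift(2)[OF _ _ T_counit_multilin]) auto

end

section \<open>Slotwise maps and the reshuffling of tensor factors\<close>

lemma T_map_lin:
  assumes "vectorspace K A" "vectorspace K B" "f \<in> lin A B"
  shows "T_map K B X f \<in> lin (T K A X) (T K B X)"
  unfolding T_map_def using assms by (intro T_lift(1) multilin_precomp[OF tens_multilin]) auto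

lemma T_map_tens:
  assumes "vectorspace K A" "vectorspace K B" "f \<in> lin A B" "v \<in> X \<rightarrow> carrier A"
  shows "T_map K B X f (tens K A X v) = tens K B X (\<lambda>x. f (v x))"
  unfolding T_map_def using assms
  by (subst T_lift(2)[OF _ _ multilin_precomp[OF tens_multilin]]) auto

context
  fixes A :: "('k, 'a) module" and B :: "('k, 'b) module"
  assumes A [simp]: "vectorspace K A" and B [simp]: "vectorspace K B"
begin

lemma tens_singleton_lin:
  assumes "vectorspace K C"
  shows "(\<lambda>c. tens K C {x} (\<lambda>_. c)) \<in> lin C (T K C {x})"
proof -
  have "tens K C {x} (\<lambda>_. c) = tens K C {x} ((\<lambda>_. \<zero>\<^bsub>C\<^esub>)(x := c))" for c
    by (rule tens_cong) simp
  then show ?thesis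
    using multilinD(3)[OF tens_multilin[OF assms], of "\<lambda>_. \<zero>\<^bsub>C\<^esub>" "{x}" x] assms by simp
qed

text \<open>By induction on \<open>X\<close>, using the product \<open>(m \<otimes> m) \<circ> (Id \<otimes> c \<otimes> Id)\<close> of
  \<open>A\<^sup>\<otimes>\<^sup>X \<otimes> B\<^sup>\<otimes>\<^sup>X\<close> to attach one more slot.\<close>

lemma shuffle_exists:
  fixes X :: "'x set"
  assumes "finite X"
  shows "\<exists>f. f \<in> lin (T K (A \<boxtimes> B) X) (T K A X \<boxtimes> T K B X) \<and>
     (\<forall>a\<in>X \<rightarrow> carrier A. \<forall>b\<in>X \<rightarrow> carrier B.
        f (tens K (A \<boxtimes> B) X (\<lambda>x. pure K A B (a x) (b x))) =
        pure K (T K A X) (T K B X) (tens K A X a) (tens K B X b))"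
  using assms
proof induct
  case empty
  let ?O = "{} :: 'x set"
  let ?W = "T K A ?O \<boxtimes> T K B ?O"
  let ?h = "\<lambda>_. pure K (T K A ?O) (T K B ?O) (tens K A ?O undefined) (tens K B ?O undefined)"
  have h: "multilin ?O (A \<boxtimes> B) ?W ?h"
    by (rule multilinI) auto
  show ?case
  proof (intro exI conjI ballI)
    show "pres_lift K ?W ?h \<in> lin (T K (A \<boxtimes> B) ?O) ?W"
      by (intro T_lift(1) h) auto
    have tA: "tens K A ?O a = tens K A ?O undefined" for a :: "'x \<Rightarrow> 'a"
      by (rule tens_cong) simp
    have tB: "tens K B ?O b = tens K B ?O undefined" for b :: "'x \<Rightarrow> 'b"
      by (rule tens_cong) simp
    show "pres_lift K ?W ?h (tens K (A \<boxtimes> B) ?O (\<lambda>x. pure K A B (a x) (b x))) =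
      pure K (T K A ?O) (T K B ?O) (tens K A ?O a) (tens K B ?O b)" for a :: "'x \<Rightarrow> 'a" and b :: "'x \<Rightarrow> 'b"
      by (subst T_lift(2)[OF _ _ h]) (simp_all add: tA[of a] tB[of b])
  qed
next
  case (insert x X)
  then obtain f where f: "f \<in> lin (T K (A \<boxtimes> B) X) (T K A X \<boxtimes> T K B X)"
    and f_eq: "\<And>a b. \<lbrakk>a \<in> X \<rightarrow> carrier A; b \<in> X \<rightarrow> carrier B\<rbrakk> \<Longrightarrow>
        f (tens K (A \<boxtimes> B) X (\<lambda>x. pure K A B (a x) (b x))) =
        pure K (T K A X) (T K B X) (tens K A X a) (tens K B X b)" by blast
  let ?Z = "insert x X"
  let ?W = "T K A ?Z \<boxtimes> T K B ?Z"
  let ?P = "T K A {x} \<boxtimes> T K B {x}" and ?Q = "T K A X \<boxtimes> T K B X"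
  let ?s = "tmap K (T K A {x}) (T K B {x}) (\<lambda>a. tens K A {x} (\<lambda>_. a)) (\<lambda>b. tens K B {x} (\<lambda>_. b))"
  let ?m = "tmap K (T K A ?Z) (T K B ?Z) (T_mult K A {x} X) (T_mult K B {x} X)"
  let ?c = "mid_flip K (T K A {x}) (T K B {x}) (T K A X) (T K B X)"
  let ?h = "\<lambda>w. ?m (?c (pure K ?P ?Q (?s (w x)) (f (tens K (A \<boxtimes> B) X w))))"
  have d: "{x} \<inter> X = {}" using insert by auto
  have mA: "T_mult K A {x} X \<in> lin (T K A {x} \<boxtimes> T K A X) (T K A ?Z)"
    and mB: "T_mult K B {x} X \<in> lin (T K B {x} \<boxtimes> T K B X) (T K B ?Z)"
    using T_mult_lin[OF A d] T_mult_lin[OF B d] by simp_all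
  have s: "?s \<in> lin (A \<boxtimes> B) ?P"
    by (intro tmap_lin tens_singleton_lin) auto
  have mc: "(\<lambda>t. ?m (?c t)) \<in> lin (?P \<boxtimes> ?Q) ?W"
    by (rule lin_comp[OF mid_flip_lin tmap_lin[OF _ _ _ _ mA mB]]) auto
  have "multilin ?Z (A \<boxtimes> B) (?P \<boxtimes> ?Q) (\<lambda>w. pure K ?P ?Q (?s (w x)) (f (tens K (A \<boxtimes> B) X w)))"
  proof (rule multilinI)
    fix w assume w: "w \<in> ?Z \<rightarrow> carrier (A \<boxtimes> B)"
    then have wx: "w x \<in> carrier (A \<boxtimes> B)" and wX: "w \<in> X \<rightarrow> carrier (A \<boxtimes> B)" by auto
    have fX: "f (tens K (A \<boxtimes> B) X w) \<in> carrier ?Q" using wX by (intro lin_closed[OF f]) simp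
    show "pure K ?P ?Q (?s (w x)) (f (tens K (A \<boxtimes> B) X w)) \<in> carrier (?P \<boxtimes> ?Q)"
      using fX lin_closed[OF s wx] by simp
    have "tens K (A \<boxtimes> B) X (restrict w ?Z) = tens K (A \<boxtimes> B) X w"
      by (rule tens_cong) auto
    then show "pure K ?P ?Q (?s (restrict w ?Z x)) (f (tens K (A \<boxtimes> B) X (restrict w ?Z))) =
        pure K ?P ?Q (?s (w x)) (f (tens K (A \<boxtimes> B) X w))" by simp
    fix y assume "y \<in> ?Z"
    show "(\<lambda>t. pure K ?P ?Q (?s ((w(y := t)) x)) (f (tens K (A \<boxtimes> B) X (w(y := t))))) \<in>
        lin (A \<boxtimes> B) (?P \<boxtimes> ?Q)"
    \<comment> \<open>The new slot \<open>x\<close> enters only the first factor and the old slots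
      only the second, so in either case one factor of the pure tensor stays constant.\<close>
    proof (cases "y = x")
      case True
      then have "tens K (A \<boxtimes> B) X (w(y := t)) = tens K (A \<boxtimes> B) X w" for t
        using insert.hyps by (intro tens_cong) auto
      then show ?thesis using lin_pure(1)[OF _ _ s fX] True by simp
    next
      case False
      then have "y \<in> X" using \<open>y \<in> ?Z\<close> by simp
      then have "(\<lambda>t. f (tens K (A \<boxtimes> B) X (w(y := t)))) \<in> lin (A \<boxtimes> B) ?Q"
        using wX by (intro lin_comp[OF tens_lin f]) auto
      from lin_pure(2)[OF _ _ lin_closed[OF s wx] this] show ?thesis using False by simp
    qed
  qed
  from multilin_comp[OF this mc] have h: "multilin ?Z (A \<boxtimes> B) ?W ?h" .
  show ?case
  proof (intro exI conjI ballI)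
    show "pres_lift K ?W ?h \<in> lin (T K (A \<boxtimes> B) ?Z) ?W"
      by (intro T_lift(1) h) auto
    fix a b assume a: "a \<in> ?Z \<rightarrow> carrier A" and b: "b \<in> ?Z \<rightarrow> carrier B"
    then have [simp]: "a \<in> X \<rightarrow> carrier A" "b \<in> X \<rightarrow> carrier B" "a x \<in> carrier A" "b x \<in> carrier B"
      and [simp]: "\<And>y. y \<in> X \<Longrightarrow> a y \<in> carrier A" "\<And>y. y \<in> X \<Longrightarrow> b y \<in> carrier B"
      by auto
    have "pres_lift K ?W ?h (tens K (A \<boxtimes> B) ?Z (\<lambda>x. pure K A B (a x) (b x))) =
      ?h (\<lambda>x. pure K A B (a x) (b x))"
      using a b by (intro T_lift(2)[OF _ _ h]) auto
    also have "\<dots> = pure K (T K A ?Z) (T K B ?Z) (tens K A ({x} \<union> X) (glue {x} (\<lambda>_. a x) a))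
       (tens K B ({x} \<union> X) (glue {x} (\<lambda>_. b x) b))"
      by (simp add: f_eq tmap_pure tens_singleton_lin mid_flip_pure mA mB T_mult_tens d del: Un_insert_left)
    also have "tens K A ({x} \<union> X) (glue {x} (\<lambda>_. a x) a) = tens K A ?Z a"
      unfolding insert_is_Un[symmetric] by (rule tens_cong) (simp add: glue_def)
    also have "tens K B ({x} \<union> X) (glue {x} (\<lambda>_. b x) b) = tens K B ?Z b"
      unfolding insert_is_Un[symmetric] by (rule tens_cong) (simp add: glue_def)
    finally show "pres_lift K ?W ?h (tens K (A \<boxtimes> B) ?Z (\<lambda>x. pure K A B (a x) (b x))) =
      pure K (T K A ?Z) (T K B ?Z) (tens K A ?Z a) (tens K B ?Z b)" .
  qed
qed

lemma shuffle_lin: "finite X \<Longrightarrow> shuffle K A B X \<in> lin (T K (A \<boxtimes> B) X) (T K A X \<boxtimes> T K B X)"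
  unfolding shuffle_def using someI_ex[OF shuffle_exists] by blast

lemma shuffle_tens:
  "\<lbrakk>finite X; a \<in> X \<rightarrow> carrier A; b \<in> X \<rightarrow> carrier B\<rbrakk> \<Longrightarrow>
    shuffle K A B X (tens K (A \<boxtimes> B) X (\<lambda>x. pure K A B (a x) (b x))) =
    pure K (T K A X) (T K B X) (tens K A X a) (tens K B X b)"
  unfolding shuffle_def using someI_ex[OF shuffle_exists, of X] by blast

end

section \<open>Equality of linear maps tested on pure tensors\<close>

lemma tensor_family:
  assumes "w \<in> X \<rightarrow> {pure K A B a b | a b. a \<in> G \<and> b \<in> H}"
  shows "\<exists>a\<in>X \<rightarrow> G. \<exists>b\<in>X \<rightarrow> H. \<forall>x\<in>X. w x = pure K A B (a x) (b x)"
proof -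
  have "\<forall>x\<in>X. \<exists>p. w x = pure K A B (fst p) (snd p) \<and> fst p \<in> G \<and> snd p \<in> H"
    using assms by fastforce
  then obtain p where "\<forall>x\<in>X. w x = pure K A B (fst (p x)) (snd (p x)) \<and> fst (p x) \<in> G \<and> snd (p x) \<in> H"
    by metis
  then show ?thesis
    by (intro bexI[of _ "\<lambda>x. fst (p x)"] bexI[of _ "\<lambda>x. snd (p x)"]) auto
qed

lemma lin_eq_tensor:
  assumes "vectorspace K A" "vectorspace K B" "vectorspace K W" "f \<in> lin (A \<boxtimes> B) W" "g \<in> lin (A \<boxtimes> B) W"
    and "generates K A G" "generates K B H"
    and "\<And>a b. \<lbrakk>a \<in> G; b \<in> H\<rbrakk> \<Longrightarrow> f (pure K A B a b) = g (pure K A B a b)"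
  shows "\<forall>t\<in>carrier (A \<boxtimes> B). f t = g t"
  by (rule lin_eqI[OF tensor_generates]) (use assms in auto)

lemma lin_eq_T:
  assumes "finite X" "vectorspace K A" "vectorspace K W" "f \<in> lin (T K A X) W" "g \<in> lin (T K A X) W"
    and "\<And>v. v \<in> X \<rightarrow> carrier A \<Longrightarrow> f (tens K A X v) = g (tens K A X v)"
  shows "\<forall>t\<in>carrier (T K A X). f t = g t"
  by (rule lin_eqI[OF T_generates[OF _ generates_carrier]]) (use assms in auto)

text \<open>Pure tensors generate \<open>A \<otimes> B\<close>, so by \<open>T_generates\<close> the
  entries of a family may all be taken pure; choosing the two factors of every entry then splits the
  family as \<open>a\<close> and \<open>b\<close>.\<close>

lemma lin_eq_T_tensor:
  assumes "finite X" "vectorspace K A" "vectorspace K B" "vectorspace K W"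
    and "f \<in> lin (T K (A \<boxtimes> B) X) W" "g \<in> lin (T K (A \<boxtimes> B) X) W"
    and eq: "\<And>a b. \<lbrakk>a \<in> X \<rightarrow> carrier A; b \<in> X \<rightarrow> carrier B\<rbrakk> \<Longrightarrow>
      f (tens K (A \<boxtimes> B) X (\<lambda>x. pure K A B (a x) (b x))) = g (tens K (A \<boxtimes> B) X (\<lambda>x. pure K A B (a x) (b x)))"
  shows "\<forall>t\<in>carrier (T K (A \<boxtimes> B) X). f t = g t"
proof (rule lin_eqI[OF T_generates[OF _ tensor_generates[OF _ _ generates_carrier generates_carrier]]])
  fix t assume "t \<in> {tens K (A \<boxtimes> B) X w | w. w \<in> X \<rightarrow> {pure K A B a b | a b. a \<in> carrier A \<and> b \<in> carrier B}}"
  then obtain w where w: "w \<in> X \<rightarrow> {pure K A B a b | a b. a \<in> carrier A \<and> b \<in> carrier B}"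
    and t: "t = tens K (A \<boxtimes> B) X w" by blast
  from tensor_family[OF w] obtain a b where ab: "a \<in> X \<rightarrow> carrier A" "b \<in> X \<rightarrow> carrier B"
    and "\<forall>x\<in>X. w x = pure K A B (a x) (b x)" by blast
  then have "t = tens K (A \<boxtimes> B) X (\<lambda>x. pure K A B (a x) (b x))"
    unfolding t by (intro tens_cong) simp
  with eq[OF ab] show "f t = g t" by simp
qed (use assms in auto)

lemma lin_eq_T_tensor3:
  assumes "finite X" "vectorspace K A" "vectorspace K B" "vectorspace K C" "vectorspace K W"
    and "f \<in> lin (T K ((A \<boxtimes> B) \<boxtimes> C) X) W" "g \<in> lin (T K ((A \<boxtimes> B) \<boxtimes> C) X) W"
    and eq: "\<And>a b c. \<lbrakk>a \<in> X \<rightarrow> carrier A; b \<in> X \<rightarrow> carrier B; c \<in> X \<rightarrow> carrier C\<rbrakk> \<Longrightarrow>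
      f (tens K ((A \<boxtimes> B) \<boxtimes> C) X (\<lambda>x. pure K (A \<boxtimes> B) C (pure K A B (a x) (b x)) (c x))) =
      g (tens K ((A \<boxtimes> B) \<boxtimes> C) X (\<lambda>x. pure K (A \<boxtimes> B) C (pure K A B (a x) (b x)) (c x)))"
  shows "\<forall>t\<in>carrier (T K ((A \<boxtimes> B) \<boxtimes> C) X). f t = g t"
proof (rule lin_eqI[OF T_generates[OF _ tensor_generates[OF _ _
        tensor_generates[OF _ _ generates_carrier generates_carrier] generates_carrier]]])
  let ?P = "{pure K A B a b | a b. a \<in> carrier A \<and> b \<in> carrier B}"
  fix t assume "t \<in> {tens K ((A \<boxtimes> B) \<boxtimes> C) X w | w.
    w \<in> X \<rightarrow> {pure K (A \<boxtimes> B) C p c | p c. p \<in> ?P \<and> c \<in> carrier C}}"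
  then obtain w where w: "w \<in> X \<rightarrow> {pure K (A \<boxtimes> B) C p c | p c. p \<in> ?P \<and> c \<in> carrier C}"
    and t: "t = tens K ((A \<boxtimes> B) \<boxtimes> C) X w" by blast
  from tensor_family[OF w] obtain p c where p: "p \<in> X \<rightarrow> ?P" and c: "c \<in> X \<rightarrow> carrier C"
    and wpc: "\<forall>x\<in>X. w x = pure K (A \<boxtimes> B) C (p x) (c x)" by (elim bexE)
  from tensor_family[OF p] obtain a b where ab: "a \<in> X \<rightarrow> carrier A" "b \<in> X \<rightarrow> carrier B"
    and "\<forall>x\<in>X. p x = pure K A B (a x) (b x)" by (elim bexE)
  with wpc have "t = tens K ((A \<boxtimes> B) \<boxtimes> C) X (\<lambda>x. pure K (A \<boxtimes> B) C (pure K A B (a x) (b x)) (c x))"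
    unfolding t by (intro tens_cong) simp
  with eq[OF ab c] show "f t = g t" by simp
qed (use assms in auto)

section \<open>The twisted bialgebra of tensors\<close>

lemma lin_eq_T_T:
  assumes "finite X" "finite Y" "vectorspace K A" "vectorspace K B" "vectorspace K W"
    and "f \<in> lin (T K A X \<boxtimes> T K B Y) W" "g \<in> lin (T K A X \<boxtimes> T K B Y) W"
    and "\<And>v w. \<lbrakk>v \<in> X \<rightarrow> carrier A; w \<in> Y \<rightarrow> carrier B\<rbrakk> \<Longrightarrow>
      f (pure K (T K A X) (T K B Y) (tens K A X v) (tens K B Y w)) =
      g (pure K (T K A X) (T K B Y) (tens K A X v) (tens K B Y w))"
  shows "\<forall>t\<in>carrier (T K A X \<boxtimes> T K B Y). f t = g t"
  by (rule lin_eqI[OF tensor_generates[OF _ _ T_generates[OF _ generates_carrier]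
        T_generates[OF _ generates_carrier]]]) (use assms in auto)

lemma lin_eq_T_T_T:
  assumes "finite X" "finite Y" "finite Z" "vectorspace K A" "vectorspace K W"
    and "f \<in> lin ((T K A X \<boxtimes> T K A Y) \<boxtimes> T K A Z) W" "g \<in> lin ((T K A X \<boxtimes> T K A Y) \<boxtimes> T K A Z) W"
    and "\<And>u v w. \<lbrakk>u \<in> X \<rightarrow> carrier A; v \<in> Y \<rightarrow> carrier A; w \<in> Z \<rightarrow> carrier A\<rbrakk> \<Longrightarrow>
      f (pure K (T K A X \<boxtimes> T K A Y) (T K A Z) (pure K (T K A X) (T K A Y) (tens K A X u) (tens K A Y v)) (tens K A Z w)) =
      g (pure K (T K A X \<boxtimes> T K A Y) (T K A Z) (pure K (T K A X) (T K A Y) (tens K A X u) (tens K A Y v)) (tens K A Z w))"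
  shows "\<forall>t\<in>carrier ((T K A X \<boxtimes> T K A Y) \<boxtimes> T K A Z). f t = g t"
  by (rule lin_eqI[OF tensor_generates[OF _ _ tensor_generates[OF _ _ T_generates[OF _ generates_carrier]
        T_generates[OF _ generates_carrier]] T_generates[OF _ generates_carrier]]]) (use assms in auto)

context
  fixes A :: "('k, 'a) module"
  assumes A [simp]: "vectorspace K A"
begin

text \<open>Characterises the transported family by its values at the points
  \<open>\<sigma> x\<close>, which spares computing \<open>inv_into\<close> for composed or glued
  bijections.\<close>

lemma T_act_tens_eq:
  assumes "bij_betw \<sigma> X Y" "v \<in> X \<rightarrow> carrier A" "\<And>x. x \<in> X \<Longrightarrow> w (\<sigma> x) = v x"
  shows "T_act K A X \<sigma> (tens K A X v) = tens K A Y w"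
  unfolding T_act_tens[OF A assms(1,2)]
proof (rule tens_cong)
  fix y assume "y \<in> Y"
  then have "inv_into X \<sigma> y \<in> X" "\<sigma> (inv_into X \<sigma> y) = y"
    using assms(1) by (auto simp: bij_betw_def inv_into_into f_inv_into_f)
  with assms(3) show "v (inv_into X \<sigma> y) = w y" by metis
qed

lemma T_species: "species K (T K A) (T_act K A :: 'x set \<Rightarrow> _)"
proof (rule species.intro)
  show "field K" by (rule field_axioms)
next
  fix X :: "'x set" assume "finite X"
  show "vectorspace K (T K A X)" by simp
next
  fix X Y :: "'x set" and \<sigma> :: "'x \<Rightarrow> 'x" assume "bij_betw \<sigma> X Y"
  then show "T_act K A X \<sigma> \<in> lin (T K A X) (T K A Y)" by (rule T_act_lin[OF A])
next
  fix X Y :: "'x set" and \<sigma> \<tau> :: "'x \<Rightarrow> 'x" and p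
  assume X: "finite X" and \<sigma>: "bij_betw \<sigma> X Y" and eq: "\<And>x. x \<in> X \<Longrightarrow> \<sigma> x = \<tau> x"
    and p: "p \<in> carrier (T K A X)"
  have \<tau>: "bij_betw \<tau> X Y" using \<sigma> eq by (metis bij_betw_cong)
  have "\<forall>p\<in>carrier (T K A X). T_act K A X \<sigma> p = T_act K A X \<tau> p"
  proof (rule lin_eq_T[OF X A _ T_act_lin[OF A \<sigma>] T_act_lin[OF A \<tau>]])
    fix v assume v: "v \<in> X \<rightarrow> carrier A"
    show "T_act K A X \<sigma> (tens K A X v) = T_act K A X \<tau> (tens K A X v)"
      unfolding T_act_tens[OF A \<tau> v]
      by (rule T_act_tens_eq[OF \<sigma> v]) (use \<tau> in \<open>simp add: eq bij_betw_def\<close>)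
  qed simp
  with p show "T_act K A X \<sigma> p = T_act K A X \<tau> p" by blast
next
  fix X :: "'x set" and p assume X: "finite X" and p: "p \<in> carrier (T K A X)"
  have "\<forall>p\<in>carrier (T K A X). T_act K A X id p = p"
    by (rule lin_eq_T[OF X A _ T_act_lin[OF A bij_betw_id] lin_id(1)]) (simp, rule T_act_tens_eq[OF bij_betw_id], simp_all)
  with p show "T_act K A X id p = p" by blast
next
  fix X Y Z :: "'x set" and \<sigma> \<tau> :: "'x \<Rightarrow> 'x" and p
  assume X: "finite X" and \<sigma>: "bij_betw \<sigma> X Y" and \<tau>: "bij_betw \<tau> Y Z" and p: "p \<in> carrier (T K A X)"
  have "\<forall>p\<in>carrier (T K A X). T_act K A X (\<tau> \<circ> \<sigma>) p = T_act K A Y \<tau> (T_act K A X \<sigma> p)"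
  proof (rule lin_eq_T[OF X A _ T_act_lin[OF A bij_betw_trans[OF \<sigma> \<tau>]]
        lin_comp[OF T_act_lin[OF A \<sigma>] T_act_lin[OF A \<tau>]]])
    fix v assume v: "v \<in> X \<rightarrow> carrier A"
    have v': "(\<lambda>y. v (inv_into X \<sigma> y)) \<in> Y \<rightarrow> carrier A"
      using v bij_betw_inv_into[OF \<sigma>] by (auto simp: bij_betw_def)
    show "T_act K A X (\<tau> \<circ> \<sigma>) (tens K A X v) = T_act K A Y \<tau> (T_act K A X \<sigma> (tens K A X v))"
      unfolding T_act_tens[OF A \<sigma> v] T_act_tens[OF A \<tau> v']
      by (rule T_act_tens_eq[OF bij_betw_trans[OF \<sigma> \<tau>] v])
        (use \<sigma> \<tau> in \<open>auto simp: bij_betw_def\<close>)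
  qed simp
  with p show "T_act K A X (\<tau> \<circ> \<sigma>) p = T_act K A Y \<tau> (T_act K A X \<sigma> p)" by blast
qed

lemma bij_betw_glue:
  assumes "bij_betw \<sigma> X X'" "bij_betw \<tau> Y Y'" "X \<inter> Y = {}" "X' \<inter> Y' = {}"
  shows "bij_betw (glue X \<sigma> \<tau>) (X \<union> Y) (X' \<union> Y')"
proof (rule bij_betw_combine[OF _ _ assms(4)])
  show "bij_betw (glue X \<sigma> \<tau>) X X'"
    using assms(1) by (subst bij_betw_cong[of _ _ \<sigma>]) (auto simp: glue_def)
  show "bij_betw (glue X \<sigma> \<tau>) Y Y'"
    using assms(2,3) by (subst bij_betw_cong[of _ _ \<tau>]) (auto simp: glue_def)
qed

section \<open>Algebra axioms for the product of tensors\<close>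

lemma T_mult_natural:
  assumes "finite X" "finite Y" and d: "X \<inter> Y = {}" "X' \<inter> Y' = {}"
    and \<sigma>: "bij_betw \<sigma> X X'" and \<tau>: "bij_betw \<tau> Y Y'"
  shows "\<forall>t\<in>carrier (T K A X \<boxtimes> T K A Y). T_act K A (X \<union> Y) (glue X \<sigma> \<tau>) (T_mult K A X Y t) =
    T_mult K A X' Y' (tmap K (T K A X') (T K A Y') (T_act K A X \<sigma>) (T_act K A Y \<tau>) t)"
proof (rule lin_eq_T_T)
  note g = bij_betw_glue[OF \<sigma> \<tau> d]
  note lins = T_act_lin[OF A \<sigma>] T_act_lin[OF A \<tau>]
  show "(\<lambda>t. T_act K A (X \<union> Y) (glue X \<sigma> \<tau>) (T_mult K A X Y t)) \<in> lin (T K A X \<boxtimes> T K A Y) (T K A (X' \<union> Y'))"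
    by (rule lin_comp[OF T_mult_lin[OF A d(1)] T_act_lin[OF A g]])
  show "(\<lambda>t. T_mult K A X' Y' (tmap K (T K A X') (T K A Y') (T_act K A X \<sigma>) (T_act K A Y \<tau>) t))
      \<in> lin (T K A X \<boxtimes> T K A Y) (T K A (X' \<union> Y'))"
    by (rule lin_comp[OF tmap_lin[OF _ _ _ _ lins] T_mult_lin[OF A d(2)]]) simp_all
  fix v w assume v: "v \<in> X \<rightarrow> carrier A" and w: "w \<in> Y \<rightarrow> carrier A"
  have v': "(\<lambda>y. v (inv_into X \<sigma> y)) \<in> X' \<rightarrow> carrier A"
    using v bij_betw_inv_into[OF \<sigma>] by (auto simp: bij_betw_def)
  have w': "(\<lambda>y. w (inv_into Y \<tau> y)) \<in> Y' \<rightarrow> carrier A"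
    using w bij_betw_inv_into[OF \<tau>] by (auto simp: bij_betw_def)
  have "T_act K A (X \<union> Y) (glue X \<sigma> \<tau>) (tens K A (X \<union> Y) (glue X v w)) =
      tens K A (X' \<union> Y') (glue X' (\<lambda>y. v (inv_into X \<sigma> y)) (\<lambda>y. w (inv_into Y \<tau> y)))"
  proof (rule T_act_tens_eq[OF g glue_carrier[OF v w]])
    fix z assume "z \<in> X \<union> Y"
    then show "glue X' (\<lambda>y. v (inv_into X \<sigma> y)) (\<lambda>y. w (inv_into Y \<tau> y)) (glue X \<sigma> \<tau> z) = glue X v w z"
      using \<sigma> \<tau> d by (auto simp: glue_def bij_betw_def)
  qed
  then show "T_act K A (X \<union> Y) (glue X \<sigma> \<tau>) (T_mult K A X Y (pure K (T K A X) (T K A Y) (tens K A X v) (tens K A Y w))) =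
    T_mult K A X' Y' (tmap K (T K A X') (T K A Y') (T_act K A X \<sigma>) (T_act K A Y \<tau>)
      (pure K (T K A X) (T K A Y) (tens K A X v) (tens K A Y w)))"
    using v w v' w' by (simp add: T_mult_tens d tmap_pure lins T_act_tens[OF A \<sigma>] T_act_tens[OF A \<tau>])
qed (use assms in auto)

lemma T_mult_assoc:
  assumes "finite X" "finite Y" "finite Z" and d: "X \<inter> Y = {}" "X \<inter> Z = {}" "Y \<inter> Z = {}"
  shows "\<forall>u\<in>carrier ((T K A X \<boxtimes> T K A Y) \<boxtimes> T K A Z).
    T_mult K A (X \<union> Y) Z (tmap K (T K A (X \<union> Y)) (T K A Z) (T_mult K A X Y) id u) =
    T_mult K A X (Y \<union> Z) (tmap K (T K A X) (T K A (Y \<union> Z)) id (T_mult K A Y Z)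
      (tassoc K (T K A X) (T K A Y) (T K A Z) u))"
proof (rule lin_eq_T_T_T)
  have d': "(X \<union> Y) \<inter> Z = {}" "X \<inter> (Y \<union> Z) = {}" using d by auto
  note lins = T_mult_lin[OF A d(1)] T_mult_lin[OF A d(3)]
  show "(\<lambda>u. T_mult K A (X \<union> Y) Z (tmap K (T K A (X \<union> Y)) (T K A Z) (T_mult K A X Y) id u))
      \<in> lin ((T K A X \<boxtimes> T K A Y) \<boxtimes> T K A Z) (T K A (X \<union> Y \<union> Z))"
    by (rule lin_comp[OF tmap_lin[OF _ _ _ _ lins(1) lin_id(2)] T_mult_lin[OF A d'(1)]]) simp_all
  show "(\<lambda>u. T_mult K A X (Y \<union> Z) (tmap K (T K A X) (T K A (Y \<union> Z)) id (T_mult K A Y Z)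
      (tassoc K (T K A X) (T K A Y) (T K A Z) u))) \<in> lin ((T K A X \<boxtimes> T K A Y) \<boxtimes> T K A Z) (T K A (X \<union> Y \<union> Z))"
    unfolding Un_assoc
    by (rule lin_comp[OF lin_comp[OF tassoc_lin tmap_lin[OF _ _ _ _ lin_id(2) lins(2)]]
        T_mult_lin[OF A d'(2)]]) simp_all
  fix u v w assume c: "u \<in> X \<rightarrow> carrier A" "v \<in> Y \<rightarrow> carrier A" "w \<in> Z \<rightarrow> carrier A"
  have "glue (X \<union> Y) (glue X u v) w = glue X u (glue Y v w)"
    by (auto simp: glue_def)
  with c show "T_mult K A (X \<union> Y) Z (tmap K (T K A (X \<union> Y)) (T K A Z) (T_mult K A X Y) id
      (pure K (T K A X \<boxtimes> T K A Y) (T K A Z) (pure K (T K A X) (T K A Y) (tens K A X u) (tens K A Y v)) (tens K A Z w))) =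
    T_mult K A X (Y \<union> Z) (tmap K (T K A X) (T K A (Y \<union> Z)) id (T_mult K A Y Z) (tassoc K (T K A X) (T K A Y) (T K A Z)
      (pure K (T K A X \<boxtimes> T K A Y) (T K A Z) (pure K (T K A X) (T K A Y) (tens K A X u) (tens K A Y v)) (tens K A Z w))))"
    using glue_carrier[OF c(1,2)] glue_carrier[OF c(2,3)]
    by (simp add: tmap_pure lins lin_id tassoc_pure T_mult_tens d d' Un_assoc)
qed (use assms in auto)

lemma tens_empty: "tens K A {} v = T_unit K A"
  unfolding T_unit_def by (rule tens_cong) simp

lemma T_unit_carrier: "T_unit K A \<in> carrier (T K A {})"
  unfolding T_unit_def by simp

lemma T_mult_unit_left:
  assumes "finite X"
  shows "\<forall>p\<in>carrier (T K A X). T_mult K A {} X (pure K (T K A {}) (T K A X) (T_unit K A) p) = p"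
proof (rule lin_eq_T[OF assms A])
  show "(\<lambda>p. T_mult K A {} X (pure K (T K A {}) (T K A X) (T_unit K A) p)) \<in> lin (T K A X) (T K A X)"
    using lin_comp[OF pure_lin(1)[OF _ _ T_unit_carrier] T_mult_lin[OF A, of "{}" X]] by simp
  show "T_mult K A {} X (pure K (T K A {}) (T K A X) (T_unit K A) (tens K A X v)) = tens K A X v"
    if "v \<in> X \<rightarrow> carrier A" for v
    using T_mult_tens[OF A, of "{}" X "\<lambda>_. undefined" v] that by (simp add: tens_empty glue_def)
qed (auto intro: lin_id)

lemma T_mult_unit_right:
  assumes "finite X"
  shows "\<forall>p\<in>carrier (T K A X). T_mult K A X {} (pure K (T K A X) (T K A {}) p (T_unit K A)) = p"
proof (rule lin_eq_T[OF assms A])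
  show "(\<lambda>p. T_mult K A X {} (pure K (T K A X) (T K A {}) p (T_unit K A))) \<in> lin (T K A X) (T K A X)"
    using lin_comp[OF pure_lin(2)[OF _ _ T_unit_carrier] T_mult_lin[OF A, of X "{}"]] by simp
  show "T_mult K A X {} (pure K (T K A X) (T K A {}) (tens K A X v) (T_unit K A)) = tens K A X v"
    if "v \<in> X \<rightarrow> carrier A" for v
  proof -
    have "tens K A X (glue X v (\<lambda>_. undefined)) = tens K A X v"
      by (rule tens_cong) (simp add: glue_def)
    then show ?thesis
      using T_mult_tens[OF A, of X "{}" v "\<lambda>_. undefined"] that by (simp add: tens_empty)
  qed
qed (auto intro: lin_id)

lemma T_twisted_algebra:
  "twisted_algebra K (T K A) (T_act K A :: 'x set \<Rightarrow> _) (T_mult K A) (T_unit K A)"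
  by (intro twisted_algebra.intro T_species twisted_algebra_axioms.intro)
    (auto simp: T_mult_lin T_mult_natural T_mult_assoc T_unit_carrier T_mult_unit_left T_mult_unit_right)

section \<open>Coalgebra axioms for the splitting coproduct\<close>

lemma T_comult_natural:
  assumes "finite X" "finite Y" and d: "X \<inter> Y = {}" "X' \<inter> Y' = {}"
    and \<sigma>: "bij_betw \<sigma> X X'" and \<tau>: "bij_betw \<tau> Y Y'"
  shows "\<forall>p\<in>carrier (T K A (X \<union> Y)). T_comult K A X' Y' (T_act K A (X \<union> Y) (glue X \<sigma> \<tau>) p) =
    tmap K (T K A X') (T K A Y') (T_act K A X \<sigma>) (T_act K A Y \<tau>) (T_comult K A X Y p)"
proof (rule lin_eq_T)
  note g = bij_betw_glue[OF \<sigma> \<tau> d]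
  note lins = T_act_lin[OF A \<sigma>] T_act_lin[OF A \<tau>]
  show "(\<lambda>p. T_comult K A X' Y' (T_act K A (X \<union> Y) (glue X \<sigma> \<tau>) p)) \<in> lin (T K A (X \<union> Y)) (T K A X' \<boxtimes> T K A Y')"
    by (rule lin_comp[OF T_act_lin[OF A g] T_comult_lin[OF A d(2)]])
  show "(\<lambda>p. tmap K (T K A X') (T K A Y') (T_act K A X \<sigma>) (T_act K A Y \<tau>) (T_comult K A X Y p))
      \<in> lin (T K A (X \<union> Y)) (T K A X' \<boxtimes> T K A Y')"
    by (rule lin_comp[OF T_comult_lin[OF A d(1)] tmap_lin[OF _ _ _ _ lins]]) simp_all
  fix v assume v: "v \<in> X \<union> Y \<rightarrow> carrier A"
  then have vX: "v \<in> X \<rightarrow> carrier A" and vY: "v \<in> Y \<rightarrow> carrier A" by auto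
  \<comment> \<open>One family on the whole of \<open>X' \<union> Y'\<close> serves both factors: on
    \<open>X'\<close> it is the transport of \<open>v\<close> along \<open>\<sigma>\<close>, on
    \<open>Y'\<close> the transport along \<open>\<tau>\<close>.\<close>
  let ?v = "\<lambda>y. v (inv_into (X \<union> Y) (glue X \<sigma> \<tau>) y)"
  have v': "?v \<in> X' \<union> Y' \<rightarrow> carrier A"
    using v bij_betw_inv_into[OF g] by (auto simp: bij_betw_def)
  have gi: "?v (glue X \<sigma> \<tau> z) = v z" if "z \<in> X \<union> Y" for z
    using g that by (simp add: bij_betw_def)
  have "T_act K A X \<sigma> (tens K A X v) = tens K A X' ?v"
    by (rule T_act_tens_eq[OF \<sigma> vX]) (use gi in \<open>force simp: glue_def\<close>)
  moreover have "T_act K A Y \<tau> (tens K A Y v) = tens K A Y' ?v"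
  proof (rule T_act_tens_eq[OF \<tau> vY])
    fix y assume "y \<in> Y"
    then have "glue X \<sigma> \<tau> y = \<tau> y" using d by (auto simp: glue_def)
    then show "?v (\<tau> y) = v y" using gi[of y] \<open>y \<in> Y\<close> by simp
  qed
  ultimately show "T_comult K A X' Y' (T_act K A (X \<union> Y) (glue X \<sigma> \<tau>) (tens K A (X \<union> Y) v)) =
    tmap K (T K A X') (T K A Y') (T_act K A X \<sigma>) (T_act K A Y \<tau>) (T_comult K A X Y (tens K A (X \<union> Y) v))"
    using vX vY by (simp add: T_act_tens[OF A g v] T_comult_tens[OF A d(2) v'] T_comult_tens[OF A d(1) v]
      tmap_pure lins)
qed (use assms in auto)

lemma T_comult_coassoc:
  assumes "finite X" "finite Y" "finite Z" and d: "X \<inter> Y = {}" "X \<inter> Z = {}" "Y \<inter> Z = {}"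
  shows "\<forall>p\<in>carrier (T K A (X \<union> Y \<union> Z)).
    tassoc K (T K A X) (T K A Y) (T K A Z)
      (tmap K (T K A X \<boxtimes> T K A Y) (T K A Z) (T_comult K A X Y) id (T_comult K A (X \<union> Y) Z p)) =
    tmap K (T K A X) (T K A Y \<boxtimes> T K A Z) id (T_comult K A Y Z) (T_comult K A X (Y \<union> Z) p)"
proof (rule lin_eq_T)
  have d': "(X \<union> Y) \<inter> Z = {}" "X \<inter> (Y \<union> Z) = {}" using d by auto
  note lins = T_comult_lin[OF A d(1)] T_comult_lin[OF A d(3)]
  show "(\<lambda>p. tassoc K (T K A X) (T K A Y) (T K A Z)
      (tmap K (T K A X \<boxtimes> T K A Y) (T K A Z) (T_comult K A X Y) id (T_comult K A (X \<union> Y) Z p)))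
      \<in> lin (T K A (X \<union> Y \<union> Z)) (T K A X \<boxtimes> (T K A Y \<boxtimes> T K A Z))"
    by (rule lin_comp[OF lin_comp[OF T_comult_lin[OF A d'(1)] tmap_lin[OF _ _ _ _ lins(1) lin_id(2)]]
        tassoc_lin]) simp_all
  show "(\<lambda>p. tmap K (T K A X) (T K A Y \<boxtimes> T K A Z) id (T_comult K A Y Z) (T_comult K A X (Y \<union> Z) p))
      \<in> lin (T K A (X \<union> Y \<union> Z)) (T K A X \<boxtimes> (T K A Y \<boxtimes> T K A Z))"
    unfolding Un_assoc
    by (rule lin_comp[OF T_comult_lin[OF A d'(2)] tmap_lin[OF _ _ _ _ lin_id(2) lins(2)]]) simp_all
  fix v assume v: "v \<in> X \<union> Y \<union> Z \<rightarrow> carrier A"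
  then have c: "v \<in> X \<rightarrow> carrier A" "v \<in> Y \<rightarrow> carrier A" "v \<in> Z \<rightarrow> carrier A"
    "v \<in> X \<union> Y \<rightarrow> carrier A" "v \<in> Y \<union> Z \<rightarrow> carrier A" "v \<in> X \<union> (Y \<union> Z) \<rightarrow> carrier A" by auto
  have "T_comult K A X (Y \<union> Z) (tens K A (X \<union> Y \<union> Z) v) =
      pure K (T K A X) (T K A (Y \<union> Z)) (tens K A X v) (tens K A (Y \<union> Z) v)"
    using T_comult_tens[OF A d'(2) c(6)] by (simp add: Un_assoc)
  then show "tassoc K (T K A X) (T K A Y) (T K A Z)
      (tmap K (T K A X \<boxtimes> T K A Y) (T K A Z) (T_comult K A X Y) id (T_comult K A (X \<union> Y) Z (tens K A (X \<union> Y \<union> Z) v))) =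
    tmap K (T K A X) (T K A Y \<boxtimes> T K A Z) id (T_comult K A Y Z) (T_comult K A X (Y \<union> Z) (tens K A (X \<union> Y \<union> Z) v))"
    using c(1-3) tens_carrier[OF A c(4)] tens_carrier[OF A c(5)]
    by (simp add: T_comult_tens[OF A d'(1) v] T_comult_tens[OF A d(1) c(4)] T_comult_tens[OF A d(3) c(5)]
      tmap_pure lins lin_id tassoc_pure)
qed (use assms in auto)

lemma T_counit_left:
  assumes "finite X"
  shows "\<forall>p\<in>carrier (T K A X).
    lunit K (T K A X) (tmap K (self_vs K) (T K A X) (T_counit K) id (T_comult K A {} X p)) = p"
proof (rule lin_eq_T[OF assms A])
  have c: "T_comult K A {} X \<in> lin (T K A X) (T K A {} \<boxtimes> T K A X)"
    using T_comult_lin[OF A, of "{}" X] by simp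
  show "(\<lambda>p. lunit K (T K A X) (tmap K (self_vs K) (T K A X) (T_counit K) id (T_comult K A {} X p)))
      \<in> lin (T K A X) (T K A X)"
    by (rule lin_comp[OF lin_comp[OF c tmap_lin[OF _ _ _ _ T_counit_lin[OF A] lin_id(2)]] lunit_lin]) simp_all
  fix v assume v: "v \<in> X \<rightarrow> carrier A"
  interpret T: module K "T K A X" by (simp add: vs_module)
  show "lunit K (T K A X) (tmap K (self_vs K) (T K A X) (T_counit K) id (T_comult K A {} X (tens K A X v))) = tens K A X v"
    using v T_comult_tens[OF A, of "{}" X v]
    by (simp add: tmap_pure T_counit_lin lin_id T_counit_tens lunit_pure)
qed (auto intro: lin_id)

lemma T_counit_right:
  assumes "finite X"
  shows "\<forall>p\<in>carrier (T K A X).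
    runit K (T K A X) (tmap K (T K A X) (self_vs K) id (T_counit K) (T_comult K A X {} p)) = p"
proof (rule lin_eq_T[OF assms A])
  have c: "T_comult K A X {} \<in> lin (T K A X) (T K A X \<boxtimes> T K A {})"
    using T_comult_lin[OF A, of X "{}"] by simp
  show "(\<lambda>p. runit K (T K A X) (tmap K (T K A X) (self_vs K) id (T_counit K) (T_comult K A X {} p)))
      \<in> lin (T K A X) (T K A X)"
    by (rule lin_comp[OF lin_comp[OF c tmap_lin[OF _ _ _ _ lin_id(2) T_counit_lin[OF A]]] runit_lin]) simp_all
  fix v assume v: "v \<in> X \<rightarrow> carrier A"
  interpret T: module K "T K A X" by (simp add: vs_module)
  show "runit K (T K A X) (tmap K (T K A X) (self_vs K) id (T_counit K) (T_comult K A X {} (tens K A X v))) = tens K A X v"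
    using v T_comult_tens[OF A, of X "{}" v]
    by (simp add: tmap_pure T_counit_lin lin_id T_counit_tens runit_pure)
qed (auto intro: lin_id)

lemma T_twisted_coalgebra:
  "twisted_coalgebra K (T K A) (T_act K A :: 'x set \<Rightarrow> _) (T_comult K A) (T_counit K)"
  by (intro twisted_coalgebra.intro T_species twisted_coalgebra_axioms.intro)
    (auto simp: T_comult_lin T_comult_natural T_comult_coassoc T_counit_lin T_counit_left T_counit_right)

section \<open>Compatibility of product and splitting coproduct\<close>

lemma T_comult_mult:
  assumes fin: "finite I" "finite J" and d: "I \<inter> J = {}" "I' \<inter> J' = {}" and U: "I \<union> J = I' \<union> J'"
  shows "\<forall>t\<in>carrier (T K A I' \<boxtimes> T K A J'). T_comult K A I J (T_mult K A I' J' t) =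
      tmap K (T K A I) (T K A J) (T_mult K A (I' \<inter> I) (J' \<inter> I)) (T_mult K A (I' \<inter> J) (J' \<inter> J))
        (mid_flip K (T K A (I' \<inter> I)) (T K A (I' \<inter> J)) (T K A (J' \<inter> I)) (T K A (J' \<inter> J))
          (tmap K (T K A (I' \<inter> I) \<boxtimes> T K A (I' \<inter> J)) (T K A (J' \<inter> I) \<boxtimes> T K A (J' \<inter> J))
            (T_comult K A (I' \<inter> I) (I' \<inter> J)) (T_comult K A (J' \<inter> I) (J' \<inter> J)) t))"
proof (rule lin_eq_T_T)
  have dd: "(I' \<inter> I) \<inter> (I' \<inter> J) = {}" "(J' \<inter> I) \<inter> (J' \<inter> J) = {}"
    "(I' \<inter> I) \<inter> (J' \<inter> I) = {}" "(I' \<inter> J) \<inter> (J' \<inter> J) = {}" using d by auto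
  have u: "(I' \<inter> I) \<union> (I' \<inter> J) = I'" "(J' \<inter> I) \<union> (J' \<inter> J) = J'"
    "(I' \<inter> I) \<union> (J' \<inter> I) = I" "(I' \<inter> J) \<union> (J' \<inter> J) = J" using U by auto
  note lins = T_comult_lin[OF A dd(1), unfolded u] T_comult_lin[OF A dd(2), unfolded u]
    T_mult_lin[OF A dd(3), unfolded u] T_mult_lin[OF A dd(4), unfolded u]
  show "finite I'" "finite J'" using fin U by (metis finite_Un)+
  show "(\<lambda>t. T_comult K A I J (T_mult K A I' J' t)) \<in> lin (T K A I' \<boxtimes> T K A J') (T K A I \<boxtimes> T K A J)"
    using lin_comp[OF T_mult_lin[OF A d(2), folded U] T_comult_lin[OF A d(1)]] .
  show "(\<lambda>t. tmap K (T K A I) (T K A J) (T_mult K A (I' \<inter> I) (J' \<inter> I)) (T_mult K A (I' \<inter> J) (J' \<inter> J))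
        (mid_flip K (T K A (I' \<inter> I)) (T K A (I' \<inter> J)) (T K A (J' \<inter> I)) (T K A (J' \<inter> J))
          (tmap K (T K A (I' \<inter> I) \<boxtimes> T K A (I' \<inter> J)) (T K A (J' \<inter> I) \<boxtimes> T K A (J' \<inter> J))
            (T_comult K A (I' \<inter> I) (I' \<inter> J)) (T_comult K A (J' \<inter> I) (J' \<inter> J)) t)))
      \<in> lin (T K A I' \<boxtimes> T K A J') (T K A I \<boxtimes> T K A J)"
    by (rule lin_comp[OF lin_comp[OF tmap_lin[OF _ _ _ _ lins(1,2)] mid_flip_lin] tmap_lin[OF _ _ _ _ lins(3,4)]])
      simp_all
  fix v w assume v: "v \<in> I' \<rightarrow> carrier A" and w: "w \<in> J' \<rightarrow> carrier A"
  then have c: "v \<in> I' \<inter> I \<rightarrow> carrier A" "v \<in> I' \<inter> J \<rightarrow> carrier A"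
    "w \<in> J' \<inter> I \<rightarrow> carrier A" "w \<in> J' \<inter> J \<rightarrow> carrier A" by auto
  \<comment> \<open>Inside \<open>I\<close>, membership in \<open>I'\<close> and in
    \<open>I' \<inter> I\<close> coincide, so both gluings take the same values there; likewise
    inside \<open>J\<close>.\<close>
  have "tens K A I (glue I' v w) = tens K A I (glue (I' \<inter> I) v w)"
    "tens K A J (glue I' v w) = tens K A J (glue (I' \<inter> J) v w)"
    by (auto simp: glue_def intro!: tens_cong)
  moreover have "T_mult K A I' J' (pure K (T K A I') (T K A J') (tens K A I' v) (tens K A J' w)) =
      tens K A (I \<union> J) (glue I' v w)"
    unfolding U by (rule T_mult_tens[OF A d(2) v w])
  ultimately show "T_comult K A I J (T_mult K A I' J' (pure K (T K A I') (T K A J') (tens K A I' v) (tens K A J' w))) =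
      tmap K (T K A I) (T K A J) (T_mult K A (I' \<inter> I) (J' \<inter> I)) (T_mult K A (I' \<inter> J) (J' \<inter> J))
        (mid_flip K (T K A (I' \<inter> I)) (T K A (I' \<inter> J)) (T K A (J' \<inter> I)) (T K A (J' \<inter> J))
          (tmap K (T K A (I' \<inter> I) \<boxtimes> T K A (I' \<inter> J)) (T K A (J' \<inter> I) \<boxtimes> T K A (J' \<inter> J))
            (T_comult K A (I' \<inter> I) (I' \<inter> J)) (T_comult K A (J' \<inter> I) (J' \<inter> J))
            (pure K (T K A I') (T K A J') (tens K A I' v) (tens K A J' w))))"
    using v w c T_comult_tens[OF A d(1), of "glue I' v w"] glue_carrier[OF v w]
      T_comult_tens[OF A dd(1), of v] T_comult_tens[OF A dd(2), of w]
      T_mult_tens[OF A dd(3) c(1,3)] T_mult_tens[OF A dd(4) c(2,4)]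
    by (simp add: u U tmap_pure lins mid_flip_pure)
qed auto

lemma T_twisted_bialgebra:
  "twisted_bialgebra K (T K A) (T_act K A :: 'x set \<Rightarrow> _) (T_mult K A) (T_unit K A)
     (T_comult K A) (T_counit K)"
proof (intro twisted_bialgebra.intro T_twisted_algebra T_twisted_coalgebra twisted_bialgebra_axioms.intro)
  let ?O = "{} :: 'x set"
  show "T_comult K A ?O ?O (T_unit K A) = pure K (T K A ?O) (T K A ?O) (T_unit K A) (T_unit K A)"
    using T_comult_tens[OF A, of ?O ?O] by (simp add: tens_empty)
  show "T_counit K (T_unit K A :: (('x \<Rightarrow> 'a) \<Rightarrow> 'k) set) = \<one>"
    unfolding T_unit_def by (rule T_counit_tens[OF A])
  fix p q assume p: "p \<in> carrier (T K A ?O)" and q: "q \<in> carrier (T K A ?O)"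
  have 1: "(\<lambda>t. T_counit K (T_mult K A ?O ?O t)) \<in> lin (T K A ?O \<boxtimes> T K A ?O) (self_vs K)"
    using lin_comp[OF T_mult_lin[OF A, of ?O ?O, simplified] T_counit_lin[OF A]] .
  \<comment> \<open>The product of two counit values, rewritten as a linear functional of
    \<open>t\<close> so that \<open>lin_eq_T_T\<close> applies; \<open>lunit\<close> on
    \<open>self_vs K\<close> multiplies scalars.\<close>
  have 2: "(\<lambda>t. lunit K (self_vs K) (tmap K (self_vs K) (self_vs K) (T_counit K) (T_counit K) t))
      \<in> lin (T K A ?O \<boxtimes> T K A ?O) (self_vs K)"
    by (rule lin_comp[OF tmap_lin[OF _ _ _ _ T_counit_lin[OF A] T_counit_lin[OF A]] lunit_lin]) simp_all
  have "\<forall>t\<in>carrier (T K A ?O \<boxtimes> T K A ?O). T_counit K (T_mult K A ?O ?O t) =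
      lunit K (self_vs K) (tmap K (self_vs K) (self_vs K) (T_counit K) (T_counit K) t)"
    by (rule lin_eq_T_T[OF _ _ A A _ 1 2])
      (simp_all add: T_mult_tens[of A ?O ?O, simplified] tmap_pure T_counit_lin T_counit_tens lunit_pure)
  moreover have "T_counit K p \<in> carrier K" "T_counit K q \<in> carrier K"
    using lin_closed[OF T_counit_lin[OF A]] p q by auto
  ultimately show "T_counit K (T_mult K A ?O ?O (pure K (T K A ?O) (T K A ?O) p q)) = T_counit K p \<otimes> T_counit K q"
    using p q by (simp add: tmap_pure T_counit_lin lunit_pure)
qed (rule bspec[OF T_comult_mult]; assumption)

end

section \<open>Expansion of multilinear maps\<close>

lemma tmap_comp:
  assumes "vectorspace K A" "vectorspace K B" "vectorspace K C" "vectorspace K D"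
    "vectorspace K E" "vectorspace K F"
    and f: "f \<in> lin A C" "f' \<in> lin C E" and g: "g \<in> lin B D" "g' \<in> lin D F"
  shows "\<forall>t\<in>carrier (A \<boxtimes> B). tmap K E F (\<lambda>x. f' (f x)) (\<lambda>x. g' (g x)) t =
    tmap K E F f' g' (tmap K C D f g t)"
proof (rule lin_eq_tensor[OF _ _ _ _ _ generates_carrier generates_carrier])
  note lins = lin_comp[OF f] lin_comp[OF g]
  show "tmap K E F (\<lambda>x. f' (f x)) (\<lambda>x. g' (g x)) \<in> lin (A \<boxtimes> B) (E \<boxtimes> F)"
    by (rule tmap_lin[OF _ _ _ _ lins]) (use assms in auto)
  show "(\<lambda>t. tmap K E F f' g' (tmap K C D f g t)) \<in> lin (A \<boxtimes> B) (E \<boxtimes> F)"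
    by (rule lin_comp[OF tmap_lin[OF _ _ _ _ f(1) g(1)] tmap_lin[OF _ _ _ _ f(2) g(2)]])
      (use assms in auto)
  show "tmap K E F (\<lambda>x. f' (f x)) (\<lambda>x. g' (g x)) (pure K A B a b) =
    tmap K E F f' g' (tmap K C D f g (pure K A B a b))" if "a \<in> carrier A" "b \<in> carrier B" for a b
    using that assms lin_closed[OF f(1)] lin_closed[OF g(1)] by (simp add: tmap_pure lins)
qed (use assms in auto)

text \<open>Each slot releases its own scalar by linearity there; \<open>Y\<close> is the set of
  slots treated so far. The counit axioms use this to turn a family of scalars in the slots into
  their product.\<close>

lemma multilin_scale:
  assumes h: "multilin X A W h" and A: "vectorspace K A" and W: "vectorspace K W"
    and "finite Y" "Y \<subseteq> X" and v: "v \<in> X \<rightarrow> carrier A" and r: "r \<in> X \<rightarrow> carrier K"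
  shows "h (\<lambda>x. if x \<in> Y then r x \<odot>\<^bsub>A\<^esub> v x else v x) = (\<Otimes>x\<in>Y. r x) \<odot>\<^bsub>W\<^esub> h v"
  using assms(4,5)
proof (induct Y)
  case empty
  interpret W: module K W using W by (rule vs_module)
  show ?case using multilinD(1)[OF h v] by simp
next
  case (insert y Y)
  interpret W: module K W using W by (rule vs_module)
  let ?v = "\<lambda>x. if x \<in> Y then r x \<odot>\<^bsub>A\<^esub> v x else v x"
  have c: "v x \<in> carrier A" "r x \<in> carrier K" if "x \<in> X" for x using v r that by auto
  have v': "?v \<in> X \<rightarrow> carrier A" using c A by auto
  have y: "y \<in> X" "y \<notin> Y" "Y \<subseteq> X" using insert by auto
  have "(\<lambda>x. if x \<in> insert y Y then r x \<odot>\<^bsub>A\<^esub> v x else v x) = ?v(y := r y \<odot>\<^bsub>A\<^esub> v y)"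
    using y by auto
  moreover have "h (?v(y := r y \<odot>\<^bsub>A\<^esub> v y)) = r y \<odot>\<^bsub>W\<^esub> h (?v(y := v y))"
    using module_hom_smult[OF multilinD(3)[OF h v' y(1)]] c y by simp
  moreover have "?v(y := v y) = ?v" using y by auto
  moreover have "h ?v = (\<Otimes>x\<in>Y. r x) \<odot>\<^bsub>W\<^esub> h v" using insert by simp
  moreover have rY: "r \<in> Y \<rightarrow> carrier K" using c y by auto
  ultimately show ?case
    using insert.hyps c y multilinD(1)[OF h v] by (simp add: finprod_insert W.smult_assoc1)
qed

lemma tens_scale:
  assumes A: "vectorspace K A" and X: "finite X" and v: "v \<in> X \<rightarrow> carrier A" and r: "r \<in> X \<rightarrow> carrier K"
  shows "tens K A X (\<lambda>x. r x \<odot>\<^bsub>A\<^esub> v x) = (\<Otimes>x\<in>X. r x) \<odot>\<^bsub>T K A X\<^esub> tens K A X v"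
proof -
  have "tens K A X (\<lambda>x. r x \<odot>\<^bsub>A\<^esub> v x) = tens K A X (\<lambda>x. if x \<in> X then r x \<odot>\<^bsub>A\<^esub> v x else v x)"
    by (rule tens_cong) simp
  then show ?thesis
    using multilin_scale[OF tens_multilin[OF A] A _ X subset_refl v r] A by simp
qed

lemma finsum_Times:
  assumes W: "vectorspace K W" and fin: "finite I" "finite F"
    and g: "\<And>i f. \<lbrakk>i \<in> I; f \<in> F\<rbrakk> \<Longrightarrow> g i f \<in> carrier W"
  shows "(\<Oplus>\<^bsub>W\<^esub>i\<in>I. \<Oplus>\<^bsub>W\<^esub>f\<in>F. g i f) = (\<Oplus>\<^bsub>W\<^esub>p\<in>I \<times> F. g (fst p) (snd p))"
  using fin(1) g
proof (induct I)
  case empty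
  interpret W: abelian_group W using W by (rule vs_group)
  show ?case by simp
next
  case (insert i I)
  interpret W: abelian_group W using W by (rule vs_group)
  have c: "g j f \<in> carrier W" if "j \<in> insert i I" "f \<in> F" for j f using insert.prems that by blast
  have "(\<Oplus>\<^bsub>W\<^esub>p\<in>insert i I \<times> F. g (fst p) (snd p)) = (\<Oplus>\<^bsub>W\<^esub>p\<in>(\<lambda>f. (i, f)) ` F \<union> I \<times> F. g (fst p) (snd p))"
    by (rule arg_cong[where f = "\<lambda>S. \<Oplus>\<^bsub>W\<^esub>p\<in>S. g (fst p) (snd p)"]) auto
  also have "\<dots> = (\<Oplus>\<^bsub>W\<^esub>p\<in>(\<lambda>f. (i, f)) ` F. g (fst p) (snd p)) \<oplus>\<^bsub>W\<^esub> (\<Oplus>\<^bsub>W\<^esub>p\<in>I \<times> F. g (fst p) (snd p))"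
    using insert.hyps fin c by (intro W.finsum_Un_disjoint) auto
  also have "(\<Oplus>\<^bsub>W\<^esub>p\<in>(\<lambda>f. (i, f)) ` F. g (fst p) (snd p)) = (\<Oplus>\<^bsub>W\<^esub>f\<in>F. g i f)"
    using c by (subst W.finsum_reindex) (auto simp: inj_on_def)
  also have "(\<Oplus>\<^bsub>W\<^esub>p\<in>I \<times> F. g (fst p) (snd p)) = (\<Oplus>\<^bsub>W\<^esub>j\<in>I. \<Oplus>\<^bsub>W\<^esub>f\<in>F. g j f)"
    using insert.hyps c by simp
  finally show ?case
    using insert.hyps c W by (subst W.finsum_insert) (auto intro!: W.finsum_closed)
qed

text \<open>The slots in \<open>Y\<close> carry sums and are distributed one after the other;
  \<open>v\<close> fills the remaining slots. It stays arbitrary in the induction because the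
  induction hypothesis is applied to a family that already holds the full sum in slot
  \<open>y\<close>.\<close>

lemma multilin_expand:
  assumes h: "multilin X A W h" and A: "vectorspace K A" and W: "vectorspace K W"
    and "finite Y" "Y \<subseteq> X" and I: "\<And>x. finite (I x)" and v: "v \<in> X \<rightarrow> carrier A"
    and u: "\<And>x i. \<lbrakk>x \<in> X; i \<in> I x\<rbrakk> \<Longrightarrow> u x i \<in> carrier A"
  shows "h (\<lambda>x. if x \<in> Y then \<Oplus>\<^bsub>A\<^esub>i\<in>I x. u x i else v x) =
    (\<Oplus>\<^bsub>W\<^esub>f\<in>Pi\<^sub>E Y I. h (\<lambda>x. if x \<in> Y then u x (f x) else v x))"
  using assms(4,5) v
proof (induct Y arbitrary: v)
  case empty
  interpret W: abelian_group W using W by (rule vs_group)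
  show ?case using multilinD(1)[OF h empty(2)] by simp
next
  case (insert y Y)
  interpret W: abelian_group W using W by (rule vs_group)
  have y: "y \<in> X" "y \<notin> Y" "Y \<subseteq> X" "finite Y" using insert by auto
  let ?s = "\<Oplus>\<^bsub>A\<^esub>i\<in>I y. u y i"
  let ?g = "\<lambda>f i x. if x \<in> Y then u x (f x) else (v(y := u y i)) x"
  have s: "?s \<in> carrier A" using u y A by simp
  have fin: "finite (Pi\<^sub>E Y I)" using y I by (intro finite_PiE) auto
  have vX: "v x \<in> carrier A" if "x \<in> X" for x using insert.prems that by auto
  have fv: "(\<lambda>x. if x \<in> Y then u x (f x) else (v(y := a)) x) \<in> X \<rightarrow> carrier A"
    if "f \<in> Pi\<^sub>E Y I" "a \<in> carrier A" for f a
    using vX u y that by (auto simp: PiE_mem)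
  have cg: "h (?g f i) \<in> carrier W" if "i \<in> I y" "f \<in> Pi\<^sub>E Y I" for i f
    by (rule multilinD(1)[OF h fv]) (use that u y in auto)
  have eq: "?g f i = (\<lambda>x. if x \<in> insert y Y then u x ((f(y := i)) x) else v x)" for f i
    using y by (auto simp: fun_eq_iff)
  \<comment> \<open>The new slot \<open>y\<close> is moved into the background family, so that the
    induction hypothesis expands \<open>Y\<close> first and slot \<open>y\<close> is expanded
    afterwards.\<close>
  have "(\<lambda>x. if x \<in> insert y Y then \<Oplus>\<^bsub>A\<^esub>i\<in>I x. u x i else v x) =
      (\<lambda>x. if x \<in> Y then \<Oplus>\<^bsub>A\<^esub>i\<in>I x. u x i else (v(y := ?s)) x)"
    by auto
  then have "h (\<lambda>x. if x \<in> insert y Y then \<Oplus>\<^bsub>A\<^esub>i\<in>I x. u x i else v x) =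
      (\<Oplus>\<^bsub>W\<^esub>f\<in>Pi\<^sub>E Y I. h (\<lambda>x. if x \<in> Y then u x (f x) else (v(y := ?s)) x))"
    using insert.hyps(3)[of "v(y := ?s)"] y s vX by simp
  also have "\<dots> = (\<Oplus>\<^bsub>W\<^esub>f\<in>Pi\<^sub>E Y I. \<Oplus>\<^bsub>W\<^esub>i\<in>I y. h (?g f i))"
  proof (rule W.finsum_cong'[OF refl])
    fix f assume f: "f \<in> Pi\<^sub>E Y I"
    let ?w = "\<lambda>x. if x \<in> Y then u x (f x) else v x"
    have w: "(\<lambda>x. if x \<in> Y then u x (f x) else (v(y := a)) x) = ?w(y := a)" for a
      using y by auto
    have "?w \<in> X \<rightarrow> carrier A" using vX u y f by (auto simp: PiE_mem)
    from lin_finsum[OF multilinD(3)[OF h this y(1)] A W, of "I y" "u y"] u y(1)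
    show "h (\<lambda>x. if x \<in> Y then u x (f x) else (v(y := ?s)) x) = (\<Oplus>\<^bsub>W\<^esub>i\<in>I y. h (?g f i))"
      unfolding w by simp
  qed (use cg W in \<open>auto intro!: W.finsum_closed\<close>)
  also have "\<dots> = (\<Oplus>\<^bsub>W\<^esub>p\<in>Pi\<^sub>E Y I \<times> I y. h (?g (fst p) (snd p)))"
    using cg by (intro finsum_Times W fin I) auto
  also have "\<dots> = (\<Oplus>\<^bsub>W\<^esub>p\<in>Pi\<^sub>E Y I \<times> I y. h (\<lambda>x. if x \<in> insert y Y then u x (((fst p)(y := snd p)) x) else v x))"
  proof (rule W.finsum_cong'[OF refl])
    fix p
    show "h (?g (fst p) (snd p)) = h (\<lambda>x. if x \<in> insert y Y then u x (((fst p)(y := snd p)) x) else v x)"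
      by (simp only: eq)
  next
    show "(\<lambda>p. h (\<lambda>x. if x \<in> insert y Y then u x (((fst p)(y := snd p)) x) else v x))
      \<in> Pi\<^sub>E Y I \<times> I y \<rightarrow> carrier W"
      using cg[unfolded eq] by auto
  qed
  \<comment> \<open>A choice on \<open>insert y Y\<close> is the same as a choice on
    \<open>Y\<close> together with a summand for \<open>y\<close>.\<close>
  also have "\<dots> = (\<Oplus>\<^bsub>W\<^esub>f\<in>(\<lambda>p. (fst p)(y := snd p)) ` (Pi\<^sub>E Y I \<times> I y).
      h (\<lambda>x. if x \<in> insert y Y then u x (f x) else v x))"
  proof (rule W.finsum_reindex[symmetric])
    show "inj_on (\<lambda>p. (fst p)(y := snd p)) (Pi\<^sub>E Y I \<times> I y)"
    proof (rule inj_onI, clarsimp)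
      fix f i g j assume f: "f \<in> Pi\<^sub>E Y I" and g: "g \<in> Pi\<^sub>E Y I" and eq: "f(y := i) = g(y := j)"
      \<comment> \<open>Extensionality makes both functions \<open>undefined\<close> at
        \<open>y\<close>, so each is recovered from its update.\<close>
      have "f = (f(y := i))(y := undefined)" "g = (g(y := j))(y := undefined)"
        using PiE_arb[OF f y(2)] PiE_arb[OF g y(2)] by auto
      with eq show "f = g \<and> i = j" by (metis fun_upd_same)
    qed
    show "(\<lambda>f. h (\<lambda>x. if x \<in> insert y Y then u x (f x) else v x))
      \<in> (\<lambda>p. (fst p)(y := snd p)) ` (Pi\<^sub>E Y I \<times> I y) \<rightarrow> carrier W"
      using cg[unfolded eq] by auto
  qed
  also have "(\<lambda>p. (fst p)(y := snd p)) ` (Pi\<^sub>E Y I \<times> I y) = Pi\<^sub>E (insert y Y) I"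
    unfolding PiE_insert_eq by force
  finally show ?case .
qed

lemma tens_expand:
  assumes A: "vectorspace K A" and X: "finite X" and I: "\<And>x. finite (I x)"
    and u: "\<And>x i. \<lbrakk>x \<in> X; i \<in> I x\<rbrakk> \<Longrightarrow> u x i \<in> carrier A"
  shows "tens K A X (\<lambda>x. \<Oplus>\<^bsub>A\<^esub>i\<in>I x. u x i) = (\<Oplus>\<^bsub>T K A X\<^esub>f\<in>Pi\<^sub>E X I. tens K A X (\<lambda>x. u x (f x)))"
proof -
  have "tens K A X (\<lambda>x. if x \<in> X then w x else z x) = tens K A X w" for w z
    by (rule tens_cong) simp
  then show ?thesis
    \<comment> \<open>All slots of \<open>X\<close> carry sums; the zero family only supplies a
      background with values in the carrier.\<close>
    using multilin_expand[OF tens_multilin[OF A] A _ X subset_refl I, where v = "\<lambda>_. \<zero>\<^bsub>A\<^esub>" and u = u] A u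
    by simp
qed

text \<open>Scalars are absorbed into the left factors, so sums without coefficients suffice. It
  provides the Sweedler expressions on which \<open>is_tensor_coproduct_unique\<close> evaluates
  both candidates.\<close>

lemma tensor_sum_of_pure:
  assumes A: "vectorspace K A" and B: "vectorspace K B" and t: "t \<in> carrier (A \<boxtimes> B)"
  shows "\<exists>(n :: nat) a b. (\<forall>i<n. a i \<in> carrier A \<and> b i \<in> carrier B) \<and>
    t = (\<Oplus>\<^bsub>A \<boxtimes> B\<^esub>i\<in>{..<n}. pure K A B (a i) (b i))"
proof -
  let ?Q = "\<lambda>t. \<exists>(n :: nat) a b. (\<forall>i<n. a i \<in> carrier A \<and> b i \<in> carrier B) \<and>
    t = (\<Oplus>\<^bsub>A \<boxtimes> B\<^esub>i\<in>{..<n}. pure K A B (a i) (b i))"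
  have AB: "vectorspace K (A \<boxtimes> B)" using A B by simp
  interpret W: module K "A \<boxtimes> B" using AB by (rule vs_module)
  from generates_lspan[OF tensor_generates[OF A B generates_carrier generates_carrier] t]
  show "?Q t"
  proof induct
    case lspan_zero
    show ?case by (intro exI[of _ "0::nat"]) simp
  next
    case (lspan_base g)
    then obtain a b where "a \<in> carrier A" "b \<in> carrier B" "g = pure K A B a b" by blast
    then show ?case
      using A B by (intro exI[of _ "1::nat"] exI[of _ "\<lambda>_. a"] exI[of _ "\<lambda>_. b"]) (simp add: lessThan_Suc)
  next
    case (lspan_add x y)
    then obtain n a b m c d
      where 1: "\<forall>i<n. a i \<in> carrier A \<and> b i \<in> carrier B" "x = (\<Oplus>\<^bsub>A \<boxtimes> B\<^esub>i\<in>{..<n::nat}. pure K A B (a i) (b i))"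
        and 2: "\<forall>i<m. c i \<in> carrier A \<and> d i \<in> carrier B" "y = (\<Oplus>\<^bsub>A \<boxtimes> B\<^esub>i\<in>{..<m::nat}. pure K A B (c i) (d i))"
      by blast
    \<comment> \<open>The two sums are concatenated: the indices from \<open>n\<close> up to
      \<open>n + m\<close> run through the second sum, shifted by \<open>n\<close>.\<close>
    let ?a = "\<lambda>i. if i < n then a i else c (i - n)" and ?b = "\<lambda>i. if i < n then b i else d (i - n)"
    let ?p = "\<lambda>i. pure K A B (?a i) (?b i)"
    have car: "?a i \<in> carrier A" "?b i \<in> carrier B" if "i < n + m" for i using that 1(1) 2(1) by auto
    have un: "{..<n + m} = {..<n} \<union> (\<lambda>i. i + n) ` {..<m}"
    proof -
      have "i \<in> (\<lambda>i. i + n) ` {..<m}" if "i < n + m" "\<not> i < n" for i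
        using that by (intro image_eqI[of _ _ "i - n"]) auto
      then show ?thesis by auto
    qed
    have "(\<Oplus>\<^bsub>A \<boxtimes> B\<^esub>i\<in>{..<n + m}. ?p i) = (\<Oplus>\<^bsub>A \<boxtimes> B\<^esub>i\<in>{..<n}. ?p i) \<oplus>\<^bsub>A \<boxtimes> B\<^esub> (\<Oplus>\<^bsub>A \<boxtimes> B\<^esub>i\<in>(\<lambda>i. i + n) ` {..<m}. ?p i)"
      unfolding un using 1(1) 2(1) A B by (intro W.M.finsum_Un_disjoint) auto
    also have "(\<Oplus>\<^bsub>A \<boxtimes> B\<^esub>i\<in>{..<n}. ?p i) = x"
      unfolding 1(2) using 1(1) A B by (intro W.M.finsum_cong') auto
    also have "(\<Oplus>\<^bsub>A \<boxtimes> B\<^esub>i\<in>(\<lambda>i. i + n) ` {..<m}. ?p i) = (\<Oplus>\<^bsub>A \<boxtimes> B\<^esub>i\<in>{..<m}. ?p (i + n))"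
      using 1(1) 2(1) A B by (intro W.M.finsum_reindex) (auto simp: inj_on_def)
    also have "\<dots> = y"
      unfolding 2(2) using 2(1) A B by (intro W.M.finsum_cong') auto
    finally show ?case using car by (intro exI[of _ "n + m"] exI[of _ ?a] exI[of _ ?b]) auto
  next
    case (lspan_smult r x)
    then obtain n a b where 1: "\<forall>i<n. a i \<in> carrier A \<and> b i \<in> carrier B"
        "x = (\<Oplus>\<^bsub>A \<boxtimes> B\<^esub>i\<in>{..<n::nat}. pure K A B (a i) (b i))" by blast
    have "r \<odot>\<^bsub>A \<boxtimes> B\<^esub> x = (\<Oplus>\<^bsub>A \<boxtimes> B\<^esub>i\<in>{..<n}. r \<odot>\<^bsub>A \<boxtimes> B\<^esub> pure K A B (a i) (b i))"
      unfolding 1(2) using 1(1) A B lspan_smult(1)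
      by (intro lin_finsum[OF lin_scale[OF lin_id(1) AB] AB AB]) auto
    also have "\<dots> = (\<Oplus>\<^bsub>A \<boxtimes> B\<^esub>i\<in>{..<n}. pure K A B (r \<odot>\<^bsub>A\<^esub> a i) (b i))"
      using 1(1) A B lspan_smult(1)
      by (intro W.M.finsum_cong') (auto simp: module_hom_smult[OF pure_lin(2)])
    finally show ?case
      using 1(1) A lspan_smult(1)
      by (intro exI[of _ n] exI[of _ "\<lambda>i. r \<odot>\<^bsub>A\<^esub> a i"] exI[of _ b]) auto
  qed
qed

end

section \<open>The coproduct induced by a coalgebra\<close>

definition T_coproduct :: "'k ring \<Rightarrow> ('k, 'v) module \<Rightarrow> ('v \<Rightarrow> ('v \<times> 'v \<Rightarrow> 'k) set) \<Rightarrow> 'x set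
    \<Rightarrow> (('x \<Rightarrow> 'v) \<Rightarrow> 'k) set \<Rightarrow> ((('x \<Rightarrow> 'v) \<Rightarrow> 'k) set \<times> (('x \<Rightarrow> 'v) \<Rightarrow> 'k) set \<Rightarrow> 'k) set" where
  "T_coproduct K V \<delta>V X t = shuffle K V V X (T_map K (V \<boxtimes>\<^bsub>K\<^esub> V) X \<delta>V t)"

definition T_eps :: "'k ring \<Rightarrow> ('v \<Rightarrow> 'k) \<Rightarrow> 'x set \<Rightarrow> (('x \<Rightarrow> 'v) \<Rightarrow> 'k) set \<Rightarrow> 'k" where
  "T_eps K \<epsilon>V X = pres_lift K (self_vs K) (\<lambda>v. \<Otimes>\<^bsub>K\<^esub>x\<in>X. \<epsilon>V (v x))"

context ground_field
begin

lemma pure_family: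
  assumes "vectorspace K A" "vectorspace K B" "a \<in> X \<rightarrow> carrier A" "b \<in> X \<rightarrow> carrier B"
  shows "(\<lambda>x. pure K A B (a x) (b x)) \<in> X \<rightarrow> carrier (A \<boxtimes> B)"
  using assms by (auto simp: Pi_iff)

section \<open>Compatibility of the reshuffling with the species structure\<close>

lemma shuffle_act:
  assumes A: "vectorspace K A" and X: "finite X" and \<sigma>: "bij_betw \<sigma> X Y"
  shows "\<forall>t\<in>carrier (T K (A \<boxtimes> A) X). shuffle K A A Y (T_act K (A \<boxtimes> A) X \<sigma> t) =
    tmap K (T K A Y) (T K A Y) (T_act K A X \<sigma>) (T_act K A X \<sigma>) (shuffle K A A X t)"
proof (rule lin_eq_T_tensor[OF X A A])
  have AA: "vectorspace K (A \<boxtimes> A)" using A by simp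
  have Y: "finite Y" using X \<sigma> by (simp add: bij_betw_finite)
  note lins = T_act_lin[OF A \<sigma>] T_act_lin[OF AA \<sigma>] shuffle_lin[OF A A X] shuffle_lin[OF A A Y]
  show "(\<lambda>t. shuffle K A A Y (T_act K (A \<boxtimes> A) X \<sigma> t)) \<in> lin (T K (A \<boxtimes> A) X) (T K A Y \<boxtimes> T K A Y)"
    by (rule lin_comp[OF lins(2,4)])
  show "(\<lambda>t. tmap K (T K A Y) (T K A Y) (T_act K A X \<sigma>) (T_act K A X \<sigma>) (shuffle K A A X t))
      \<in> lin (T K (A \<boxtimes> A) X) (T K A Y \<boxtimes> T K A Y)"
    by (rule lin_comp[OF lins(3) tmap_lin[OF _ _ _ _ lins(1) lins(1)]]) (simp_all add: A)
  fix a b assume a: "a \<in> X \<rightarrow> carrier A" and b: "b \<in> X \<rightarrow> carrier A"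
  have inv: "inv_into X \<sigma> y \<in> X" if "y \<in> Y" for y
    using bij_betw_inv_into[OF \<sigma>] that by (auto simp: bij_betw_def)
  have c: "(\<lambda>x. pure K A A (a x) (b x)) \<in> X \<rightarrow> carrier (A \<boxtimes> A)" by (rule pure_family[OF A A a b])
  have a': "(\<lambda>y. a (inv_into X \<sigma> y)) \<in> Y \<rightarrow> carrier A" and b': "(\<lambda>y. b (inv_into X \<sigma> y)) \<in> Y \<rightarrow> carrier A"
    using a b inv by auto
  show "shuffle K A A Y (T_act K (A \<boxtimes> A) X \<sigma> (tens K (A \<boxtimes> A) X (\<lambda>x. pure K A A (a x) (b x)))) =
    tmap K (T K A Y) (T K A Y) (T_act K A X \<sigma>) (T_act K A X \<sigma>)
      (shuffle K A A X (tens K (A \<boxtimes> A) X (\<lambda>x. pure K A A (a x) (b x))))"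
    using a b c a' b' by (simp add: A X Y T_act_tens[OF AA \<sigma> c] T_act_tens[OF A \<sigma>] shuffle_tens tmap_pure lins)
qed (simp add: A)

lemma shuffle_mult:
  assumes A: "vectorspace K A" and X: "finite X" and Y: "finite Y" and d: "X \<inter> Y = {}"
  shows "\<forall>t\<in>carrier (T K (A \<boxtimes> A) X \<boxtimes> T K (A \<boxtimes> A) Y).
    shuffle K A A (X \<union> Y) (T_mult K (A \<boxtimes> A) X Y t) =
    tmap K (T K A (X \<union> Y)) (T K A (X \<union> Y)) (T_mult K A X Y) (T_mult K A X Y)
      (mid_flip K (T K A X) (T K A X) (T K A Y) (T K A Y)
        (tmap K (T K A X \<boxtimes> T K A X) (T K A Y \<boxtimes> T K A Y) (shuffle K A A X) (shuffle K A A Y) t))"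
proof -
  have AA: "vectorspace K (A \<boxtimes> A)" using A by simp
  have XY: "finite (X \<union> Y)" using X Y by simp
  let ?P = "{pure K A A a b | a b. a \<in> carrier A \<and> b \<in> carrier A}"
  have gen: "generates K (T K (A \<boxtimes> A) Z) {tens K (A \<boxtimes> A) Z v | v. v \<in> Z \<rightarrow> ?P}" if "finite Z" for Z :: "'x set"
    by (rule T_generates[OF AA tensor_generates[OF A A generates_carrier generates_carrier] that])
  note lins = T_mult_lin[OF A d] T_mult_lin[OF AA d] shuffle_lin[OF A A X] shuffle_lin[OF A A Y]
    shuffle_lin[OF A A XY]
  have tens: "\<exists>a\<in>Z \<rightarrow> carrier A. \<exists>b\<in>Z \<rightarrow> carrier A. t = tens K (A \<boxtimes> A) Z (\<lambda>z. pure K A A (a z) (b z))"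
    if t: "t \<in> {tens K (A \<boxtimes> A) Z v | v. v \<in> Z \<rightarrow> ?P}" for Z :: "'x set" and t
  proof -
    from t obtain w where w: "w \<in> Z \<rightarrow> ?P" and t: "t = tens K (A \<boxtimes> A) Z w" by blast
    from tensor_family[OF w] obtain a b where ab: "a \<in> Z \<rightarrow> carrier A" "b \<in> Z \<rightarrow> carrier A"
      and "\<forall>z\<in>Z. w z = pure K A A (a z) (b z)" by blast
    then have "t = tens K (A \<boxtimes> A) Z (\<lambda>z. pure K A A (a z) (b z))"
      unfolding t by (intro tens_cong) simp
    with ab show ?thesis by blast
  qed
  show ?thesis
  proof (rule lin_eq_tensor[OF _ _ _ _ _ gen[OF X] gen[OF Y]])
    show "(\<lambda>t. shuffle K A A (X \<union> Y) (T_mult K (A \<boxtimes> A) X Y t))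
        \<in> lin (T K (A \<boxtimes> A) X \<boxtimes> T K (A \<boxtimes> A) Y) (T K A (X \<union> Y) \<boxtimes> T K A (X \<union> Y))"
      by (rule lin_comp[OF lins(2,5)])
    show "(\<lambda>t. tmap K (T K A (X \<union> Y)) (T K A (X \<union> Y)) (T_mult K A X Y) (T_mult K A X Y)
      (mid_flip K (T K A X) (T K A X) (T K A Y) (T K A Y)
        (tmap K (T K A X \<boxtimes> T K A X) (T K A Y \<boxtimes> T K A Y) (shuffle K A A X) (shuffle K A A Y) t)))
        \<in> lin (T K (A \<boxtimes> A) X \<boxtimes> T K (A \<boxtimes> A) Y) (T K A (X \<union> Y) \<boxtimes> T K A (X \<union> Y))"
      by (rule lin_comp[OF lin_comp[OF tmap_lin[OF _ _ _ _ lins(3,4)] mid_flip_lin] tmap_lin[OF _ _ _ _ lins(1) lins(1)]])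
        (simp_all add: A)
    fix s t assume s: "s \<in> {tens K (A \<boxtimes> A) X v | v. v \<in> X \<rightarrow> ?P}" and t: "t \<in> {tens K (A \<boxtimes> A) Y v | v. v \<in> Y \<rightarrow> ?P}"
    from tens[OF s] obtain a b where ab: "a \<in> X \<rightarrow> carrier A" "b \<in> X \<rightarrow> carrier A"
      and s: "s = tens K (A \<boxtimes> A) X (\<lambda>z. pure K A A (a z) (b z))" by blast
    from tens[OF t] obtain c e where ce: "c \<in> Y \<rightarrow> carrier A" "e \<in> Y \<rightarrow> carrier A"
      and t: "t = tens K (A \<boxtimes> A) Y (\<lambda>z. pure K A A (c z) (e z))" by blast
    have p: "(\<lambda>z. pure K A A (a z) (b z)) \<in> X \<rightarrow> carrier (A \<boxtimes> A)"
      "(\<lambda>z. pure K A A (c z) (e z)) \<in> Y \<rightarrow> carrier (A \<boxtimes> A)" by (intro pure_family A ab ce)+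
    \<comment> \<open>Gluing two families of pure tensors amounts to gluing their left legs and
      their right legs separately.\<close>
    have "glue X (\<lambda>z. pure K A A (a z) (b z)) (\<lambda>z. pure K A A (c z) (e z)) =
        (\<lambda>z. pure K A A (glue X a c z) (glue X b e z))"
      by (auto simp: glue_def fun_eq_iff)
    then show "shuffle K A A (X \<union> Y) (T_mult K (A \<boxtimes> A) X Y (pure K (T K (A \<boxtimes> A) X) (T K (A \<boxtimes> A) Y) s t)) =
      tmap K (T K A (X \<union> Y)) (T K A (X \<union> Y)) (T_mult K A X Y) (T_mult K A X Y)
      (mid_flip K (T K A X) (T K A X) (T K A Y) (T K A Y)
        (tmap K (T K A X \<boxtimes> T K A X) (T K A Y \<boxtimes> T K A Y) (shuffle K A A X) (shuffle K A A Y)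
          (pure K (T K (A \<boxtimes> A) X) (T K (A \<boxtimes> A) Y) s t)))"
      unfolding s t
      using ab ce p shuffle_tens[OF A A XY glue_carrier[OF ab(1) ce(1)] glue_carrier[OF ab(2) ce(2)]]
      by (simp add: A X Y d T_mult_tens shuffle_tens tmap_pure mid_flip_pure lins)
  qed (simp_all add: A)
qed

text \<open>On a family of pure tensors with legs \<open>a\<close> and \<open>b\<close>, both sides
  split \<open>a\<close> over \<open>X\<close> and \<open>Y\<close> and keep \<open>b\<close> whole.
  On the left, \<open>b\<close> is first split and then put together again by the product, which is
  the identity \<open>glue X b b = b\<close>.\<close>

lemma shuffle_comult:
  assumes A: "vectorspace K A" and X: "finite X" and Y: "finite Y" and d: "X \<inter> Y = {}"
  shows "\<forall>t\<in>carrier (T K (A \<boxtimes> A) (X \<union> Y)).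
    tmap K (T K A X \<boxtimes> T K A Y) (T K A (X \<union> Y)) id (T_mult K A X Y)
      (mid_flip K (T K A X) (T K A X) (T K A Y) (T K A Y)
        (tmap K (T K A X \<boxtimes> T K A X) (T K A Y \<boxtimes> T K A Y) (shuffle K A A X) (shuffle K A A Y)
          (T_comult K (A \<boxtimes> A) X Y t))) =
    tmap K (T K A X \<boxtimes> T K A Y) (T K A (X \<union> Y)) (T_comult K A X Y) id (shuffle K A A (X \<union> Y) t)"
proof (rule lin_eq_T_tensor[OF _ A A])
  have AA: "vectorspace K (A \<boxtimes> A)" using A by simp
  show XY: "finite (X \<union> Y)" using X Y by simp
  note lins = T_mult_lin[OF A d] T_comult_lin[OF AA d] shuffle_lin[OF A A X] shuffle_lin[OF A A Y]
    shuffle_lin[OF A A XY] T_comult_lin[OF A d] lin_id(2)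
  show "(\<lambda>t. tmap K (T K A X \<boxtimes> T K A Y) (T K A (X \<union> Y)) id (T_mult K A X Y)
      (mid_flip K (T K A X) (T K A X) (T K A Y) (T K A Y)
        (tmap K (T K A X \<boxtimes> T K A X) (T K A Y \<boxtimes> T K A Y) (shuffle K A A X) (shuffle K A A Y)
          (T_comult K (A \<boxtimes> A) X Y t))))
      \<in> lin (T K (A \<boxtimes> A) (X \<union> Y)) ((T K A X \<boxtimes> T K A Y) \<boxtimes> T K A (X \<union> Y))"
    by (rule lin_comp[OF lin_comp[OF lin_comp[OF lins(2) tmap_lin[OF _ _ _ _ lins(3,4)]] mid_flip_lin]
        tmap_lin[OF _ _ _ _ lins(7) lins(1)]]) (simp_all add: A)
  show "(\<lambda>t. tmap K (T K A X \<boxtimes> T K A Y) (T K A (X \<union> Y)) (T_comult K A X Y) id (shuffle K A A (X \<union> Y) t))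
      \<in> lin (T K (A \<boxtimes> A) (X \<union> Y)) ((T K A X \<boxtimes> T K A Y) \<boxtimes> T K A (X \<union> Y))"
    by (rule lin_comp[OF lins(5) tmap_lin[OF _ _ _ _ lins(6,7)]]) (simp_all add: A)
  fix a b assume a: "a \<in> X \<union> Y \<rightarrow> carrier A" and b: "b \<in> X \<union> Y \<rightarrow> carrier A"
  then have c: "a \<in> X \<rightarrow> carrier A" "a \<in> Y \<rightarrow> carrier A" "b \<in> X \<rightarrow> carrier A" "b \<in> Y \<rightarrow> carrier A" by auto
  have p: "(\<lambda>z. pure K A A (a z) (b z)) \<in> X \<union> Y \<rightarrow> carrier (A \<boxtimes> A)"
    "(\<lambda>z. pure K A A (a z) (b z)) \<in> X \<rightarrow> carrier (A \<boxtimes> A)"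
    "(\<lambda>z. pure K A A (a z) (b z)) \<in> Y \<rightarrow> carrier (A \<boxtimes> A)" by (intro pure_family A a b c)+
  have "glue X b b = b" by (auto simp: glue_def)
  then show "tmap K (T K A X \<boxtimes> T K A Y) (T K A (X \<union> Y)) id (T_mult K A X Y)
      (mid_flip K (T K A X) (T K A X) (T K A Y) (T K A Y)
        (tmap K (T K A X \<boxtimes> T K A X) (T K A Y \<boxtimes> T K A Y) (shuffle K A A X) (shuffle K A A Y)
          (T_comult K (A \<boxtimes> A) X Y (tens K (A \<boxtimes> A) (X \<union> Y) (\<lambda>x. pure K A A (a x) (b x)))))) =
    tmap K (T K A X \<boxtimes> T K A Y) (T K A (X \<union> Y)) (T_comult K A X Y) id
      (shuffle K A A (X \<union> Y) (tens K (A \<boxtimes> A) (X \<union> Y) (\<lambda>x. pure K A A (a x) (b x))))"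
    using c p(2,3) tens_carrier[OF A a] tens_carrier[OF A b] T_comult_tens[OF A d a] T_mult_tens[OF A d c(3,4)]
    by (simp add: A X Y T_comult_tens[OF AA d p(1)] shuffle_tens[OF A A XY a b] shuffle_tens
      tmap_pure mid_flip_pure lins)
qed (simp add: A)

text \<open>Coherence of the reshuffling with associators: both sides collect the three legs of the
  slots into three tensors, bracketed to the right. It converts an associator inside every slot into
  one between spaces of tensors.\<close>

lemma shuffle_assoc:
  assumes A: "vectorspace K A" and X: "finite X"
  shows "\<forall>t\<in>carrier (T K ((A \<boxtimes> A) \<boxtimes> A) X).
    tassoc K (T K A X) (T K A X) (T K A X)
      (tmap K (T K A X \<boxtimes> T K A X) (T K A X) (shuffle K A A X) id (shuffle K (A \<boxtimes> A) A X t)) =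
    tmap K (T K A X) (T K A X \<boxtimes> T K A X) id (shuffle K A A X)
      (shuffle K A (A \<boxtimes> A) X (T_map K (A \<boxtimes> (A \<boxtimes> A)) X (tassoc K A A A) t))"
proof (rule lin_eq_T_tensor3[OF X A A A])
  have AA: "vectorspace K (A \<boxtimes> A)" using A by simp
  have as: "tassoc K A A A \<in> lin ((A \<boxtimes> A) \<boxtimes> A) (A \<boxtimes> (A \<boxtimes> A))" by (rule tassoc_lin[OF A A A])
  have map: "T_map K (A \<boxtimes> (A \<boxtimes> A)) X (tassoc K A A A) \<in> lin (T K ((A \<boxtimes> A) \<boxtimes> A) X) (T K (A \<boxtimes> (A \<boxtimes> A)) X)"
    by (rule T_map_lin[OF _ _ as]) (simp_all add: A)
  note lins = shuffle_lin[OF A A X] shuffle_lin[OF AA A X] shuffle_lin[OF A AA X] lin_id(2)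
  show "(\<lambda>t. tassoc K (T K A X) (T K A X) (T K A X)
      (tmap K (T K A X \<boxtimes> T K A X) (T K A X) (shuffle K A A X) id (shuffle K (A \<boxtimes> A) A X t)))
      \<in> lin (T K ((A \<boxtimes> A) \<boxtimes> A) X) (T K A X \<boxtimes> (T K A X \<boxtimes> T K A X))"
    by (rule lin_comp[OF lin_comp[OF lins(2) tmap_lin[OF _ _ _ _ lins(1,4)]] tassoc_lin]) (simp_all add: A)
  show "(\<lambda>t. tmap K (T K A X) (T K A X \<boxtimes> T K A X) id (shuffle K A A X)
      (shuffle K A (A \<boxtimes> A) X (T_map K (A \<boxtimes> (A \<boxtimes> A)) X (tassoc K A A A) t)))
      \<in> lin (T K ((A \<boxtimes> A) \<boxtimes> A) X) (T K A X \<boxtimes> (T K A X \<boxtimes> T K A X))"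
    by (rule lin_comp[OF lin_comp[OF map lins(3)] tmap_lin[OF _ _ _ _ lins(4,1)]]) (simp_all add: A)
  fix a b c assume abc: "a \<in> X \<rightarrow> carrier A" "b \<in> X \<rightarrow> carrier A" "c \<in> X \<rightarrow> carrier A"
  then have p: "(\<lambda>x. pure K A A (a x) (b x)) \<in> X \<rightarrow> carrier (A \<boxtimes> A)"
    "(\<lambda>x. pure K A A (b x) (c x)) \<in> X \<rightarrow> carrier (A \<boxtimes> A)"
    "(\<lambda>x. pure K (A \<boxtimes> A) A (pure K A A (a x) (b x)) (c x)) \<in> X \<rightarrow> carrier ((A \<boxtimes> A) \<boxtimes> A)"
    by (intro pure_family A AA abc)+
  have "tens K (A \<boxtimes> (A \<boxtimes> A)) X (\<lambda>x. tassoc K A A A (pure K (A \<boxtimes> A) A (pure K A A (a x) (b x)) (c x))) =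
      tens K (A \<boxtimes> (A \<boxtimes> A)) X (\<lambda>x. pure K A (A \<boxtimes> A) (a x) (pure K A A (b x) (c x)))"
    using abc by (intro tens_cong tassoc_pure A) auto
  then show "tassoc K (T K A X) (T K A X) (T K A X)
      (tmap K (T K A X \<boxtimes> T K A X) (T K A X) (shuffle K A A X) id (shuffle K (A \<boxtimes> A) A X
        (tens K ((A \<boxtimes> A) \<boxtimes> A) X (\<lambda>x. pure K (A \<boxtimes> A) A (pure K A A (a x) (b x)) (c x))))) =
    tmap K (T K A X) (T K A X \<boxtimes> T K A X) id (shuffle K A A X)
      (shuffle K A (A \<boxtimes> A) X (T_map K (A \<boxtimes> (A \<boxtimes> A)) X (tassoc K A A A)
        (tens K ((A \<boxtimes> A) \<boxtimes> A) X (\<lambda>x. pure K (A \<boxtimes> A) A (pure K A A (a x) (b x)) (c x)))))"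
    using abc p
    by (simp add: A X T_map_tens[OF _ _ as p(3)] shuffle_tens[OF AA A X p(1) abc(3)]
      shuffle_tens[OF A AA X abc(1) p(2)] shuffle_tens[OF A A X] tmap_pure lins tassoc_pure)
qed (simp_all add: A)

section \<open>The coalgebra structure on each space of tensors\<close>

context
  fixes V :: "('k, 'v) module" and \<delta>V :: "'v \<Rightarrow> ('v \<times> 'v \<Rightarrow> 'k) set" and \<epsilon>V :: "'v \<Rightarrow> 'k"
  assumes coalg: "coalgebra K V \<delta>V \<epsilon>V"
begin

interpretation co: coalgebra K V \<delta>V \<epsilon>V by (rule coalg)

lemma vs_V [simp]: "vectorspace K V" by (rule co.vs)

lemma vs_VV: "vectorspace K (V \<boxtimes> V)" by simp

lemma T_map_coproduct_lin: "T_map K (V \<boxtimes> V) X \<delta>V \<in> lin (T K V X) (T K (V \<boxtimes> V) X)"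
  by (rule T_map_lin[OF vs_V vs_VV co.coproduct_hom])

lemma T_map_coproduct_tens:
  "v \<in> X \<rightarrow> carrier V \<Longrightarrow> T_map K (V \<boxtimes> V) X \<delta>V (tens K V X v) = tens K (V \<boxtimes> V) X (\<lambda>x. \<delta>V (v x))"
  by (rule T_map_tens[OF vs_V vs_VV co.coproduct_hom])

lemma coproduct_carrier: "v \<in> X \<rightarrow> carrier V \<Longrightarrow> (\<lambda>x. \<delta>V (v x)) \<in> X \<rightarrow> carrier (V \<boxtimes> V)"
  using lin_closed[OF co.coproduct_hom] by auto

lemma T_coproduct_lin: "finite X \<Longrightarrow> T_coproduct K V \<delta>V X \<in> lin (T K V X) (T K V X \<boxtimes> T K V X)"
  using lin_comp[OF T_map_coproduct_lin shuffle_lin[OF vs_V vs_V]] by (simp add: T_coproduct_def[abs_def])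

lemma T_eps_multilin:
  assumes X: "finite X"
  shows "multilin X V (self_vs K) (\<lambda>v. \<Otimes>x\<in>X. \<epsilon>V (v x))"
proof (rule multilinI)
  have e: "\<epsilon>V a \<in> carrier K" if "a \<in> carrier V" for a
    using lin_closed[OF co.counit_hom that] by simp
  fix v assume v: "v \<in> X \<rightarrow> carrier V"
  then show "(\<Otimes>x\<in>X. \<epsilon>V (v x)) \<in> carrier (self_vs K)" using e by (auto intro!: finprod_closed)
  show "(\<Otimes>x\<in>X. \<epsilon>V (restrict v X x)) = (\<Otimes>x\<in>X. \<epsilon>V (v x))"
    using v e by (intro finprod_cong') auto
  fix x assume x: "x \<in> X"
  \<comment> \<open>The product over the other slots is a constant as slot \<open>x\<close> varies,
    so the map in that slot is a multiple of \<open>\<epsilon>V\<close>.\<close>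
  let ?r = "\<Otimes>z\<in>X - {x}. \<epsilon>V (v z)"
  have r: "?r \<in> carrier K" using v e by (auto intro!: finprod_closed)
  have eq: "(\<Otimes>z\<in>X. \<epsilon>V ((v(x := a)) z)) = ?r \<otimes> \<epsilon>V a" if a: "a \<in> carrier V" for a
  proof -
    have c: "\<epsilon>V ((v(x := a)) z) \<in> carrier K" if "z \<in> insert x X" for z using that a v by (intro e) auto
    have "(\<Otimes>z\<in>insert x (X - {x}). \<epsilon>V ((v(x := a)) z)) = \<epsilon>V a \<otimes> (\<Otimes>z\<in>X - {x}. \<epsilon>V ((v(x := a)) z))"
      using X a e c by (subst finprod_insert) (auto simp del: fun_upd_apply simp: fun_upd_same)
    moreover have "(\<Otimes>z\<in>X - {x}. \<epsilon>V ((v(x := a)) z)) = ?r"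
      using v e by (intro finprod_cong') auto
    ultimately show ?thesis using x r e[OF a] by (simp add: insert_absorb m_comm)
  qed
  from lin_scale[OF co.counit_hom self_vs r]
  show "(\<lambda>a. \<Otimes>z\<in>X. \<epsilon>V ((v(x := a)) z)) \<in> lin V (self_vs K)"
    by (rule lin_cong) (simp_all only: eq vs_V self_vs_simps)
qed

lemma T_eps_lin: "finite X \<Longrightarrow> T_eps K \<epsilon>V X \<in> lin (T K V X) (self_vs K)"
  unfolding T_eps_def by (intro T_lift(1) T_eps_multilin) auto

lemma T_eps_tens:
  "\<lbrakk>finite X; v \<in> X \<rightarrow> carrier V\<rbrakk> \<Longrightarrow> T_eps K \<epsilon>V X (tens K V X v) = (\<Otimes>x\<in>X. \<epsilon>V (v x))"
  unfolding T_eps_def by (rule T_lift(2)[OF vs_V self_vs T_eps_multilin])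

text \<open>Lets a coproduct applied to the left factor slip past an earlier reshuffling: on pure
  tensors, \<open>\<delta>V\<close> may act on the left leg of every slot before the legs are
  collected. Both uses of \<open>\<delta>V\<close> in coassociativity thereby become
  slotwise.\<close>

lemma T_coproduct_left:
  assumes X: "finite X"
  shows "\<forall>t\<in>carrier (T K (V \<boxtimes> V) X).
    tmap K (T K V X \<boxtimes> T K V X) (T K V X) (T_coproduct K V \<delta>V X) id (shuffle K V V X t) =
    tmap K (T K V X \<boxtimes> T K V X) (T K V X) (shuffle K V V X) id (shuffle K (V \<boxtimes> V) V X
      (T_map K ((V \<boxtimes> V) \<boxtimes> V) X (tmap K (V \<boxtimes> V) V \<delta>V id) t))"
proof (rule lin_eq_T_tensor[OF X vs_V vs_V])
  have f: "tmap K (V \<boxtimes> V) V \<delta>V id \<in> lin (V \<boxtimes> V) ((V \<boxtimes> V) \<boxtimes> V)"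
    by (rule tmap_lin[OF _ _ _ _ co.coproduct_hom lin_id(2)]) simp_all
  have Tf: "T_map K ((V \<boxtimes> V) \<boxtimes> V) X (tmap K (V \<boxtimes> V) V \<delta>V id) \<in> lin (T K (V \<boxtimes> V) X) (T K ((V \<boxtimes> V) \<boxtimes> V) X)"
    by (rule T_map_lin[OF _ _ f]) simp_all
  note lins = T_coproduct_lin[OF X] shuffle_lin[OF vs_V vs_V X] shuffle_lin[OF vs_VV vs_V X] lin_id(2)
  show "(\<lambda>t. tmap K (T K V X \<boxtimes> T K V X) (T K V X) (T_coproduct K V \<delta>V X) id (shuffle K V V X t))
      \<in> lin (T K (V \<boxtimes> V) X) ((T K V X \<boxtimes> T K V X) \<boxtimes> T K V X)"
    by (rule lin_comp[OF lins(2) tmap_lin[OF _ _ _ _ lins(1,4)]]) simp_all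
  show "(\<lambda>t. tmap K (T K V X \<boxtimes> T K V X) (T K V X) (shuffle K V V X) id (shuffle K (V \<boxtimes> V) V X
      (T_map K ((V \<boxtimes> V) \<boxtimes> V) X (tmap K (V \<boxtimes> V) V \<delta>V id) t)))
      \<in> lin (T K (V \<boxtimes> V) X) ((T K V X \<boxtimes> T K V X) \<boxtimes> T K V X)"
    by (rule lin_comp[OF lin_comp[OF Tf lins(3)] tmap_lin[OF _ _ _ _ lins(2,4)]]) simp_all
  fix a b assume a: "a \<in> X \<rightarrow> carrier V" and b: "b \<in> X \<rightarrow> carrier V"
  have p: "(\<lambda>x. pure K V V (a x) (b x)) \<in> X \<rightarrow> carrier (V \<boxtimes> V)" by (rule pure_family[OF vs_V vs_V a b])
  have "tens K ((V \<boxtimes> V) \<boxtimes> V) X (\<lambda>x. tmap K (V \<boxtimes> V) V \<delta>V id (pure K V V (a x) (b x))) =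
      tens K ((V \<boxtimes> V) \<boxtimes> V) X (\<lambda>x. pure K (V \<boxtimes> V) V (\<delta>V (a x)) (b x))"
    using a b by (intro tens_cong) (simp add: tmap_pure co.coproduct_hom lin_id Pi_iff)
  then show "tmap K (T K V X \<boxtimes> T K V X) (T K V X) (T_coproduct K V \<delta>V X) id
      (shuffle K V V X (tens K (V \<boxtimes> V) X (\<lambda>x. pure K V V (a x) (b x)))) =
    tmap K (T K V X \<boxtimes> T K V X) (T K V X) (shuffle K V V X) id (shuffle K (V \<boxtimes> V) V X
      (T_map K ((V \<boxtimes> V) \<boxtimes> V) X (tmap K (V \<boxtimes> V) V \<delta>V id) (tens K (V \<boxtimes> V) X (\<lambda>x. pure K V V (a x) (b x)))))"
    using a b coproduct_carrier[OF a]
    by (simp add: shuffle_tens[OF vs_V vs_V X] shuffle_tens[OF vs_VV vs_V X] T_map_tens[OF _ _ f p] tmap_pure lins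
      T_coproduct_def T_map_coproduct_tens)
qed simp

text \<open>Mirror image of \<open>T_coproduct_left\<close>, with \<open>\<delta>V\<close> acting on
  the right legs.\<close>

lemma T_coproduct_right:
  assumes X: "finite X"
  shows "\<forall>t\<in>carrier (T K (V \<boxtimes> V) X).
    tmap K (T K V X) (T K V X \<boxtimes> T K V X) id (T_coproduct K V \<delta>V X) (shuffle K V V X t) =
    tmap K (T K V X) (T K V X \<boxtimes> T K V X) id (shuffle K V V X) (shuffle K V (V \<boxtimes> V) X
      (T_map K (V \<boxtimes> (V \<boxtimes> V)) X (tmap K V (V \<boxtimes> V) id \<delta>V) t))"
proof (rule lin_eq_T_tensor[OF X vs_V vs_V])
  have f: "tmap K V (V \<boxtimes> V) id \<delta>V \<in> lin (V \<boxtimes> V) (V \<boxtimes> (V \<boxtimes> V))"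
    by (rule tmap_lin[OF _ _ _ _ lin_id(2) co.coproduct_hom]) simp_all
  have Tf: "T_map K (V \<boxtimes> (V \<boxtimes> V)) X (tmap K V (V \<boxtimes> V) id \<delta>V) \<in> lin (T K (V \<boxtimes> V) X) (T K (V \<boxtimes> (V \<boxtimes> V)) X)"
    by (rule T_map_lin[OF _ _ f]) simp_all
  note lins = T_coproduct_lin[OF X] shuffle_lin[OF vs_V vs_V X] shuffle_lin[OF vs_V vs_VV X] lin_id(2)
  show "(\<lambda>t. tmap K (T K V X) (T K V X \<boxtimes> T K V X) id (T_coproduct K V \<delta>V X) (shuffle K V V X t))
      \<in> lin (T K (V \<boxtimes> V) X) (T K V X \<boxtimes> (T K V X \<boxtimes> T K V X))"
    by (rule lin_comp[OF lins(2) tmap_lin[OF _ _ _ _ lins(4,1)]]) simp_all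
  show "(\<lambda>t. tmap K (T K V X) (T K V X \<boxtimes> T K V X) id (shuffle K V V X) (shuffle K V (V \<boxtimes> V) X
      (T_map K (V \<boxtimes> (V \<boxtimes> V)) X (tmap K V (V \<boxtimes> V) id \<delta>V) t)))
      \<in> lin (T K (V \<boxtimes> V) X) (T K V X \<boxtimes> (T K V X \<boxtimes> T K V X))"
    by (rule lin_comp[OF lin_comp[OF Tf lins(3)] tmap_lin[OF _ _ _ _ lins(4,2)]]) simp_all
  fix a b assume a: "a \<in> X \<rightarrow> carrier V" and b: "b \<in> X \<rightarrow> carrier V"
  have p: "(\<lambda>x. pure K V V (a x) (b x)) \<in> X \<rightarrow> carrier (V \<boxtimes> V)" by (rule pure_family[OF vs_V vs_V a b])
  have "tens K (V \<boxtimes> (V \<boxtimes> V)) X (\<lambda>x. tmap K V (V \<boxtimes> V) id \<delta>V (pure K V V (a x) (b x))) =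
      tens K (V \<boxtimes> (V \<boxtimes> V)) X (\<lambda>x. pure K V (V \<boxtimes> V) (a x) (\<delta>V (b x)))"
    using a b by (intro tens_cong) (simp add: tmap_pure co.coproduct_hom lin_id Pi_iff)
  then show "tmap K (T K V X) (T K V X \<boxtimes> T K V X) id (T_coproduct K V \<delta>V X)
      (shuffle K V V X (tens K (V \<boxtimes> V) X (\<lambda>x. pure K V V (a x) (b x)))) =
    tmap K (T K V X) (T K V X \<boxtimes> T K V X) id (shuffle K V V X) (shuffle K V (V \<boxtimes> V) X
      (T_map K (V \<boxtimes> (V \<boxtimes> V)) X (tmap K V (V \<boxtimes> V) id \<delta>V) (tens K (V \<boxtimes> V) X (\<lambda>x. pure K V V (a x) (b x)))))"
    using a b coproduct_carrier[OF b]
    by (simp add: shuffle_tens[OF vs_V vs_V X] shuffle_tens[OF vs_V vs_VV X] T_map_tens[OF _ _ f p] tmap_pure lins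
      T_coproduct_def T_map_coproduct_tens)
qed simp

lemma T_coproduct_coassoc:
  assumes X: "finite X"
  shows "\<forall>t\<in>carrier (T K V X).
    tassoc K (T K V X) (T K V X) (T K V X)
      (tmap K (T K V X \<boxtimes> T K V X) (T K V X) (T_coproduct K V \<delta>V X) id (T_coproduct K V \<delta>V X t)) =
    tmap K (T K V X) (T K V X \<boxtimes> T K V X) id (T_coproduct K V \<delta>V X) (T_coproduct K V \<delta>V X t)"
proof
  let ?l = "tmap K (V \<boxtimes> V) V \<delta>V id" and ?r = "tmap K V (V \<boxtimes> V) id \<delta>V"
  let ?L = "T_map K ((V \<boxtimes> V) \<boxtimes> V) X ?l" and ?R = "T_map K (V \<boxtimes> (V \<boxtimes> V)) X ?r"
  let ?D = "T_map K (V \<boxtimes> V) X \<delta>V" and ?A = "T_map K (V \<boxtimes> (V \<boxtimes> V)) X (tassoc K V V V)"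
  have l: "?l \<in> lin (V \<boxtimes> V) ((V \<boxtimes> V) \<boxtimes> V)"
    by (rule tmap_lin[OF _ _ _ _ co.coproduct_hom lin_id(2)]) simp_all
  have r: "?r \<in> lin (V \<boxtimes> V) (V \<boxtimes> (V \<boxtimes> V))"
    by (rule tmap_lin[OF _ _ _ _ lin_id(2) co.coproduct_hom]) simp_all
  have as: "tassoc K V V V \<in> lin ((V \<boxtimes> V) \<boxtimes> V) (V \<boxtimes> (V \<boxtimes> V))" by (rule tassoc_lin) simp_all
  have L: "?L \<in> lin (T K (V \<boxtimes> V) X) (T K ((V \<boxtimes> V) \<boxtimes> V) X)" by (rule T_map_lin[OF _ _ l]) simp_all
  have R: "?R \<in> lin (T K (V \<boxtimes> V) X) (T K (V \<boxtimes> (V \<boxtimes> V)) X)" by (rule T_map_lin[OF _ _ r]) simp_all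
  have AS: "?A \<in> lin (T K ((V \<boxtimes> V) \<boxtimes> V) X) (T K (V \<boxtimes> (V \<boxtimes> V)) X)" by (rule T_map_lin[OF _ _ as]) simp_all
  \<comment> \<open>Coassociativity of \<open>\<delta>V\<close> inside every slot, before any legs
    are collected.\<close>
  have "\<forall>t\<in>carrier (T K V X). ?A (?L (?D t)) = ?R (?D t)"
  proof (rule lin_eq_T[OF X vs_V])
    show "(\<lambda>t. ?A (?L (?D t))) \<in> lin (T K V X) (T K (V \<boxtimes> (V \<boxtimes> V)) X)"
      by (rule lin_comp[OF lin_comp[OF T_map_coproduct_lin L] AS])
    show "(\<lambda>t. ?R (?D t)) \<in> lin (T K V X) (T K (V \<boxtimes> (V \<boxtimes> V)) X)"
      by (rule lin_comp[OF T_map_coproduct_lin R])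
    fix v assume v: "v \<in> X \<rightarrow> carrier V"
    have d: "(\<lambda>x. \<delta>V (v x)) \<in> X \<rightarrow> carrier (V \<boxtimes> V)" by (rule coproduct_carrier[OF v])
    then have ld: "(\<lambda>x. ?l (\<delta>V (v x))) \<in> X \<rightarrow> carrier ((V \<boxtimes> V) \<boxtimes> V)" using lin_closed[OF l] by auto
    have "tens K (V \<boxtimes> (V \<boxtimes> V)) X (\<lambda>x. tassoc K V V V (?l (\<delta>V (v x)))) =
        tens K (V \<boxtimes> (V \<boxtimes> V)) X (\<lambda>x. ?r (\<delta>V (v x)))"
      using v by (intro tens_cong co.coassoc) auto
    then show "?A (?L (?D (tens K V X v))) = ?R (?D (tens K V X v))"
      by (simp add: T_map_coproduct_tens[OF v] T_map_tens[OF _ _ l d] T_map_tens[OF _ _ r d] T_map_tens[OF _ _ as ld])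
  qed simp
  moreover fix t assume t: "t \<in> carrier (T K V X)"
  moreover have D: "?D t \<in> carrier (T K (V \<boxtimes> V) X)" by (rule lin_closed[OF T_map_coproduct_lin t])
  moreover have "?L (?D t) \<in> carrier (T K ((V \<boxtimes> V) \<boxtimes> V) X)" by (rule lin_closed[OF L D])
  ultimately show "tassoc K (T K V X) (T K V X) (T K V X)
      (tmap K (T K V X \<boxtimes> T K V X) (T K V X) (T_coproduct K V \<delta>V X) id (T_coproduct K V \<delta>V X t)) =
    tmap K (T K V X) (T K V X \<boxtimes> T K V X) id (T_coproduct K V \<delta>V X) (T_coproduct K V \<delta>V X t)"
    \<comment> \<open>Only the inner coproduct, applied to \<open>t\<close>, is unfolded. The outer
      ones are moved into the slots by \<open>T_coproduct_left\<close> and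
      \<open>T_coproduct_right\<close>; on the left side \<open>shuffle_assoc\<close> then moves the
      associator into the slots, where the slotwise identity applies.\<close>
    unfolding T_coproduct_def[of K V \<delta>V X t]
    using T_coproduct_left[OF X] T_coproduct_right[OF X] shuffle_assoc[OF vs_V X] by simp
qed

lemma T_coproduct_counit_left:
  assumes X: "finite X"
  shows "\<forall>t\<in>carrier (T K V X).
    lunit K (T K V X) (tmap K (self_vs K) (T K V X) (T_eps K \<epsilon>V X) id (T_coproduct K V \<delta>V X t)) = t"
proof
  \<comment> \<open>The contraction of \<open>V \<otimes> V\<close> to \<open>V\<close> by the
    counit on the left leg; by \<open>counit_left\<close> it undoes
    \<open>\<delta>V\<close>.\<close>
  let ?e = "\<lambda>u. lunit K V (tmap K (self_vs K) V \<epsilon>V id u)"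
  let ?E = "T_map K V X ?e" and ?D = "T_map K (V \<boxtimes> V) X \<delta>V"
  have e: "?e \<in> lin (V \<boxtimes> V) V"
    by (rule lin_comp[OF tmap_lin[OF _ _ _ _ co.counit_hom lin_id(2)] lunit_lin]) simp_all
  have E: "?E \<in> lin (T K (V \<boxtimes> V) X) (T K V X)" by (rule T_map_lin[OF vs_VV vs_V e])
  \<comment> \<open>Contracting once with \<open>T_eps\<close> after the reshuffling equals
    contracting in every slot: the scalars \<open>\<epsilon>V (a x)\<close> leave the slots as a
    product, by \<open>tens_scale\<close>.\<close>
  have 1: "\<forall>t\<in>carrier (T K (V \<boxtimes> V) X).
    lunit K (T K V X) (tmap K (self_vs K) (T K V X) (T_eps K \<epsilon>V X) id (shuffle K V V X t)) = ?E t"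
  proof (rule lin_eq_T_tensor[OF X vs_V vs_V _ _ E])
    show "(\<lambda>t. lunit K (T K V X) (tmap K (self_vs K) (T K V X) (T_eps K \<epsilon>V X) id (shuffle K V V X t)))
        \<in> lin (T K (V \<boxtimes> V) X) (T K V X)"
      by (rule lin_comp[OF lin_comp[OF shuffle_lin[OF vs_V vs_V X] tmap_lin[OF _ _ _ _ T_eps_lin[OF X] lin_id(2)]] lunit_lin])
        simp_all
    fix a b assume a: "a \<in> X \<rightarrow> carrier V" and b: "b \<in> X \<rightarrow> carrier V"
    have p: "(\<lambda>x. pure K V V (a x) (b x)) \<in> X \<rightarrow> carrier (V \<boxtimes> V)" by (rule pure_family[OF vs_V vs_V a b])
    have ea: "(\<lambda>x. \<epsilon>V (a x)) \<in> X \<rightarrow> carrier K" using a lin_closed[OF co.counit_hom] by auto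
    have "tens K V X (\<lambda>x. ?e (pure K V V (a x) (b x))) = tens K V X (\<lambda>x. \<epsilon>V (a x) \<odot>\<^bsub>V\<^esub> b x)"
      using a b ea by (intro tens_cong) (auto simp: tmap_pure co.counit_hom lin_id lunit_pure Pi_iff)
    then show "lunit K (T K V X) (tmap K (self_vs K) (T K V X) (T_eps K \<epsilon>V X) id
        (shuffle K V V X (tens K (V \<boxtimes> V) X (\<lambda>x. pure K V V (a x) (b x))))) =
      ?E (tens K (V \<boxtimes> V) X (\<lambda>x. pure K V V (a x) (b x)))"
      using a b ea
      by (simp add: T_map_tens[OF vs_VV vs_V e p] shuffle_tens[OF vs_V vs_V X] tmap_pure T_eps_lin[OF X] lin_id
        T_eps_tens[OF X] lunit_pure tens_scale[OF vs_V X])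
  qed simp
  have 2: "\<forall>t\<in>carrier (T K V X). ?E (?D t) = t"
  proof (rule lin_eq_T[OF X vs_V _ lin_comp[OF T_map_coproduct_lin E] lin_id(1)])
    fix v assume v: "v \<in> X \<rightarrow> carrier V"
    have "tens K V X (\<lambda>x. ?e (\<delta>V (v x))) = tens K V X v"
      using v by (intro tens_cong co.counit_left) auto
    then show "?E (?D (tens K V X v)) = tens K V X v"
      by (simp add: T_map_coproduct_tens[OF v] T_map_tens[OF vs_VV vs_V e coproduct_carrier[OF v]])
  qed simp
  fix t assume t: "t \<in> carrier (T K V X)"
  then show "lunit K (T K V X) (tmap K (self_vs K) (T K V X) (T_eps K \<epsilon>V X) id (T_coproduct K V \<delta>V X t)) = t"
    using 1 2 lin_closed[OF T_map_coproduct_lin t] by (simp add: T_coproduct_def)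
qed

text \<open>As on the left, with the scalars now coming from the right legs
  \<open>b x\<close>.\<close>

lemma T_coproduct_counit_right:
  assumes X: "finite X"
  shows "\<forall>t\<in>carrier (T K V X).
    runit K (T K V X) (tmap K (T K V X) (self_vs K) id (T_eps K \<epsilon>V X) (T_coproduct K V \<delta>V X t)) = t"
proof
  let ?e = "\<lambda>u. runit K V (tmap K V (self_vs K) id \<epsilon>V u)"
  let ?E = "T_map K V X ?e" and ?D = "T_map K (V \<boxtimes> V) X \<delta>V"
  have e: "?e \<in> lin (V \<boxtimes> V) V"
    by (rule lin_comp[OF tmap_lin[OF _ _ _ _ lin_id(2) co.counit_hom] runit_lin]) simp_all
  have E: "?E \<in> lin (T K (V \<boxtimes> V) X) (T K V X)" by (rule T_map_lin[OF vs_VV vs_V e])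
  have 1: "\<forall>t\<in>carrier (T K (V \<boxtimes> V) X).
    runit K (T K V X) (tmap K (T K V X) (self_vs K) id (T_eps K \<epsilon>V X) (shuffle K V V X t)) = ?E t"
  proof (rule lin_eq_T_tensor[OF X vs_V vs_V _ _ E])
    show "(\<lambda>t. runit K (T K V X) (tmap K (T K V X) (self_vs K) id (T_eps K \<epsilon>V X) (shuffle K V V X t)))
        \<in> lin (T K (V \<boxtimes> V) X) (T K V X)"
      by (rule lin_comp[OF lin_comp[OF shuffle_lin[OF vs_V vs_V X] tmap_lin[OF _ _ _ _ lin_id(2) T_eps_lin[OF X]]] runit_lin])
        simp_all
    fix a b assume a: "a \<in> X \<rightarrow> carrier V" and b: "b \<in> X \<rightarrow> carrier V"
    have p: "(\<lambda>x. pure K V V (a x) (b x)) \<in> X \<rightarrow> carrier (V \<boxtimes> V)" by (rule pure_family[OF vs_V vs_V a b])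
    have eb: "(\<lambda>x. \<epsilon>V (b x)) \<in> X \<rightarrow> carrier K" using b lin_closed[OF co.counit_hom] by auto
    have "tens K V X (\<lambda>x. ?e (pure K V V (a x) (b x))) = tens K V X (\<lambda>x. \<epsilon>V (b x) \<odot>\<^bsub>V\<^esub> a x)"
      using a b eb by (intro tens_cong) (auto simp: tmap_pure co.counit_hom lin_id runit_pure Pi_iff)
    then show "runit K (T K V X) (tmap K (T K V X) (self_vs K) id (T_eps K \<epsilon>V X)
        (shuffle K V V X (tens K (V \<boxtimes> V) X (\<lambda>x. pure K V V (a x) (b x))))) =
      ?E (tens K (V \<boxtimes> V) X (\<lambda>x. pure K V V (a x) (b x)))"
      using a b eb
      by (simp add: T_map_tens[OF vs_VV vs_V e p] shuffle_tens[OF vs_V vs_V X] tmap_pure T_eps_lin[OF X] lin_id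
        T_eps_tens[OF X] runit_pure tens_scale[OF vs_V X])
  qed simp
  have 2: "\<forall>t\<in>carrier (T K V X). ?E (?D t) = t"
  proof (rule lin_eq_T[OF X vs_V _ lin_comp[OF T_map_coproduct_lin E] lin_id(1)])
    fix v assume v: "v \<in> X \<rightarrow> carrier V"
    have "tens K V X (\<lambda>x. ?e (\<delta>V (v x))) = tens K V X v"
      using v by (intro tens_cong co.counit_right) auto
    then show "?E (?D (tens K V X v)) = tens K V X v"
      by (simp add: T_map_coproduct_tens[OF v] T_map_tens[OF vs_VV vs_V e coproduct_carrier[OF v]])
  qed simp
  fix t assume t: "t \<in> carrier (T K V X)"
  then show "runit K (T K V X) (tmap K (T K V X) (self_vs K) id (T_eps K \<epsilon>V X) (T_coproduct K V \<delta>V X t)) = t"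
    using 1 2 lin_closed[OF T_map_coproduct_lin t] by (simp add: T_coproduct_def)
qed

lemma T_coalgebra:
  "finite X \<Longrightarrow> coalgebra K (T K V X) (T_coproduct K V \<delta>V X) (T_eps K \<epsilon>V X)"
  by (rule coalgebra.intro) (simp_all add: T_coproduct_lin T_eps_lin T_coproduct_coassoc
    T_coproduct_counit_left T_coproduct_counit_right)

section \<open>Compatibility of the coproduct with the twisted bialgebra\<close>

lemma T_coproduct_natural:
  assumes X: "finite X" and \<sigma>: "bij_betw \<sigma> X Y" and t: "t \<in> carrier (T K V X)"
  shows "T_coproduct K V \<delta>V Y (T_act K V X \<sigma> t) =
    tmap K (T K V Y) (T K V Y) (T_act K V X \<sigma>) (T_act K V X \<sigma>) (T_coproduct K V \<delta>V X t)"
proof -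
  have "\<forall>t\<in>carrier (T K V X). T_map K (V \<boxtimes> V) Y \<delta>V (T_act K V X \<sigma> t) =
      T_act K (V \<boxtimes> V) X \<sigma> (T_map K (V \<boxtimes> V) X \<delta>V t)"
  proof (rule lin_eq_T[OF X vs_V _ lin_comp[OF T_act_lin[OF vs_V \<sigma>] T_map_coproduct_lin]
        lin_comp[OF T_map_coproduct_lin T_act_lin[OF vs_VV \<sigma>]]])
    fix v assume v: "v \<in> X \<rightarrow> carrier V"
    have "(\<lambda>y. v (inv_into X \<sigma> y)) \<in> Y \<rightarrow> carrier V"
      using v bij_betw_inv_into[OF \<sigma>] by (auto simp: bij_betw_def)
    then show "T_map K (V \<boxtimes> V) Y \<delta>V (T_act K V X \<sigma> (tens K V X v)) =
        T_act K (V \<boxtimes> V) X \<sigma> (T_map K (V \<boxtimes> V) X \<delta>V (tens K V X v))"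
      by (simp add: T_act_tens[OF vs_V \<sigma> v] T_map_coproduct_tens v T_act_tens[OF vs_VV \<sigma> coproduct_carrier[OF v]])
  qed simp
  then show ?thesis
    using t shuffle_act[OF vs_V X \<sigma>] lin_closed[OF T_map_coproduct_lin t] by (simp add: T_coproduct_def)
qed

lemma T_eps_natural:
  assumes X: "finite X" and \<sigma>: "bij_betw \<sigma> X Y"
  shows "\<forall>t\<in>carrier (T K V X). T_eps K \<epsilon>V Y (T_act K V X \<sigma> t) = T_eps K \<epsilon>V X t"
proof -
  have Y: "finite Y" using X \<sigma> by (simp add: bij_betw_finite)
  show ?thesis
  proof (rule lin_eq_T[OF X vs_V _ lin_comp[OF T_act_lin[OF vs_V \<sigma>] T_eps_lin[OF Y]] T_eps_lin[OF X]])
    fix v assume v: "v \<in> X \<rightarrow> carrier V"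
    have v': "(\<lambda>y. v (inv_into X \<sigma> y)) \<in> Y \<rightarrow> carrier V"
      using v bij_betw_inv_into[OF \<sigma>] by (auto simp: bij_betw_def)
    have e: "\<epsilon>V a \<in> carrier K" if "a \<in> carrier V" for a
      using lin_closed[OF co.counit_hom that] by simp
    have inj: "inj_on \<sigma> X" and im: "\<sigma> ` X = Y" using \<sigma> by (auto simp: bij_betw_def)
    have "(\<Otimes>y\<in>\<sigma> ` X. \<epsilon>V (v (inv_into X \<sigma> y))) = (\<Otimes>x\<in>X. \<epsilon>V (v (inv_into X \<sigma> (\<sigma> x))))"
      using v' e by (intro finprod_reindex inj) (auto simp: im)
    also have "\<dots> = (\<Otimes>x\<in>X. \<epsilon>V (v x))"
      using v e inj by (intro finprod_cong') auto
    finally show "T_eps K \<epsilon>V Y (T_act K V X \<sigma> (tens K V X v)) = T_eps K \<epsilon>V X (tens K V X v)"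
      by (simp add: T_act_tens[OF vs_V \<sigma> v] T_eps_tens[OF Y v'] T_eps_tens[OF X v] im)
  qed simp
qed

text \<open>Applying \<open>\<delta>V\<close> in every slot commutes with gluing families, so only
  the reshuffling interacts with the product, and there \<open>shuffle_mult\<close> applies.\<close>

lemma T_coproduct_mult:
  assumes X: "finite X" and Y: "finite Y" and d: "X \<inter> Y = {}" and t: "t \<in> carrier (T K V X \<boxtimes> T K V Y)"
  shows "T_coproduct K V \<delta>V (X \<union> Y) (T_mult K V X Y t) =
    tmap K (T K V (X \<union> Y)) (T K V (X \<union> Y)) (T_mult K V X Y) (T_mult K V X Y)
      (mid_flip K (T K V X) (T K V X) (T K V Y) (T K V Y)
        (tmap K (T K V X \<boxtimes> T K V X) (T K V Y \<boxtimes> T K V Y) (T_coproduct K V \<delta>V X) (T_coproduct K V \<delta>V Y) t))"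
proof -
  let ?D = "\<lambda>X. T_map K (V \<boxtimes> V) X \<delta>V"
  let ?DD = "tmap K (T K (V \<boxtimes> V) X) (T K (V \<boxtimes> V) Y) (?D X) (?D Y)"
  have DD: "?DD \<in> lin (T K V X \<boxtimes> T K V Y) (T K (V \<boxtimes> V) X \<boxtimes> T K (V \<boxtimes> V) Y)"
    by (rule tmap_lin[OF _ _ _ _ T_map_coproduct_lin T_map_coproduct_lin]) simp_all
  have "\<forall>t\<in>carrier (T K V X \<boxtimes> T K V Y). ?D (X \<union> Y) (T_mult K V X Y t) = T_mult K (V \<boxtimes> V) X Y (?DD t)"
  proof (rule lin_eq_T_T[OF X Y vs_V vs_V _ lin_comp[OF T_mult_lin[OF vs_V d] T_map_coproduct_lin]
        lin_comp[OF DD T_mult_lin[OF vs_VV d]]])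
    fix v w assume v: "v \<in> X \<rightarrow> carrier V" and w: "w \<in> Y \<rightarrow> carrier V"
    have "(\<lambda>x. \<delta>V (glue X v w x)) = glue X (\<lambda>x. \<delta>V (v x)) (\<lambda>x. \<delta>V (w x))"
      by (auto simp: glue_def fun_eq_iff)
    then show "?D (X \<union> Y) (T_mult K V X Y (pure K (T K V X) (T K V Y) (tens K V X v) (tens K V Y w))) =
      T_mult K (V \<boxtimes> V) X Y (?DD (pure K (T K V X) (T K V Y) (tens K V X v) (tens K V Y w)))"
      using v w
      by (simp add: T_mult_tens[OF vs_V d v w] T_map_coproduct_tens[OF glue_carrier[OF v w]] T_map_coproduct_tens
        tmap_pure T_map_coproduct_lin T_mult_tens[OF vs_VV d coproduct_carrier[OF v] coproduct_carrier[OF w]])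
  qed simp
  \<comment> \<open>The tensor product of two composites is separated into its slotwise part
    \<open>?DD\<close> and its reshuffling part.\<close>
  moreover have "tmap K (T K V X \<boxtimes> T K V X) (T K V Y \<boxtimes> T K V Y) (T_coproduct K V \<delta>V X) (T_coproduct K V \<delta>V Y) t =
      tmap K (T K V X \<boxtimes> T K V X) (T K V Y \<boxtimes> T K V Y) (shuffle K V V X) (shuffle K V V Y) (?DD t)"
    unfolding T_coproduct_def[abs_def]
    by (rule bspec[OF tmap_comp[OF _ _ _ _ _ _ T_map_coproduct_lin shuffle_lin[OF vs_V vs_V X]
        T_map_coproduct_lin shuffle_lin[OF vs_V vs_V Y]] t]) simp_all
  ultimately show ?thesis
    using t lin_closed[OF DD t] shuffle_mult[OF vs_V X Y d] by (simp add: T_coproduct_def[of _ _ _ "X \<union> Y"])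
qed

text \<open>The same separation as for the product: slotwise \<open>\<delta>V\<close> commutes with
  splitting a family, and \<open>shuffle_comult\<close> does the rest.\<close>

lemma T_comult_coproduct:
  assumes X: "finite X" and Y: "finite Y" and d: "X \<inter> Y = {}" and p: "p \<in> carrier (T K V (X \<union> Y))"
  shows "tmap K (T K V X \<boxtimes> T K V Y) (T K V (X \<union> Y)) id (T_mult K V X Y)
      (mid_flip K (T K V X) (T K V X) (T K V Y) (T K V Y)
        (tmap K (T K V X \<boxtimes> T K V X) (T K V Y \<boxtimes> T K V Y) (T_coproduct K V \<delta>V X) (T_coproduct K V \<delta>V Y)
          (T_comult K V X Y p))) =
    tmap K (T K V X \<boxtimes> T K V Y) (T K V (X \<union> Y)) (T_comult K V X Y) id (T_coproduct K V \<delta>V (X \<union> Y) p)"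
proof -
  let ?D = "\<lambda>X. T_map K (V \<boxtimes> V) X \<delta>V"
  let ?DD = "tmap K (T K (V \<boxtimes> V) X) (T K (V \<boxtimes> V) Y) (?D X) (?D Y)"
  have DD: "?DD \<in> lin (T K V X \<boxtimes> T K V Y) (T K (V \<boxtimes> V) X \<boxtimes> T K (V \<boxtimes> V) Y)"
    by (rule tmap_lin[OF _ _ _ _ T_map_coproduct_lin T_map_coproduct_lin]) simp_all
  have "\<forall>p\<in>carrier (T K V (X \<union> Y)). ?DD (T_comult K V X Y p) = T_comult K (V \<boxtimes> V) X Y (?D (X \<union> Y) p)"
  proof (rule lin_eq_T[OF _ vs_V _ lin_comp[OF T_comult_lin[OF vs_V d] DD]
        lin_comp[OF T_map_coproduct_lin T_comult_lin[OF vs_VV d]]])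
    fix v assume v: "v \<in> X \<union> Y \<rightarrow> carrier V"
    then have c: "v \<in> X \<rightarrow> carrier V" "v \<in> Y \<rightarrow> carrier V" by auto
    show "?DD (T_comult K V X Y (tens K V (X \<union> Y) v)) = T_comult K (V \<boxtimes> V) X Y (?D (X \<union> Y) (tens K V (X \<union> Y) v))"
      using c
      by (simp add: T_comult_tens[OF vs_V d v] T_map_coproduct_tens[OF v] T_comult_tens[OF vs_VV d coproduct_carrier[OF v]]
        tmap_pure T_map_coproduct_lin T_map_coproduct_tens)
  qed (simp_all add: X Y)
  moreover have "tmap K (T K V X \<boxtimes> T K V X) (T K V Y \<boxtimes> T K V Y) (T_coproduct K V \<delta>V X) (T_coproduct K V \<delta>V Y) (T_comult K V X Y p) =
      tmap K (T K V X \<boxtimes> T K V X) (T K V Y \<boxtimes> T K V Y) (shuffle K V V X) (shuffle K V V Y) (?DD (T_comult K V X Y p))"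
    unfolding T_coproduct_def[abs_def]
    by (rule bspec[OF tmap_comp[OF _ _ _ _ _ _ T_map_coproduct_lin shuffle_lin[OF vs_V vs_V X]
        T_map_coproduct_lin shuffle_lin[OF vs_V vs_V Y]] lin_closed[OF T_comult_lin[OF vs_V d] p]]) simp_all
  ultimately show ?thesis
    using p lin_closed[OF T_map_coproduct_lin p] shuffle_comult[OF vs_V X Y d]
    by (simp add: T_coproduct_def[of _ _ _ "X \<union> Y"])
qed

lemma T_coproduct_tens_empty:
  fixes v :: "'x \<Rightarrow> 'v"
  shows "T_coproduct K V \<delta>V {} (tens K V {} v) = pure K (T K V {}) (T K V {}) (T_unit K V) (T_unit K V)"
proof -
  \<comment> \<open>Over the empty index set all families give the same tensor; a family of pure
    tensors is substituted so that \<open>shuffle_tens\<close> applies.\<close>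
  have "tens K (V \<boxtimes> V) {} (\<lambda>x. \<delta>V (v x)) = tens K (V \<boxtimes> V) {} (\<lambda>x. pure K V V (v x) (v x))"
    by (rule tens_cong) simp
  then show ?thesis
    using shuffle_tens[OF vs_V vs_V, of "{}" v v]
    by (simp add: T_coproduct_def T_map_coproduct_tens) (simp add: tens_empty[OF vs_V])
qed

lemma T_counit_coproduct:
  "\<forall>p\<in>carrier (T K V ({} :: 'x set)). lunit K (T K V {}) (tmap K (self_vs K) (T K V {}) (T_counit K) id
    (T_coproduct K V \<delta>V {} p)) = T_counit K p \<odot>\<^bsub>T K V {}\<^esub> T_unit K V"
proof (rule lin_eq_T[OF _ vs_V])
  let ?O = "{} :: 'x set"
  interpret T: module K "T K V ?O" by (simp add: vs_module)
  show "(\<lambda>p. lunit K (T K V ?O) (tmap K (self_vs K) (T K V ?O) (T_counit K) id (T_coproduct K V \<delta>V ?O p)))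
      \<in> lin (T K V ?O) (T K V ?O)"
    by (rule lin_comp[OF lin_comp[OF T_coproduct_lin tmap_lin[OF _ _ _ _ T_counit_lin lin_id(2)]] lunit_lin])
      simp_all
  have u: "T_unit K V \<in> carrier (T K V ?O)" by (rule T_unit_carrier[OF vs_V])
  then have "(\<lambda>r. r \<odot>\<^bsub>T K V ?O\<^esub> T_unit K V) \<in> lin (self_vs K) (T K V ?O)"
    using smult_bilin[of "T K V ?O"] by (simp add: bilin_def)
  then show "(\<lambda>p. T_counit K p \<odot>\<^bsub>T K V ?O\<^esub> T_unit K V) \<in> lin (T K V ?O) (T K V ?O)"
    by (rule lin_comp[OF T_counit_lin[OF vs_V]])
  fix v :: "'x \<Rightarrow> 'v"
  show "lunit K (T K V ?O) (tmap K (self_vs K) (T K V ?O) (T_counit K) id (T_coproduct K V \<delta>V ?O (tens K V ?O v))) =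
    T_counit K (tens K V ?O v) \<odot>\<^bsub>T K V ?O\<^esub> T_unit K V"
    by (simp add: T_coproduct_tens_empty tmap_pure T_counit_lin lin_id lunit_pure T_counit_tens[OF vs_V]
      T_unit_def)
qed simp_all

lemma T_double_twisted_bialgebra:
  "double_twisted_bialgebra K (T K V :: 'x set \<Rightarrow> _) (T_act K V) (T_mult K V) (T_unit K V)
     (T_comult K V) (T_counit K) (T_coproduct K V \<delta>V) (T_eps K \<epsilon>V)"
proof (intro double_twisted_bialgebra.intro T_twisted_bialgebra[OF vs_V] double_twisted_bialgebra_axioms.intro)
  show "T_coproduct K V \<delta>V {} (T_unit K V) = pure K (T K V {}) (T K V {}) (T_unit K V) (T_unit K V :: (('x \<Rightarrow> 'v) \<Rightarrow> 'k) set)"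
    using T_coproduct_tens_empty by (simp add: T_unit_def)
qed (simp_all add: T_coalgebra T_coproduct_natural T_eps_natural T_coproduct_mult T_comult_coproduct
    T_counit_coproduct)

section \<open>The Sweedler formula and uniqueness\<close>

lemma T_coproduct_is_tensor_coproduct:
  fixes X :: "'x set"
  assumes X: "finite X"
  shows "is_tensor_coproduct K V \<delta>V X (T_coproduct K V \<delta>V X)"
  unfolding is_tensor_coproduct_def
proof (intro conjI allI impI T_coproduct_lin[OF X])
  fix v :: "'x \<Rightarrow> 'v" and n :: "'x \<Rightarrow> nat" and a b
  assume *: "\<forall>x\<in>X. v x \<in> carrier V \<and> (\<forall>i<n x. a x i \<in> carrier V \<and> b x i \<in> carrier V) \<and>
    \<delta>V (v x) = (\<Oplus>\<^bsub>V \<boxtimes> V\<^esub>i\<in>{..<n x}. pure K V V (a x i) (b x i))"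
  let ?F = "\<Pi>\<^sub>E x\<in>X. {..<n x}"
  let ?p = "\<lambda>f x. pure K V V (a x (f x)) (b x (f x))"
  interpret TT: abelian_group "T K V X \<boxtimes> T K V X" by (rule vs_group) simp
  have v: "v \<in> X \<rightarrow> carrier V" using * by auto
  have c: "(\<lambda>x. a x (f x)) \<in> X \<rightarrow> carrier V" "(\<lambda>x. b x (f x)) \<in> X \<rightarrow> carrier V" if "f \<in> ?F" for f
    using * that by (auto simp: PiE_iff)
  \<comment> \<open>The given expressions of the \<open>\<delta>V (v x)\<close> are inserted only
    here and expanded over all choices of summands. \<open>T_coproduct\<close> itself does not
    mention \<open>a\<close> and \<open>b\<close>, so the resulting sum has the same value for every
    such expression.\<close>
  have "tens K (V \<boxtimes> V) X (\<lambda>x. \<delta>V (v x)) = tens K (V \<boxtimes> V) X (\<lambda>x. \<Oplus>\<^bsub>V \<boxtimes> V\<^esub>i\<in>{..<n x}. pure K V V (a x i) (b x i))"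
    using * by (intro tens_cong) auto
  also have "\<dots> = (\<Oplus>\<^bsub>T K (V \<boxtimes> V) X\<^esub>f\<in>?F. tens K (V \<boxtimes> V) X (?p f))"
    using * by (intro tens_expand[OF vs_VV X]) auto
  finally have "T_coproduct K V \<delta>V X (tens K V X v) = shuffle K V V X (\<Oplus>\<^bsub>T K (V \<boxtimes> V) X\<^esub>f\<in>?F. tens K (V \<boxtimes> V) X (?p f))"
    by (simp add: T_coproduct_def T_map_coproduct_tens[OF v])
  also have "\<dots> = (\<Oplus>\<^bsub>T K V X \<boxtimes> T K V X\<^esub>f\<in>?F. shuffle K V V X (tens K (V \<boxtimes> V) X (?p f)))"
  proof (rule lin_finsum[OF shuffle_lin[OF vs_V vs_V X]])
    fix f assume "f \<in> ?F"
    from c[OF this] show "tens K (V \<boxtimes> V) X (?p f) \<in> carrier (T K (V \<boxtimes> V) X)"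
      by (intro tens_carrier pure_family vs_V vs_VV)
  qed simp_all
  also have "\<dots> = (\<Oplus>\<^bsub>T K V X \<boxtimes> T K V X\<^esub>f\<in>?F.
      pure K (T K V X) (T K V X) (tens K V X (\<lambda>x. a x (f x))) (tens K V X (\<lambda>x. b x (f x))))"
    using c by (intro TT.finsum_cong') (auto simp: shuffle_tens[OF vs_V vs_V X])
  finally show "T_coproduct K V \<delta>V X (tens K V X v) = \<dots>" .
qed

text \<open>Both maps take the value prescribed by the sum formula for one and the same expression
  of the \<open>\<delta>V (v x)\<close>, hence agree on the tensors that generate the space.\<close>

lemma is_tensor_coproduct_unique:
  assumes X: "finite X" and d: "is_tensor_coproduct K V \<delta>V X d" and d': "is_tensor_coproduct K V \<delta>V X d'"
  shows "\<forall>t\<in>carrier (T K V X). d t = d' t"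
proof (rule lin_eq_T[OF X vs_V])
  show "d \<in> lin (T K V X) (T K V X \<boxtimes> T K V X)" "d' \<in> lin (T K V X) (T K V X \<boxtimes> T K V X)"
    using d d' by (simp_all add: is_tensor_coproduct_def)
  fix v assume v: "v \<in> X \<rightarrow> carrier V"
  \<comment> \<open>Expressions exist slot by slot; three successive choices, of lengths, left legs
    and right legs, turn them into families indexed by \<open>X\<close>.\<close>
  have "\<forall>x\<in>X. \<exists>(n :: nat) a b. (\<forall>i<n. a i \<in> carrier V \<and> b i \<in> carrier V) \<and>
      \<delta>V (v x) = (\<Oplus>\<^bsub>V \<boxtimes> V\<^esub>i\<in>{..<n}. pure K V V (a i) (b i))"
    using coproduct_carrier[OF v] by (intro ballI tensor_sum_of_pure) auto
  then obtain n where "\<forall>x\<in>X. \<exists>a b. (\<forall>i<n x. a i \<in> carrier V \<and> b i \<in> carrier V) \<and>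
      \<delta>V (v x) = (\<Oplus>\<^bsub>V \<boxtimes> V\<^esub>i\<in>{..<n x :: nat}. pure K V V (a i) (b i))"
    by (rule bchoice[THEN exE])
  then obtain a where "\<forall>x\<in>X. \<exists>b. (\<forall>i<n x. a x i \<in> carrier V \<and> b i \<in> carrier V) \<and>
      \<delta>V (v x) = (\<Oplus>\<^bsub>V \<boxtimes> V\<^esub>i\<in>{..<n x}. pure K V V (a x i) (b i))"
    by (rule bchoice[THEN exE])
  then obtain b where "\<forall>x\<in>X. (\<forall>i<n x. a x i \<in> carrier V \<and> b x i \<in> carrier V) \<and>
      \<delta>V (v x) = (\<Oplus>\<^bsub>V \<boxtimes> V\<^esub>i\<in>{..<n x}. pure K V V (a x i) (b x i))"
    by (rule bchoice[THEN exE])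
  with v have *: "\<forall>x\<in>X. v x \<in> carrier V \<and> (\<forall>i<n x. a x i \<in> carrier V \<and> b x i \<in> carrier V) \<and>
      \<delta>V (v x) = (\<Oplus>\<^bsub>V \<boxtimes> V\<^esub>i\<in>{..<n x}. pure K V V (a x i) (b x i))"
    by (simp add: Pi_iff)
  note eq = is_tensor_coproduct_def[THEN iffD1, THEN conjunct2, THEN spec[of _ v], THEN spec[of _ n],
      THEN spec[of _ a], THEN spec[of _ b], THEN mp, OF _ *]
  show "d (tens K V X v) = d' (tens K V X v)"
    by (simp only: eq[OF d] eq[OF d'])
qed simp

end

end

theorem proposition1p8:
  fixes K :: "'k ring" and V :: "('k, 'v) module"
    and \<delta>V :: "'v \<Rightarrow> ('v \<times> 'v \<Rightarrow> 'k) set" and \<epsilon>V :: "'v \<Rightarrow> 'k"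
  assumes "field K" and "coalgebra K V \<delta>V \<epsilon>V"
  shows "\<exists>(\<delta> :: 'x set \<Rightarrow> (('x \<Rightarrow> 'v) \<Rightarrow> 'k) set
               \<Rightarrow> ((('x \<Rightarrow> 'v) \<Rightarrow> 'k) set \<times> (('x \<Rightarrow> 'v) \<Rightarrow> 'k) set \<Rightarrow> 'k) set)
           (\<epsilon> :: 'x set \<Rightarrow> (('x \<Rightarrow> 'v) \<Rightarrow> 'k) set \<Rightarrow> 'k).
      (\<forall>X. finite X \<longrightarrow> is_tensor_coproduct K V \<delta>V X (\<delta> X)) \<and>
      (\<forall>X d. finite X \<and> is_tensor_coproduct K V \<delta>V X d \<longrightarrow>
         (\<forall>t\<in>carrier (T K V X). d t = \<delta> X t)) \<and>
      double_twisted_bialgebra K (T K V) (T_act K V) (T_mult K V) (T_unit K V)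
        (T_comult K V) (T_counit K) \<delta> \<epsilon> \<and>
      (\<forall>X v. finite X \<and> (\<forall>x\<in>X. v x \<in> carrier V) \<longrightarrow>
         \<epsilon> X (tens K V X v) = (\<Otimes>\<^bsub>K\<^esub>x\<in>X. \<epsilon>V (v x)))"
proof -
  interpret ground_field K using assms(1) by (simp add: ground_field_def)
  note co = assms(2)
  show ?thesis
  \<comment> \<open>The witnesses \<open>T_coproduct K V \<delta>V\<close> and
    \<open>T_eps K \<epsilon>V\<close> are determined by unification with the facts shown
    below.\<close>
  proof (intro exI conjI allI impI)
    show "is_tensor_coproduct K V \<delta>V X (T_coproduct K V \<delta>V X)" if "finite X" for X :: "'x set"
      by (rule T_coproduct_is_tensor_coproduct[OF co that])
    show "\<forall>t\<in>carrier (T K V X). d t = T_coproduct K V \<delta>V X t"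
      if "finite X \<and> is_tensor_coproduct K V \<delta>V X d" for X :: "'x set" and d
      using that is_tensor_coproduct_unique[OF co _ _ T_coproduct_is_tensor_coproduct[OF co]] by blast
    show "double_twisted_bialgebra K (T K V) (T_act K V) (T_mult K V) (T_unit K V)
        (T_comult K V) (T_counit K) (T_coproduct K V \<delta>V :: 'x set \<Rightarrow> _) (T_eps K \<epsilon>V)"
      by (rule T_double_twisted_bialgebra[OF co])
    show "T_eps K \<epsilon>V X (tens K V X v) = (\<Otimes>\<^bsub>K\<^esub>x\<in>X. \<epsilon>V (v x))"
      if "finite X \<and> (\<forall>x\<in>X. v x \<in> carrier V)" for X :: "'x set" and v
      using that by (intro T_eps_tens[OF co]) auto
  qed
qed

end
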